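(* Let $X$ be a Banach space, $k$ a positive integer, $K\subset X$ a nonempty compact set, and $B_1(K)=\{x\in X:\inf_{y\in K}\|x-y\|\le 1\}$. Let $F:X\to X$ be a map that is continuous on $B_1(K)$ and restricts to a homeomorphism of $K$ onto $K$, and let $\mathcal T:B_1(K)\to L(X)$, $x\mapsto T_x$, be continuous. Assume that the linear cocycle $(F,\mathcal T)$ on $K\times X$ admits a $k$-exponential separation. Then there exist $\varepsilon_0>0$ and $\delta_0>0$, depending only on these unperturbed data, such that the following holds for all $\varepsilon\in[0,\varepsilon_0]$ and $\delta\in[0,\delta_0]$. Let $\tilde K\subset B_1(K)$ be a nonempty set, let $h:\tilde K\to K$ be a map, let $\tilde F$ be a map with values in $X$ that is continuous on $B_1(K)$ and restricts to a homeomorphism of $\tilde K$ onto $\tilde K$, and let $\mathcal G:\mathcal D(\mathcal G)\to L(X)$, $x\mapsto G_x$, be continuous with $B_1(K)\subset\mathcal D(\mathcal G)\subset X$. Suppose that $$\sup_{x\in\tilde K}\|h(x)-x\|\le\delta,\qquad \sup_{x\in B_1(K)}\|\tilde F(x)-F(x)\|\le\delta,\qquad \sup_{x\in B_1(K)}\|T_x-G_x\|_{L(X)}=\varepsilon .$$ Then the linear cocycle $(\tilde F,\mathcal G)$ on $\tilde K\times X$ admits a $k$-exponential separation. If in addition $\tilde K$ is compact, then $(\tilde F,\mathcal G)$ on $\tilde K\times X$ has the unique $k$-exponential separation.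
   Context: $L(X)$ is the space of bounded linear operators on $X$ with the operator norm; $S=\{v\in X:\|v\|=1\}$; $X^*$ is the dual space with its dual norm. $G(k,X)$ is the set of $k$-dimensional linear subspaces of $X$ with the gap metric $$d(H_1,H_2)=\max\Big\{\sup_{v\in H_1\cap S}\inf_{u\in H_2\cap S}\|v-u\|,\ \sup_{v\in H_2\cap S}\inf_{u\in H_1\cap S}\|v-u\|\Big\},$$ and $G(k,X^* )$ is defined in the same way for $X^*$. For a nonempty set $A\subset X$: a $k$-dimensional bundle $A\times(P_x)$ is a family $\{P_x\}_{x\in A}\subset G(k,X)$; it is continuous if $x\mapsto P_x$ is continuous from $A$ to $G(k,X)$. A $k$-codimensional bundle $A\times(Q_x)$ is a family of closed $k$-codimensional subspaces of $X$ for which there is a family $\{L_x\}_{x\in A}\subset G(k,X^* )$ with $\mathrm{Ker}(L_x)=\{v\in X: l(v)=0\ \forall\, l\in L_x\}=Q_x$ for all $x\in A$; it is continuous if $x\mapsto L_x$ is continuous from $A$ to $G(k,X^* )$. For a map $f$ with $f(A)=A$ and a map $\mathcal H:x\mapsto H_x\in L(X)$ defined on a set containing $A$, the linear cocycle $(f,\mathcal H)$ on $A\times X$ is the map $(x,v)\mapsto(f(x),H_xv)$. Put $H^0_x=\mathrm{Id}$ and $H^n_x=H_{f^{n-1}(x)}\circ H^{n-1}_x$ for $n\ge1$. $(f,\mathcal H)$ on $A\times X$ admits a $k$-exponential separation if there are a $k$-dimensional continuous bundle $A\times(P_x)$ and a $k$-codimensional continuous bundle $A\times(Q_x)$ such that: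 (i) $X=P_x\oplus Q_x$ for all $x\in A$; (ii) $H_xP_x=P_{f(x)}$ and $H_xQ_x\subset Q_{f(x)}$ for all $x\in A$; (iii) there are constants $M>0$ and $\gamma\in(0,1)$ with $\|H^n_xw\|\le M\gamma^n\|H^n_xv\|$ for all $x\in A$, $v\in P_x\cap S$, $w\in Q_x\cap S$, $n\in\mathbb N=\{0,1,2,\dots\}$. It has the unique $k$-exponential separation if moreover there is exactly one pair of bundles satisfying (i)–(iii). *)

theory Defs
  imports "HOL-Analysis.Analysis"
begin

definition grassmannian :: "nat \<Rightarrow> 'a::real_normed_vector set set" where
  "grassmannian k = {H. subspace H \<and> (\<exists>B. finite B \<and> span B = H) \<and> dim H = k}"

text \<open>For \<open>k \<ge> 1\<close> all suprema and infima below range over nonempty bounded sets of reals.\<close>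

definition gap :: "'a::real_normed_vector set \<Rightarrow> 'a set \<Rightarrow> real" where
  "gap H1 H2 = max
     (SUP v\<in>H1 \<inter> sphere 0 1. INF u\<in>H2 \<inter> sphere 0 1. norm (v - u))
     (SUP v\<in>H2 \<inter> sphere 0 1. INF u\<in>H1 \<inter> sphere 0 1. norm (v - u))"

definition gap_continuous_on ::
    "'x::metric_space set \<Rightarrow> ('x \<Rightarrow> 'a::real_normed_vector set) \<Rightarrow> bool" where
  "gap_continuous_on A P \<longleftrightarrow> (\<forall>x\<in>A. ((\<lambda>y. gap (P y) (P x)) \<longlongrightarrow> 0) (at x within A))"

definition is_direct_sum :: "'a::real_vector set \<Rightarrow> 'a set \<Rightarrow> bool" where
  "is_direct_sum P Q \<longleftrightarrow>
     subspace P \<and> subspace Q \<and> P \<inter> Q = {0} \<and> {p + q | p q. p \<in> P \<and> q \<in> Q} = UNIV"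

text \<open>\<open>Q\<close> has codimension \<open>k\<close> iff it has a \<open>k\<close>-dimensional algebraic complement
  (which is isomorphic to the quotient by \<open>Q\<close>).\<close>

definition codimensional :: "nat \<Rightarrow> 'a::real_normed_vector set \<Rightarrow> bool" where
  "codimensional k Q \<longleftrightarrow> subspace Q \<and> (\<exists>C\<in>grassmannian k. is_direct_sum C Q)"

definition common_kernel :: "('a::real_normed_vector \<Rightarrow>\<^sub>L real) set \<Rightarrow> 'a set" where
  "common_kernel L = {v. \<forall>l\<in>L. blinfun_apply l v = 0}"

text \<open>A bundle over \<open>A\<close> is encoded as a function on the whole type, of which only the values
  on \<open>A\<close> are relevant.\<close>

definition continuous_dim_bundle ::
    "nat \<Rightarrow> 'x::metric_space set \<Rightarrow> ('x \<Rightarrow> 'a::real_normed_vector set) \<Rightarrow> bool" where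
  "continuous_dim_bundle k A P \<longleftrightarrow> (\<forall>x\<in>A. P x \<in> grassmannian k) \<and> gap_continuous_on A P"

definition continuous_codim_bundle ::
    "nat \<Rightarrow> 'x::metric_space set \<Rightarrow> ('x \<Rightarrow> 'a::real_normed_vector set) \<Rightarrow> bool" where
  "continuous_codim_bundle k A Q \<longleftrightarrow>
     (\<forall>x\<in>A. closed (Q x) \<and> codimensional k (Q x)) \<and>
     (\<exists>L :: 'x \<Rightarrow> ('a \<Rightarrow>\<^sub>L real) set.
        (\<forall>x\<in>A. L x \<in> grassmannian k \<and> common_kernel (L x) = Q x) \<and> gap_continuous_on A L)"

fun cocycle_iter ::
    "('x \<Rightarrow> 'x) \<Rightarrow> ('x \<Rightarrow> 'a::real_normed_vector \<Rightarrow>\<^sub>L 'a) \<Rightarrow> nat \<Rightarrow> 'x \<Rightarrow> 'a \<Rightarrow>\<^sub>L 'a" where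
  "cocycle_iter f H 0 x = id_blinfun"
| "cocycle_iter f H (Suc n) x = H ((f ^^ n) x) o\<^sub>L cocycle_iter f H n x"

text \<open>The base \<open>A\<close> of a cocycle is meant to be nonempty and to satisfy \<open>f ` A = A\<close>.\<close>

definition separating_bundles ::
    "nat \<Rightarrow> 'x::metric_space set \<Rightarrow> ('x \<Rightarrow> 'x) \<Rightarrow> ('x \<Rightarrow> 'a::real_normed_vector \<Rightarrow>\<^sub>L 'a)
      \<Rightarrow> ('x \<Rightarrow> 'a set) \<Rightarrow> ('x \<Rightarrow> 'a set) \<Rightarrow> bool" where
  "separating_bundles k A f H P Q \<longleftrightarrow>
     continuous_dim_bundle k A P \<and> continuous_codim_bundle k A Q \<and>
     (\<forall>x\<in>A. is_direct_sum (P x) (Q x)) \<and>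
     (\<forall>x\<in>A. blinfun_apply (H x) ` P x = P (f x) \<and> blinfun_apply (H x) ` Q x \<subseteq> Q (f x)) \<and>
     (\<exists>M \<gamma>. M > 0 \<and> 0 < \<gamma> \<and> \<gamma> < 1 \<and>
        (\<forall>x\<in>A. \<forall>v\<in>P x \<inter> sphere 0 1. \<forall>w\<in>Q x \<inter> sphere 0 1. \<forall>n.
           norm (cocycle_iter f H n x w) \<le> M * \<gamma> ^ n * norm (cocycle_iter f H n x v)))"

definition exponential_separation ::
    "nat \<Rightarrow> 'x::metric_space set \<Rightarrow> ('x \<Rightarrow> 'x) \<Rightarrow> ('x \<Rightarrow> 'a::real_normed_vector \<Rightarrow>\<^sub>L 'a) \<Rightarrow> bool" where
  "exponential_separation k A f H \<longleftrightarrow> (\<exists>P Q. separating_bundles k A f H P Q)"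

definition unique_exponential_separation ::
    "nat \<Rightarrow> 'x::metric_space set \<Rightarrow> ('x \<Rightarrow> 'x) \<Rightarrow> ('x \<Rightarrow> 'a::real_normed_vector \<Rightarrow>\<^sub>L 'a) \<Rightarrow> bool" where
  "unique_exponential_separation k A f H \<longleftrightarrow>
     exponential_separation k A f H \<and>
     (\<forall>P Q P' Q'. separating_bundles k A f H P Q \<and> separating_bundles k A f H P' Q' \<longrightarrow>
        (\<forall>x\<in>A. P x = P' x \<and> Q x = Q' x))"

definition unit_nbhd :: "'a::metric_space set \<Rightarrow> 'a set" where
  "unit_nbhd K = {x. infdist x K \<le> 1}"

end

theory Submission
  imports Defs
begin

text \<open>A splitting \<open>X = P \<oplus> Q\<close> is carried throughout by the bounded projection onto \<open>P\<close> along \<open>Q\<close>.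
  Gap-continuity of the two bundles of an exponential separation is the same thing as
  operator-norm continuity of these projections, invariance is a commutation relation between
  projections and cocycle, and closeness of splittings is closeness of projections. Over the
  compact set \<open>K\<close> the projections \<open>R0 y\<close> are then bounded and uniformly continuous, and the cocycle
  is bounded below on their ranges by a common constant.

  Existence. Choose \<open>N\<close> so large that the \<open>N\<close>-th iterate contracts the null spaces
  much more strongly than the ranges. If \<open>\<epsilon>\<close> and \<open>\<delta>\<close> are small, then for \<open>x\<close> in the perturbed base
  the \<open>N\<close>-th iterate of the perturbed cocycle at \<open>x\<close> is almost block diagonal with respect to the
  reference projections \<open>R0 (h x)\<close>, with the same domination between its blocks
  (\<open>perturbed_iterates_close\<close>, \<open>perturbed_block_estimates\<close>). Invariant graphs over the ranges and
  over the null spaces are then fixed points of contractions on bounded operator-valued sections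
  (\<open>invariant_splitting_near\<close>). As \<open>h\<close> is an arbitrary map, the sections are arbitrary functions on
  the base, and continuity of the new splitting has to be recovered afterwards.

  Everything else follows from rigidity of domination. In a dominated splitting a vector with
  arbitrarily long backward orbits that stay uniformly transverse to the null spaces must lie in the
  range, because its null space component is exponentially small compared with its range component.
  A vector whose forward orbit is exponentially small compared with the range directions must lie in the null
  space. This shows that the splitting found for the \<open>N\<close>-th iterate is invariant under the
  perturbed cocycle itself (\<open>dominated_splitting_generator_invariant\<close>). It shows that the splitting
  is continuous: up to an exponentially small error it is determined by a finite piece of the
  orbit, on which all data are continuous (\<open>dominated_splitting_continuous\<close>). And it shows that
  over a compact base, where any two pairs of separating bundles are uniformly transverse,
  the pair is unique (\<open>separating_bundles_unique\<close>).

  The order of the choices matters: first \<open>N\<close>, which fixes the domination and the lower bounds, then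
  the distance \<open>r\<close> allowed between new and reference projections, then the
  accuracy \<open>e\<close> of the perturbed operators, and only then \<open>\<epsilon>\<close> and \<open>\<delta>\<close>.\<close>

section \<open>Finite-dimensional subspaces of a normed space\<close>

text \<open>Coordinates with respect to a new basis vector are controlled by its distance to the old subspace;
this is what makes coordinate functionals bounded.\<close>

lemma abs_times_infdist_le_norm:
  fixes S :: "'a::real_normed_vector set"
  assumes "subspace S" "u \<in> S"
  shows "\<bar>c\<bar> * infdist b S \<le> norm (c *\<^sub>R b + u)"
proof (cases "c = 0")
  case False
  have "infdist b S \<le> dist b (- (inverse c *\<^sub>R u))"
    by (rule infdist_le) (simp add: assms subspace_neg subspace_scale)
  also have "\<dots> = norm (inverse c *\<^sub>R (c *\<^sub>R b + u))"
    using False by (simp add: dist_norm scaleR_add_right)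
  also have "\<dots> = norm (c *\<^sub>R b + u) / \<bar>c\<bar>" by (simp only: norm_scaleR) (simp add: divide_simps)
  finally show ?thesis using False by (simp add: field_simps)
qed auto

text \<open>Induction on the generators: if \<open>b\<close> has positive distance from \<open>span B\<close>, then a ball of
\<open>span (insert b B)\<close> is a closed piece of the continuous image of an interval times a ball of \<open>span B\<close>.
Positive distance needs \<open>span B\<close> closed, so closedness is derived from compactness of balls along the way.\<close>

lemma compact_span_Int_cball:
  fixes B :: "'a::real_normed_vector set"
  assumes "finite B"
  shows "compact (span B \<inter> cball 0 r)" and "closed (span B)"
proof -
  have closed_if: "closed (span C)" if "\<And>r. compact (span C \<inter> cball 0 r)" for C :: "'a set"
  proof (unfold closed_sequential_limits, intro allI impI, elim conjE)
    fix X l assume X: "\<forall>n. X n \<in> span C" and lim: "X \<longlonglongrightarrow> l"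
    then obtain R where "\<And>n. norm (X n) \<le> R"
      using convergent_imp_Bseq convergentI BseqE by metis
    then have "\<forall>n. X n \<in> span C \<inter> cball 0 R" using X by simp
    then show "l \<in> span C"
      using compact_imp_closed[OF that[of R]] lim closed_sequential_limits by blast
  qed
  have "\<forall>r. compact (span B \<inter> cball 0 r)"
    using assms
  proof induction
    case empty
    then show ?case by (auto intro!: finite_imp_compact finite_subset[of _ "{0}"])
  next
    case (insert b B)
    have cl: "closed (span B)" by (rule closed_if) (use insert.IH in blast)
    show ?case
    proof (cases "b \<in> span B")
      case True
      then have "span (insert b B) = span B" by (simp add: span_redundant)
      then show ?thesis using insert.IH by simp
    next
      case False
      define d where "d = infdist b (span B)"
      have d: "d > 0" using False cl by (metis d_def empty_iff infdist_nonneg infdist_pos_not_in_closed span_zero)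
      have coord: "\<bar>c\<bar> * d \<le> norm (c *\<^sub>R b + u)" if "u \<in> span B" for c u
        unfolding d_def using that by (intro abs_times_infdist_le_norm) auto
      show ?thesis
      proof
        fix r
        define R where "R = \<bar>r\<bar> / d"
        define h where "h = (\<lambda>(c, u). c *\<^sub>R b + u)"
        define W where "W = h ` ({-R..R} \<times> (span B \<inter> cball 0 (\<bar>r\<bar> + R * norm b)))"
        have "compact W" unfolding W_def h_def
          by (intro compact_continuous_image compact_Times)
            (use insert.IH in \<open>auto intro!: continuous_intros simp: case_prod_unfold\<close>)
        moreover have "span (insert b B) \<inter> cball 0 r = W \<inter> cball 0 r"
        proof (intro equalityI subsetI)
          fix v assume v: "v \<in> span (insert b B) \<inter> cball 0 r"
          then obtain c where c: "v - c *\<^sub>R b \<in> span B" by (auto simp: span_insert)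
          have "\<bar>c\<bar> * d \<le> norm v" using coord[OF c, of c] by simp
          then have cR: "\<bar>c\<bar> \<le> R" using v d unfolding R_def by (auto simp: pos_le_divide_eq)
          have "norm (v - c *\<^sub>R b) \<le> norm v + \<bar>c\<bar> * norm b" using norm_triangle_ineq4[of v "c *\<^sub>R b"] by simp
          also have "\<dots> \<le> \<bar>r\<bar> + R * norm b" using v cR by (intro add_mono mult_right_mono) auto
          finally show "v \<in> W \<inter> cball 0 r"
            using v c cR unfolding W_def h_def by (auto intro!: image_eqI[of _ _ "(c, v - c *\<^sub>R b)"])
        next
          fix v assume v: "v \<in> W \<inter> cball 0 r"
          then obtain c u where cu: "v = c *\<^sub>R b + u" "u \<in> span B" unfolding W_def h_def by auto
          then have "v - c *\<^sub>R b \<in> span B" by simp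
          then have "v \<in> span (insert b B)" unfolding span_insert by blast
          then show "v \<in> span (insert b B) \<inter> cball 0 r" using v by simp
        qed
        ultimately show "compact (span (insert b B) \<inter> cball 0 r)" by (simp add: compact_Int_closed)
      qed
    qed
  qed
  then show "compact (span B \<inter> cball 0 r)" "closed (span B)" by (auto intro: closed_if)
qed

lemma grassmannian_subspace: "H \<in> grassmannian k \<Longrightarrow> subspace H"
  by (simp add: grassmannian_def)

lemma grassmannian_basis:
  assumes "H \<in> grassmannian k"
  obtains B where "finite B" "independent B" "span B = H" "card B = k"
proof -
  obtain S where S: "finite S" "span S = H" "dim H = k" using assms by (auto simp: grassmannian_def)
  obtain B where B: "B \<subseteq> S" "independent B" "S \<subseteq> span B"
    using maximal_independent_subset[of S] by blast
  have "span B = H" using B S by (metis span_mono span_span subset_antisym)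
  then show ?thesis using that[of B] B S finite_subset dim_span dim_eq_card by metis
qed

lemma grassmannianI:
  assumes "finite B" "independent B" "span B = H" "card B = k"
  shows "H \<in> grassmannian k"
  using assms dim_eq_card[of B H] by (auto simp: grassmannian_def dim_eq_card_independent)

lemma grassmannian_inj_image:
  assumes "H \<in> grassmannian k" "linear f" "inj_on f H"
  shows "f ` H \<in> grassmannian k"
proof -
  obtain B where B: "finite B" "independent B" "span B = H" "card B = k"
    using grassmannian_basis[OF assms(1)] .
  have "independent (f ` B)"
    using linear_independent_injective_image[OF assms(2)] B assms(3)
    by (metis linear_inj_on_span_independent_image assms(2))
  moreover have "card (f ` B) = k" using B assms(3) card_image inj_on_subset span_superset by metis
  moreover have "span (f ` B) = f ` H" using linear_span_image[OF assms(2)] B by metis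
  ultimately show ?thesis using B by (intro grassmannianI) auto
qed

lemma grassmannian_subset_eq:
  assumes "H \<in> grassmannian k" "H' \<in> grassmannian k" "H \<subseteq> H'"
  shows "H = H'"
proof (rule ccontr)
  assume "H \<noteq> H'"
  then obtain v where v: "v \<in> H'" "v \<notin> H" using assms by blast
  obtain B where B: "finite B" "independent B" "span B = H" "card B = k"
    using grassmannian_basis[OF assms(1)] .
  obtain B' where B': "finite B'" "independent B'" "span B' = H'" "card B' = k"
    using grassmannian_basis[OF assms(2)] .
  have "independent (insert v B)" using B v by (simp add: independent_insertI)
  moreover have "insert v B \<subseteq> span B'" using B B' v assms(3) span_superset by blast
  ultimately have "card (insert v B) \<le> card B'" using independent_span_bound[OF B'(1)] by blast
  moreover have "v \<notin> B" using v B span_superset by blast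
  ultimately show False using B B' by simp
qed

text \<open>If a nonzero vector of \<open>H\<close> were killed, extending it to a basis of \<open>H\<close> would leave only \<open>k - 1\<close> vectors
to span the image.\<close>

lemma grassmannian_surj_imp_inj:
  assumes "H \<in> grassmannian k" "f ` H \<in> grassmannian k" "linear f"
  shows "inj_on f H"
proof -
  have sub: "subspace H" using assms(1) by (rule grassmannian_subspace)
  have "v = 0" if v: "v \<in> H" "f v = 0" for v
  proof (rule ccontr)
    assume "v \<noteq> 0"
    then have "independent {v}" by simp
    then obtain B where B: "{v} \<subseteq> B" "B \<subseteq> H" "independent B" "H \<subseteq> span B"
      using maximal_independent_subset_extend[of "{v}" H] v by blast
    have spB: "span B = H" using B sub by (metis span_minimal subset_antisym)
    obtain C where C: "finite C" "independent C" "span C = H" "card C = k"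
      using grassmannian_basis[OF assms(1)] .
    have fB: "finite B" "card B \<le> k" using independent_span_bound[OF C(1) B(3)] B C by auto
    obtain D where D: "finite D" "independent D" "span D = f ` H" "card D = k"
      using grassmannian_basis[OF assms(2)] .
    have "f ` H = span (f ` B)" using linear_span_image[OF assms(3)] spB by metis
    also have "f ` B = insert 0 (f ` (B - {v}))" using B v by auto
    also have "span \<dots> = span (f ` (B - {v}))" by (simp add: span_insert_0)
    finally have "D \<subseteq> span (f ` (B - {v}))" using D span_superset by metis
    then have "card D \<le> card (f ` (B - {v}))"
      using independent_span_bound[of "f ` (B - {v})" D] D fB by auto
    also have "\<dots> \<le> card (B - {v})" using fB by (simp add: card_image_le)
    also have "\<dots> < card B" using fB B by (intro psubset_card_mono) auto
    finally show False using D fB by simp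
  qed
  then show ?thesis using linear_inj_on_iff_eq_0[OF assms(3) sub] by blast
qed

text \<open>Compactness of the unit sphere of \<open>H\<close>. It is applied to seminorms given by finitely many functionals and to
\<open>\<lambda>p. norm (T p)\<close> for an operator \<open>T\<close> injective on \<open>H\<close>.\<close>

lemma grassmannian_bounded_below:
  fixes N :: "'a::real_normed_vector \<Rightarrow> real"
  assumes H: "H \<in> grassmannian k" and cont: "continuous_on H N"
    and hom: "\<And>c v. N (c *\<^sub>R v) = \<bar>c\<bar> * N v" and pos: "\<And>v. v \<in> H \<Longrightarrow> v \<noteq> 0 \<Longrightarrow> N v > 0"
  obtains m where "m > 0" "\<And>v. v \<in> H \<Longrightarrow> m * norm v \<le> N v"
proof -
  obtain B where B: "finite B" "span B = H" using grassmannian_basis[OF H] by metis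
  define S where "S = (span B \<inter> cball 0 1) \<inter> sphere 0 1"
  have "compact S" unfolding S_def
    by (rule compact_Int_closed[OF compact_span_Int_cball(1)[OF B(1)]])
      (auto simp: sphere_def intro!: closed_Collect_eq continuous_intros)
  have "\<exists>m>0. \<forall>v\<in>S. m \<le> N v"
  proof (cases "S = {}")
    case True
    then show ?thesis by (auto intro!: exI[of _ 1])
  next
    case False
    obtain s where s: "s \<in> S" "\<forall>v\<in>S. N s \<le> N v"
      using continuous_attains_inf[OF \<open>compact S\<close> False] continuous_on_subset[OF cont] B
      unfolding S_def by (metis Int_lower1 Int_assoc)
    have "s \<in> H" "s \<noteq> 0" using s B unfolding S_def by auto
    then have "N s > 0" by (rule pos)
    then show ?thesis using s by blast
  qed
  then obtain m where m: "m > 0" "\<forall>v\<in>S. m \<le> N v" by blast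
  have "m * norm v \<le> N v" if "v \<in> H" for v
  proof (cases "v = 0")
    case True
    then show ?thesis using hom[of 0 v] by simp
  next
    case False
    have "inverse (norm v) *\<^sub>R v \<in> S"
      using that False B unfolding S_def by (auto simp: span_scale)
    then have "m \<le> \<bar>inverse (norm v)\<bar> * N v" using m hom by metis
    then show ?thesis using False by (simp add: field_simps)
  qed
  with m that show ?thesis by blast
qed

section \<open>Projections and the gap metric\<close>

definition fixed_space :: "('a::real_normed_vector \<Rightarrow>\<^sub>L 'a) \<Rightarrow> 'a set" where
  "fixed_space \<P> = {v. \<P> v = v}"

definition null_space :: "('a::real_normed_vector \<Rightarrow>\<^sub>L 'a) \<Rightarrow> 'a set" where
  "null_space \<P> = {v. \<P> v = 0}"

definition idempotent :: "('a::real_normed_vector \<Rightarrow>\<^sub>L 'a) \<Rightarrow> bool" where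
  "idempotent \<P> \<longleftrightarrow> (\<forall>v. \<P> (\<P> v) = \<P> v)"

lemma subspace_fixed_space: "subspace (fixed_space \<P>)"
  by (auto simp: subspace_def fixed_space_def blinfun.bilinear_simps)

lemma subspace_null_space: "subspace (null_space \<P>)"
  by (auto simp: subspace_def null_space_def blinfun.bilinear_simps)

lemma is_direct_sum_projection:
  assumes "idempotent \<P>"
  shows "is_direct_sum (fixed_space \<P>) (null_space \<P>)"
proof -
  have "v \<in> {p + q | p q. p \<in> fixed_space \<P> \<and> q \<in> null_space \<P>}" for v
  proof -
    have "v = \<P> v + (v - \<P> v)" "\<P> v \<in> fixed_space \<P>" "v - \<P> v \<in> null_space \<P>"
      using assms by (simp_all add: idempotent_def fixed_space_def null_space_def blinfun.bilinear_simps)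
    then show ?thesis by blast
  qed
  then have "{p + q | p q. p \<in> fixed_space \<P> \<and> q \<in> null_space \<P>} = UNIV" by blast
  moreover have "fixed_space \<P> \<inter> null_space \<P> = {0}"
    by (auto simp: fixed_space_def null_space_def)
  ultimately show ?thesis
    unfolding is_direct_sum_def using subspace_fixed_space[of \<P>] subspace_null_space[of \<P>] by blast
qed

lemma linear_projection_exists:
  fixes P Q :: "'a::real_vector set"
  assumes "is_direct_sum P Q"
  obtains \<pi> where "linear \<pi>" "\<And>v. \<pi> v \<in> P" "\<And>v. v - \<pi> v \<in> Q"
    "\<And>v. v \<in> P \<Longrightarrow> \<pi> v = v" "\<And>v. v \<in> Q \<Longrightarrow> \<pi> v = 0"
proof -
  have P: "subspace P" and Q: "subspace Q" and PQ: "P \<inter> Q = {0}"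
    and sum: "{p + q | p q. p \<in> P \<and> q \<in> Q} = UNIV"
    using assms by (auto simp: is_direct_sum_def)
  have "\<exists>p. p \<in> P \<and> v - p \<in> Q" for v
  proof -
    have "v \<in> {p + q | p q. p \<in> P \<and> q \<in> Q}" using sum by blast
    then obtain p q where "v = p + q" "p \<in> P" "q \<in> Q" by blast
    then show ?thesis by (intro exI[of _ p]) simp
  qed
  then obtain \<pi> where \<pi>: "\<And>v. \<pi> v \<in> P" "\<And>v. v - \<pi> v \<in> Q" by metis
  have uniq: "\<pi> v = p" if "p \<in> P" "v - p \<in> Q" for v p
  proof -
    have "\<pi> v - p \<in> P" by (intro subspace_diff P \<pi>(1) that(1))
    moreover have "(v - p) - (v - \<pi> v) \<in> Q" by (intro subspace_diff[of Q] Q \<pi>(2) that(2))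
    then have "\<pi> v - p \<in> Q" by simp
    ultimately have "\<pi> v - p \<in> P \<inter> Q" by (rule IntI)
    then show ?thesis unfolding PQ by simp
  qed
  have "linear \<pi>"
  proof (rule linearI)
    fix u v c
    have "u - \<pi> u + (v - \<pi> v) \<in> Q" by (intro subspace_add Q \<pi>(2))
    then show "\<pi> (u + v) = \<pi> u + \<pi> v"
      by (intro uniq subspace_add P \<pi>(1)) (simp add: algebra_simps)
    have "c *\<^sub>R (u - \<pi> u) \<in> Q" by (intro subspace_scale Q \<pi>(2))
    then show "\<pi> (c *\<^sub>R u) = c *\<^sub>R \<pi> u"
      by (intro uniq subspace_scale P \<pi>(1)) (simp add: algebra_simps)
  qed
  moreover have "\<pi> v = v" if "v \<in> P" for v using that Q by (intro uniq) (auto simp: subspace_0)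
  moreover have "\<pi> v = 0" if "v \<in> Q" for v using that P by (intro uniq) (auto simp: subspace_0)
  ultimately show ?thesis using \<pi> that by blast
qed

text \<open>The last conclusion is the quantitative form of boundedness that survives perturbation of \<open>L\<close>: a
vector on which every functional in \<open>L\<close> is small has a small projection. The constant comes from the
equivalence on \<open>P\<close> of the norm with \<open>\<lambda>v. \<Sum>l\<in>B. \<bar>l v\<bar>\<close>, for a finite basis \<open>B\<close> of \<open>L\<close>.\<close>

lemma bounded_projection_exists:
  fixes P :: "'a::real_normed_vector set"
  assumes P: "P \<in> grassmannian k" and L: "L \<in> grassmannian k"
    and sum: "is_direct_sum P (common_kernel L)"
  obtains \<P> C where "idempotent \<P>" "fixed_space \<P> = P" "null_space \<P> = common_kernel L"
    "C \<ge> 0" "\<And>w g. (\<And>l. l \<in> L \<Longrightarrow> \<bar>blinfun_apply l w\<bar> \<le> g * norm l) \<Longrightarrow> norm (\<P> w) \<le> C * g"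
proof -
  obtain \<pi> where \<pi>: "linear \<pi>" "\<And>v. \<pi> v \<in> P" "\<And>v. v - \<pi> v \<in> common_kernel L"
    "\<And>v. v \<in> P \<Longrightarrow> \<pi> v = v" "\<And>v. v \<in> common_kernel L \<Longrightarrow> \<pi> v = 0"
    using linear_projection_exists[OF sum] by metis
  obtain B where B: "finite B" "independent B" "span B = L" "card B = k"
    using grassmannian_basis[OF L] .
  define N where "N v = (\<Sum>l\<in>B. \<bar>blinfun_apply l v\<bar>)" for v
  have BL: "B \<subseteq> L" using B span_superset by blast
  have pos: "N v > 0" if v: "v \<in> P" "v \<noteq> 0" for v
  proof (rule ccontr)
    assume "\<not> N v > 0"
    then have "N v = 0" unfolding N_def using sum_nonneg[of B "\<lambda>l. \<bar>blinfun_apply l v\<bar>"] by linarith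
    then have "\<forall>l\<in>B. blinfun_apply l v = 0"
      unfolding N_def using B by (simp add: sum_nonneg_eq_0_iff)
    moreover have "subspace {l. blinfun_apply l v = 0}"
      by (auto simp: subspace_def blinfun.bilinear_simps)
    ultimately have "L \<subseteq> {l. blinfun_apply l v = 0}"
      using B(3) span_minimal[of B "{l. blinfun_apply l v = 0}"] by auto
    then have "v \<in> P \<inter> common_kernel L" using v by (auto simp: common_kernel_def)
    then show False using sum v by (auto simp: is_direct_sum_def)
  qed
  obtain m where m: "m > 0" "\<And>v. v \<in> P \<Longrightarrow> m * norm v \<le> N v"
  proof (rule grassmannian_bounded_below[OF P, of N])
    show "continuous_on P N" unfolding N_def by (intro continuous_intros)
    show "N (c *\<^sub>R v) = \<bar>c\<bar> * N v" for c v
      unfolding N_def by (simp add: blinfun.bilinear_simps abs_mult sum_distrib_left)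
  qed (use pos that in auto)
  define C where "C = (\<Sum>l\<in>B. norm l) / m"
  have bound: "norm (\<pi> w) \<le> C * g" if g: "\<And>l. l \<in> L \<Longrightarrow> \<bar>blinfun_apply l w\<bar> \<le> g * norm l" for w g
  proof -
    have "m * norm (\<pi> w) \<le> N (\<pi> w)" using m \<pi> by blast
    also have "N (\<pi> w) = N w"
    proof -
      have "blinfun_apply l (\<pi> w) = blinfun_apply l w" if "l \<in> B" for l
      proof -
        have "blinfun_apply l (w - \<pi> w) = 0" using \<pi>(3)[of w] BL that by (auto simp: common_kernel_def)
        then show ?thesis by (simp add: blinfun.bilinear_simps)
      qed
      then show ?thesis by (simp add: N_def)
    qed
    also have "N w \<le> (\<Sum>l\<in>B. g * norm l)" unfolding N_def using g BL by (intro sum_mono) auto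
    also have "\<dots> = m * (C * g)" using m by (simp add: C_def sum_distrib_left[symmetric])
    finally show ?thesis using m by simp
  qed
  have "norm (\<pi> w) \<le> norm w * C" for w
  proof -
    have "norm (\<pi> w) \<le> C * norm w"
    proof (rule bound)
      fix l
      show "\<bar>blinfun_apply l w\<bar> \<le> norm w * norm l" using norm_blinfun[of l w] by (simp add: mult.commute)
    qed
    then show ?thesis by (simp add: mult.commute)
  qed
  then have bl: "bounded_linear \<pi>"
    using \<pi>(1) by (intro bounded_linear_intro[of _ C]) (auto simp: linear_add linear_scale)
  define \<P> where "\<P> = Blinfun \<pi>"
  have ap: "blinfun_apply \<P> v = \<pi> v" for v using bl by (simp add: \<P>_def bounded_linear_Blinfun_apply)
  show ?thesis
  proof
    show "idempotent \<P>" using \<pi> by (simp add: idempotent_def ap)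
    have "\<pi> v = v \<longleftrightarrow> v \<in> P" for v by (rule iffI[OF _ \<pi>(4)]) (use \<pi>(2)[of v] in simp_all)
    then show "fixed_space \<P> = P" unfolding fixed_space_def ap by blast
    have "\<pi> v = 0 \<longleftrightarrow> v \<in> common_kernel L" for v by (rule iffI[OF _ \<pi>(5)]) (use \<pi>(3)[of v] in simp_all)
    then show "null_space \<P> = common_kernel L" unfolding null_space_def ap by blast
    show "C \<ge> 0" using m by (simp add: C_def sum_nonneg)
    show "norm (\<P> w) \<le> C * g" if "\<And>l. l \<in> L \<Longrightarrow> \<bar>blinfun_apply l w\<bar> \<le> g * norm l" for w g
      unfolding ap by (rule bound) (rule that)
  qed
qed

text \<open>Rests on the identity \<open>\<P>' - \<P> = (1 - \<P>) \<P>' - \<P> (1 - \<P>')\<close>: the two hypotheses bound the two terms by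
multiples of \<open>1 + norm \<P>'\<close>, and for \<open>a \<le> 1/4\<close> the unknown \<open>norm \<P>'\<close> is absorbed into the left-hand side. All
continuity statements for projections below go through this lemma.\<close>

lemma projection_difference:
  fixes \<P> \<P>' :: "'a::real_normed_vector \<Rightarrow>\<^sub>L 'a"
  assumes "idempotent \<P>'" and a: "0 \<le> a" "a \<le> 1/4"
    and P: "\<And>p. p \<in> fixed_space \<P>' \<Longrightarrow> norm (p - \<P> p) \<le> a * norm p"
    and Q: "\<And>q. q \<in> null_space \<P>' \<Longrightarrow> norm (\<P> q) \<le> a * norm q"
  shows "norm (\<P>' - \<P>) \<le> 2 * a * (1 + 2 * norm \<P>)"
proof -
  have "norm (\<P>' - \<P>) \<le> a * (1 + 2 * norm \<P>')"
  proof (rule norm_blinfun_bound)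
    show "0 \<le> a * (1 + 2 * norm \<P>')" using a by simp
    fix v
    have p: "\<P>' v \<in> fixed_space \<P>'" and q: "v - \<P>' v \<in> null_space \<P>'"
      using assms(1) by (auto simp: idempotent_def fixed_space_def null_space_def blinfun.bilinear_simps)
    have "(\<P>' - \<P>) v = (\<P>' v - \<P> (\<P>' v)) - \<P> (v - \<P>' v)"
      by (simp add: blinfun.bilinear_simps)
    then have "norm ((\<P>' - \<P>) v) \<le> norm (\<P>' v - \<P> (\<P>' v)) + norm (\<P> (v - \<P>' v))"
      by (metis norm_triangle_ineq4)
    also have "\<dots> \<le> a * norm (\<P>' v) + a * norm (v - \<P>' v)" using P[OF p] Q[OF q] by linarith
    also have "\<dots> \<le> a * norm (\<P>' v) + a * (norm v + norm (\<P>' v))"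
      using a by (intro add_mono mult_left_mono norm_triangle_ineq4) auto
    also have "\<dots> = a * (norm v + 2 * norm (\<P>' v))" by (simp add: algebra_simps)
    also have "\<dots> \<le> a * (norm v + 2 * (norm \<P>' * norm v))"
      using a norm_blinfun[of \<P>' v] by (intro mult_left_mono add_mono) auto
    finally show "norm ((\<P>' - \<P>) v) \<le> a * (1 + 2 * norm \<P>') * norm v"
      by (simp add: algebra_simps)
  qed
  also have "\<dots> \<le> a * (1 + 2 * (norm \<P> + norm (\<P>' - \<P>)))"
    using a norm_triangle_sub[of \<P>' \<P>] by (intro mult_left_mono) auto
  also have "\<dots> = a * (1 + 2 * norm \<P>) + (2 * a) * norm (\<P>' - \<P>)" by (simp add: algebra_simps)
  also have "\<dots> \<le> a * (1 + 2 * norm \<P>) + 1/2 * norm (\<P>' - \<P>)"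
    using a by (intro add_left_mono mult_right_mono) auto
  finally show ?thesis by simp
qed

lemma sphere_nonempty_if_grassmannian:
  assumes "H \<in> grassmannian k" "k > 0"
  shows "H \<inter> sphere 0 1 \<noteq> {}"
proof -
  obtain B where B: "finite B" "independent B" "span B = H" "card B = k"
    using grassmannian_basis[OF assms(1)] .
  then obtain b where b: "b \<in> B" using assms(2) by fastforce
  then have "b \<noteq> 0" using B dependent_zero by blast
  then have "inverse (norm b) *\<^sub>R b \<in> H \<inter> sphere 0 1" using B b by (auto intro: span_scale span_base)
  then show ?thesis by blast
qed

lemma gap_commute: "gap H1 H2 = gap H2 H1"
  unfolding gap_def by (simp add: max.commute)

lemma gap_less_imp:
  fixes H1 :: "'a::real_normed_vector set"
  assumes H: "subspace H1" "subspace H2" "H2 \<inter> sphere 0 1 \<noteq> {}"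
    and g: "gap H1 H2 < g" and v: "v \<in> H1"
  shows "\<exists>u\<in>H2. norm (v - u) \<le> g * norm v"
proof (cases "v = 0")
  case True
  then show ?thesis using H by (auto intro!: bexI[of _ 0] simp: subspace_0)
next
  case False
  define w where "w = inverse (norm v) *\<^sub>R v"
  have w: "w \<in> H1 \<inter> sphere 0 1" using v False H by (auto simp: w_def subspace_scale)
  define I where "I x = (INF u\<in>H2 \<inter> sphere 0 1. norm (x - u))" for x
  have bb: "bdd_below ((\<lambda>u. norm (x - u)) ` (H2 \<inter> sphere 0 1))" for x
    by (intro bdd_belowI[of _ 0]) auto
  have "I x \<le> 2" if "x \<in> H1 \<inter> sphere 0 1" for x
  proof -
    obtain u where u: "u \<in> H2 \<inter> sphere 0 1" using H by blast
    have "I x \<le> norm (x - u)" unfolding I_def using u bb by (intro cINF_lower)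
    also have "\<dots> \<le> 2" using norm_triangle_ineq4[of x u] u that by auto
    finally show ?thesis .
  qed
  then have "bdd_above (I ` (H1 \<inter> sphere 0 1))" by (intro bdd_aboveI[of _ 2]) auto
  then have "I w \<le> (SUP v\<in>H1 \<inter> sphere 0 1. I v)" using w by (intro cSUP_upper)
  also have "\<dots> \<le> gap H1 H2" unfolding gap_def I_def by simp
  finally have "I w < g" using g by simp
  then obtain u where u: "u \<in> H2" "norm (w - u) < g"
    unfolding I_def using cINF_less_iff[OF H(3) bb] by blast
  have "norm (v - norm v *\<^sub>R u) = norm (norm v *\<^sub>R (w - u))"
    using False by (simp add: w_def scaleR_diff_right)
  also have "\<dots> = norm v * norm (w - u)" by simp
  also have "\<dots> \<le> norm v * g" using u by (intro mult_left_mono) auto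
  finally show ?thesis
    using u H by (intro bexI[of _ "norm v *\<^sub>R u"]) (auto simp: mult.commute subspace_scale)
qed

lemma gap_le:
  fixes H1 :: "'a::real_normed_vector set"
  assumes "H1 \<inter> sphere 0 1 \<noteq> {}" "H2 \<inter> sphere 0 1 \<noteq> {}"
    and 1: "\<And>v. v \<in> H1 \<inter> sphere 0 1 \<Longrightarrow> \<exists>u\<in>H2 \<inter> sphere 0 1. norm (v - u) \<le> s"
    and 2: "\<And>v. v \<in> H2 \<inter> sphere 0 1 \<Longrightarrow> \<exists>u\<in>H1 \<inter> sphere 0 1. norm (v - u) \<le> s"
  shows "0 \<le> gap H1 H2" "gap H1 H2 \<le> s"
proof -
  have *: "(SUP v\<in>A. INF u\<in>B. norm (v - u)) \<le> s \<and> 0 \<le> (SUP v\<in>A. INF u\<in>B. norm (v - u))"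
    if ne: "A \<noteq> {}" "B \<noteq> {}" and le: "\<And>v. v \<in> A \<Longrightarrow> \<exists>u\<in>B. norm (v - u) \<le> s" for A B :: "'a set"
  proof -
    have bb: "bdd_below ((\<lambda>u. norm (x - u)) ` B)" for x
      by (intro bdd_belowI[of _ 0]) auto
    have I: "(INF u\<in>B. norm (v - u)) \<le> s" if "v \<in> A" for v
      using le[OF that] cINF_lower[OF bb] order_trans by metis
    have I0: "0 \<le> (INF u\<in>B. norm (v - u))" for v using ne by (intro cINF_greatest) auto
    have ba: "bdd_above ((\<lambda>v. INF u\<in>B. norm (v - u)) ` A)" using I by (intro bdd_aboveI[of _ s]) auto
    obtain v where "v \<in> A" using ne by blast
    then show ?thesis using cSUP_upper[OF _ ba, of v] I0[of v] ne I by (auto intro!: cSUP_least)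
  qed
  show "0 \<le> gap H1 H2" "gap H1 H2 \<le> s"
    using *[OF assms(1,2) 1] *[OF assms(2,1) 2] unfolding gap_def by auto
qed

text \<open>A unit vector of one range is moved by at most \<open>s\<close> when projected to the other range, and normalizing
the result costs at most \<open>s\<close> again.\<close>

lemma gap_fixed_space_le:
  fixes \<P> \<P>' :: "'a::real_normed_vector \<Rightarrow>\<^sub>L 'a"
  assumes idem: "idempotent \<P>" "idempotent \<P>'"
    and ne: "fixed_space \<P> \<inter> sphere 0 1 \<noteq> {}" "fixed_space \<P>' \<inter> sphere 0 1 \<noteq> {}"
    and close: "norm (\<P>' - \<P>) \<le> s" and "s < 1"
  shows "0 \<le> gap (fixed_space \<P>') (fixed_space \<P>)" "gap (fixed_space \<P>') (fixed_space \<P>) \<le> 2 * s"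
proof -
  have *: "\<exists>u\<in>fixed_space B \<inter> sphere 0 1. norm (v - u) \<le> 2 * s"
    if v: "v \<in> fixed_space A \<inter> sphere 0 1" and idB: "idempotent B" and AB: "norm (A - B) \<le> s"
    for A B :: "'a \<Rightarrow>\<^sub>L 'a" and v
  proof -
    have "norm (v - B v) = norm ((A - B) v)" using v by (simp add: fixed_space_def blinfun.bilinear_simps)
    also have "\<dots> \<le> s" using norm_blinfun[of "A - B" v] AB v by simp
    finally have vs: "norm (v - B v) \<le> s" .
    have "\<bar>norm v - norm (B v)\<bar> \<le> norm (v - B v)" by (rule norm_triangle_ineq3)
    then have d: "\<bar>1 - norm (B v)\<bar> \<le> s" using vs v by simp
    then have nz: "norm (B v) > 0" using \<open>s < 1\<close> by linarith
    define u where "u = inverse (norm (B v)) *\<^sub>R B v"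
    have u: "u \<in> fixed_space B \<inter> sphere 0 1"
      using nz idB by (auto simp: u_def fixed_space_def idempotent_def blinfun.bilinear_simps)
    have "B v - u = (1 - inverse (norm (B v))) *\<^sub>R B v" by (simp add: u_def scaleR_diff_left)
    then have "norm (B v - u) = \<bar>1 - inverse (norm (B v))\<bar> * norm (B v)" by simp
    also have "\<dots> = \<bar>(1 - inverse (norm (B v))) * norm (B v)\<bar>" by (simp add: abs_mult)
    also have "\<dots> = \<bar>norm (B v) - 1\<bar>" using nz by (simp add: algebra_simps)
    also have "\<dots> \<le> s" using d by linarith
    finally have "norm (B v - u) \<le> s" .
    then have "norm (v - u) \<le> 2 * s" using vs norm_triangle_ineq[of "v - B v" "B v - u"] by simp
    then show ?thesis using u by blast
  qed
  have close': "norm (\<P> - \<P>') \<le> s" using close by (simp add: norm_minus_commute)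
  show "0 \<le> gap (fixed_space \<P>') (fixed_space \<P>)" "gap (fixed_space \<P>') (fixed_space \<P>) \<le> 2 * s"
    by (rule gap_le[OF ne(2,1)], erule *[OF _ idem(1) close], erule *[OF _ idem(2) close'])+
qed

section \<open>Bundles as norm-continuous families of projections\<close>

text \<open>Closeness of \<open>P y\<close> to \<open>P x\<close> bounds \<open>1 - R x\<close> on \<open>P y\<close>. Closeness of the functionals \<open>L y\<close> to \<open>L x\<close>
makes every functional of \<open>L x\<close> small on \<open>Q y\<close>, hence bounds \<open>R x\<close> on \<open>Q y\<close>. These are the two hypotheses
of \<open>projection_difference\<close>.\<close>

lemma bundle_projections:
  fixes P :: "'x::metric_space \<Rightarrow> 'a::real_normed_vector set"
  assumes k: "k > 0" and P: "continuous_dim_bundle k A P" and Q: "continuous_codim_bundle k A Q"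
    and sum: "\<forall>x\<in>A. is_direct_sum (P x) (Q x)"
  obtains R where "\<And>x. x \<in> A \<Longrightarrow> idempotent (R x)" "\<And>x. x \<in> A \<Longrightarrow> fixed_space (R x) = P x"
    "\<And>x. x \<in> A \<Longrightarrow> null_space (R x) = Q x" "continuous_on A R"
proof -
  have PG: "P x \<in> grassmannian k" if "x \<in> A" for x using P that by (auto simp: continuous_dim_bundle_def)
  obtain L :: "'x \<Rightarrow> ('a \<Rightarrow>\<^sub>L real) set" where L: "\<And>x. x \<in> A \<Longrightarrow> L x \<in> grassmannian k"
      "\<And>x. x \<in> A \<Longrightarrow> common_kernel (L x) = Q x" and Lc: "gap_continuous_on A L"
    using Q unfolding continuous_codim_bundle_def by blast
  have "\<forall>x\<in>A. \<exists>\<P> C. idempotent \<P> \<and> fixed_space \<P> = P x \<and> null_space \<P> = Q x \<and> C \<ge> 0 \<and>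
     (\<forall>w g. (\<forall>l \<in> L x. \<bar>blinfun_apply l w\<bar> \<le> g * norm l) \<longrightarrow> norm (blinfun_apply \<P> w) \<le> C * g)"
  proof
    fix x assume x: "x \<in> A"
    have "is_direct_sum (P x) (common_kernel (L x))" using sum L x by auto
    from bounded_projection_exists[OF PG[OF x] L(1)[OF x] this] L(2)[OF x]
    show "\<exists>\<P> C. idempotent \<P> \<and> fixed_space \<P> = P x \<and> null_space \<P> = Q x \<and> C \<ge> 0 \<and>
     (\<forall>w g. (\<forall>l \<in> L x. \<bar>blinfun_apply l w\<bar> \<le> g * norm l) \<longrightarrow> norm (blinfun_apply \<P> w) \<le> C * g)"
      by metis
  qed
  then obtain R C where R: "\<And>x. x \<in> A \<Longrightarrow> idempotent (R x)" "\<And>x. x \<in> A \<Longrightarrow> fixed_space (R x) = P x"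
    "\<And>x. x \<in> A \<Longrightarrow> null_space (R x) = Q x" and C: "\<And>x. x \<in> A \<Longrightarrow> C x \<ge> 0"
    "\<And>x w g. x \<in> A \<Longrightarrow> (\<And>l. l \<in> L x \<Longrightarrow> \<bar>blinfun_apply l w\<bar> \<le> g * norm l) \<Longrightarrow>
      norm (blinfun_apply (R x) w) \<le> C x * g"
    by metis
  have "continuous_on A R"
    unfolding continuous_on_def
  proof (intro ballI tendstoI)
    fix x and e :: real assume x: "x \<in> A" and e: "e > 0"
    define E where "E = 1 + 2 * norm (R x)"
    define a where "a = min (1/4) (e / (4 * E))"
    define g where "g = a / (1 + norm (R x) + C x)"
    have E: "E > 0" by (simp add: E_def add_pos_nonneg)
    have a: "0 < a" "a \<le> 1/4" "a * (4 * E) \<le> e" using e E by (auto simp: a_def min_def field_simps)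
    have D: "1 + norm (R x) + C x > 0" using C(1)[OF x] by (simp add: add_pos_nonneg)
    have g: "g > 0" using a D by (simp add: g_def)
    have gD: "g * (1 + norm (R x) + C x) = a" using D by (simp add: g_def)
    have g1: "(1 + norm (R x)) * g \<le> a" "C x * g \<le> a"
      using gD C(1)[OF x] g mult_nonneg_nonneg[of g "norm (R x)"] mult_nonneg_nonneg[of g "C x"]
      by (auto simp: algebra_simps)
    have "\<forall>\<^sub>F y in at x within A. gap (P y) (P x) < g"
      using P x g unfolding continuous_dim_bundle_def gap_continuous_on_def by (auto intro: order_tendstoD)
    moreover have "\<forall>\<^sub>F y in at x within A. gap (L y) (L x) < g"
      using Lc x g unfolding gap_continuous_on_def by (auto intro: order_tendstoD)
    moreover have "\<forall>\<^sub>F y in at x within A. y \<in> A" by (simp add: eventually_at_filter)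
    ultimately show "\<forall>\<^sub>F y in at x within A. dist (R y) (R x) < e"
    proof eventually_elim
      case (elim y)
      have "norm (R y - R x) \<le> 2 * a * (1 + 2 * norm (R x))"
      proof (rule projection_difference)
        show "idempotent (R y)" using R elim by blast
        show "0 \<le> a" "a \<le> 1/4" using a by auto
        fix p assume "p \<in> fixed_space (R y)"
        then have "p \<in> P y" using R elim by blast
        then obtain u where u: "u \<in> P x" "norm (p - u) \<le> g * norm p"
          using gap_less_imp[of "P y" "P x" g p] elim PG x k
          by (meson grassmannian_subspace sphere_nonempty_if_grassmannian)
        have "R x u = u" using u R x by (auto simp: fixed_space_def)
        then have "p - R x p = (p - u) - R x (p - u)" by (simp add: blinfun.bilinear_simps)
        then have "norm (p - R x p) = norm ((p - u) - R x (p - u))" by (rule arg_cong)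
        then have "norm (p - R x p) \<le> norm (p - u) + norm (R x) * norm (p - u)"
          using norm_triangle_ineq4[of "p - u" "R x (p - u)"] norm_blinfun[of "R x" "p - u"] by simp
        also have "\<dots> = (1 + norm (R x)) * norm (p - u)" by (simp add: algebra_simps)
        also have "\<dots> \<le> (1 + norm (R x)) * (g * norm p)" using u by (intro mult_left_mono) auto
        also have "\<dots> \<le> a * norm p" using g1(1) by (simp add: mult.assoc[symmetric] mult_right_mono)
        finally show "norm (p - R x p) \<le> a * norm p" .
      next
        fix q assume "q \<in> null_space (R y)"
        then have q: "q \<in> common_kernel (L y)" using R L elim by blast
        have "norm (R x q) \<le> C x * (g * norm q)"
        proof (rule C(2)[OF x])
          fix l assume l: "l \<in> L x"
          obtain l' where l': "l' \<in> L y" "norm (l - l') \<le> g * norm l"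
            using gap_less_imp[of "L x" "L y" g l] elim L x k l gap_commute[of "L x" "L y"]
            by (metis grassmannian_subspace sphere_nonempty_if_grassmannian)
          have "blinfun_apply l q = blinfun_apply (l - l') q"
            using q l' by (simp add: common_kernel_def blinfun.bilinear_simps)
          then have "\<bar>blinfun_apply l q\<bar> \<le> norm (l - l') * norm q" using norm_blinfun[of "l - l'" q] by simp
          also have "\<dots> \<le> (g * norm l) * norm q" using l' by (intro mult_right_mono) auto
          finally show "\<bar>blinfun_apply l q\<bar> \<le> g * norm q * norm l" by (simp add: mult_ac)
        qed
        also have "\<dots> \<le> a * norm q" using g1(2) by (simp add: mult.assoc[symmetric] mult_right_mono)
        finally show "norm (R x q) \<le> a * norm q" .
      qed
      also have "\<dots> = a * (4 * E) / 2" by (simp add: E_def)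
      also have "\<dots> < e" using a e by linarith
      finally show ?case by (simp add: dist_norm)
    qed
  qed
  with R that show ?thesis by blast
qed

lemma continuous_dim_bundle_fixed_space:
  fixes R :: "'x::metric_space \<Rightarrow> 'a::real_normed_vector \<Rightarrow>\<^sub>L 'a"
  assumes k: "k > 0" and R: "\<And>x. x \<in> A \<Longrightarrow> idempotent (R x)"
    "\<And>x. x \<in> A \<Longrightarrow> fixed_space (R x) \<in> grassmannian k" and cont: "continuous_on A R"
  shows "continuous_dim_bundle k A (\<lambda>x. fixed_space (R x))"
  unfolding continuous_dim_bundle_def gap_continuous_on_def
proof (intro conjI ballI tendstoI)
  fix x and e :: real assume x: "x \<in> A" and e: "e > 0"
  define s where "s = min (1/2) (e/3)"
  have s: "s > 0" "s < 1" "2 * s < e" using e by (auto simp: s_def)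
  have "\<forall>\<^sub>F y in at x within A. dist (R y) (R x) < s"
    using cont x s by (auto simp: continuous_on_def intro: tendstoD)
  moreover have "\<forall>\<^sub>F y in at x within A. y \<in> A" by (simp add: eventually_at_filter)
  ultimately show "\<forall>\<^sub>F y in at x within A. dist (gap (fixed_space (R y)) (fixed_space (R x))) 0 < e"
  proof eventually_elim
    case (elim y)
    have "norm (R y - R x) \<le> s" using elim by (simp add: dist_norm)
    from gap_fixed_space_le[OF R(1)[OF x] R(1) _ _ this s(2)]
    have "0 \<le> gap (fixed_space (R y)) (fixed_space (R x))" "gap (fixed_space (R y)) (fixed_space (R x)) \<le> 2 * s"
      using R(2) sphere_nonempty_if_grassmannian[OF _ k] x elim by auto
    then show ?case using s by simp
  qed
qed (use R in auto)

text \<open>The adjoint operator. It turns the projection onto \<open>P\<close> along \<open>Q\<close> into the projection onto the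
annihilator of \<open>Q\<close>, so that codimensional bundles reduce to dimensional ones.\<close>

definition dual_op :: "('a::real_normed_vector \<Rightarrow>\<^sub>L 'a) \<Rightarrow> ('a \<Rightarrow>\<^sub>L real) \<Rightarrow>\<^sub>L ('a \<Rightarrow>\<^sub>L real)" where
  "dual_op \<P> = Blinfun (\<lambda>l. l o\<^sub>L \<P>)"

lemma dual_op_apply: "blinfun_apply (dual_op \<P>) l = l o\<^sub>L \<P>"
  unfolding dual_op_def
  by (subst bounded_linear_Blinfun_apply) (auto intro: bounded_bilinear.bounded_linear_left[OF bounded_bilinear_blinfun_compose])

lemma continuous_on_dual_op:
  fixes R :: "'x::metric_space \<Rightarrow> 'a::real_normed_vector \<Rightarrow>\<^sub>L 'a"
  assumes "continuous_on A R"
  shows "continuous_on A (\<lambda>x. dual_op (R x))"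
proof -
  have "bounded_linear (dual_op :: ('a \<Rightarrow>\<^sub>L 'a) \<Rightarrow> _)"
  proof (rule bounded_linear_intro[of _ 1])
    show "norm (dual_op \<P>) \<le> norm \<P> * 1" for \<P> :: "'a \<Rightarrow>\<^sub>L 'a"
    proof (rule norm_blinfun_bound)
      fix l
      show "norm (blinfun_apply (dual_op \<P>) l) \<le> norm \<P> * 1 * norm l"
        using norm_blinfun_compose[of l \<P>] by (simp add: dual_op_apply mult.commute)
    qed simp
  qed (auto intro!: blinfun_eqI simp: dual_op_apply blinfun.bilinear_simps)
  then show ?thesis using assms by (rule bounded_linear.continuous_on)
qed

text \<open>The coordinate functionals of a basis \<open>B\<close> of the range, composed with \<open>\<P>\<close>, form a basis of the
range of the adjoint: \<open>l o \<P> = (\<Sum>b\<in>B. l b *\<^sub>R \<phi> b)\<close> for every functional \<open>l\<close>.\<close>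

lemma dual_projection:
  fixes \<P> :: "'a::real_normed_vector \<Rightarrow>\<^sub>L 'a"
  assumes idem: "idempotent \<P>" and G: "fixed_space \<P> \<in> grassmannian k"
  shows "idempotent (dual_op \<P>)" "fixed_space (dual_op \<P>) \<in> grassmannian k"
    "common_kernel (fixed_space (dual_op \<P>)) = null_space \<P>"
proof -
  have PP: "\<P> (\<P> v) = \<P> v" for v using idem by (simp add: idempotent_def)
  show idd: "idempotent (dual_op \<P>)"
    by (auto simp: idempotent_def dual_op_apply PP intro!: blinfun_eqI)
  obtain B where B: "finite B" "independent B" "span B = fixed_space \<P>" "card B = k"
    using grassmannian_basis[OF G] .
  have Pv: "\<P> v \<in> span B" for v using B PP by (auto simp: fixed_space_def)
  define c where "c b v = representation B (\<P> v) b" for b v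
  have expand: "(\<Sum>b\<in>B. c b v *\<^sub>R b) = \<P> v" for v
    unfolding c_def using real_vector.sum_representation_eq[OF B(2) Pv B(1)] by simp
  have "bounded_linear (c b)" if b: "b \<in> B" for b
  proof -
    define S where "S = span (B - {b})"
    have "closed S" unfolding S_def using B by (intro compact_span_Int_cball(2)) auto
    moreover have "b \<notin> S" using B(2) b by (auto simp: dependent_def S_def)
    ultimately have d: "infdist b S > 0"
      by (metis S_def empty_iff infdist_pos_not_in_closed span_zero)
    have bound: "norm (c b v) \<le> norm v * (norm \<P> / infdist b S)" for v
    proof -
      have "\<P> v = c b v *\<^sub>R b + (\<Sum>b'\<in>B-{b}. c b' v *\<^sub>R b')"
        using expand[of v] B(1) b by (simp add: sum.remove)
      moreover have "(\<Sum>b'\<in>B-{b}. c b' v *\<^sub>R b') \<in> S"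
        unfolding S_def by (intro span_sum span_scale span_base)
      ultimately have "\<bar>c b v\<bar> * infdist b S \<le> norm (\<P> v)"
        using abs_times_infdist_le_norm[of S _ "c b v" b] by (simp add: S_def)
      also have "\<dots> \<le> norm \<P> * norm v" by (rule norm_blinfun)
      finally show ?thesis using d by (simp add: field_simps)
    qed
    show ?thesis
      by (rule bounded_linear_intro[OF _ _ bound])
        (use B(2) Pv in \<open>auto simp: c_def blinfun.bilinear_simps real_vector.representation_add
          real_vector.representation_scale\<close>)
  qed
  then have phi: "blinfun_apply (Blinfun (c b)) = c b" if "b \<in> B" for b
    using that by (simp add: bounded_linear_Blinfun_apply)
  define \<phi> where "\<phi> b = Blinfun (c b)" for b
  have phi: "blinfun_apply (\<phi> b) v = c b v" if "b \<in> B" for b v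
    using that phi by (simp add: \<phi>_def)
  have delta: "c b b' = (if b = b' then 1 else 0)" if "b \<in> B" "b' \<in> B" for b b'
  proof -
    have "\<P> b' = b'" using B that span_base by (auto simp: fixed_space_def)
    then show ?thesis using real_vector.representation_basis[OF B(2), of b'] that by (auto simp: c_def)
  qed
  have inj: "inj_on \<phi> B"
  proof (rule inj_onI)
    fix b b' assume b: "b \<in> B" "b' \<in> B" and eq: "\<phi> b = \<phi> b'"
    then have "c b b = c b' b" using phi by metis
    then show "b = b'" using delta b by (auto split: if_splits)
  qed
  have expl: "l o\<^sub>L \<P> = (\<Sum>b\<in>B. blinfun_apply l b *\<^sub>R \<phi> b)" for l :: "'a \<Rightarrow>\<^sub>L real"
  proof (rule blinfun_eqI)
    fix v
    have "(l o\<^sub>L \<P>) v = blinfun_apply l (\<Sum>b\<in>B. c b v *\<^sub>R b)" by (simp add: expand)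
    also have "\<dots> = (\<Sum>b\<in>B. blinfun_apply l b *\<^sub>R \<phi> b) v"
      by (simp add: blinfun.sum_right blinfun.sum_left blinfun.bilinear_simps phi mult.commute)
    finally show "(l o\<^sub>L \<P>) v = (\<Sum>b\<in>B. blinfun_apply l b *\<^sub>R \<phi> b) v" .
  qed
  have phiP: "\<phi> b \<in> fixed_space (dual_op \<P>)" if "b \<in> B" for b
    using that by (auto simp: fixed_space_def dual_op_apply phi PP c_def intro!: blinfun_eqI)
  have sp: "span (\<phi> ` B) = fixed_space (dual_op \<P>)"
  proof
    show "span (\<phi> ` B) \<subseteq> fixed_space (dual_op \<P>)"
      using phiP by (intro span_minimal subspace_fixed_space) auto
    show "fixed_space (dual_op \<P>) \<subseteq> span (\<phi> ` B)"
    proof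
      fix l assume "l \<in> fixed_space (dual_op \<P>)"
      then have "l = (\<Sum>b\<in>B. blinfun_apply l b *\<^sub>R \<phi> b)" using expl[of l] by (simp add: fixed_space_def dual_op_apply)
      also have "\<dots> \<in> span (\<phi> ` B)" by (intro span_sum span_scale span_base) auto
      finally show "l \<in> span (\<phi> ` B)" .
    qed
  qed
  have ind: "independent (\<phi> ` B)"
  proof (rule independent_if_scalars_zero)
    fix f l assume 0: "(\<Sum>l\<in>\<phi> ` B. f l *\<^sub>R l) = 0" and "l \<in> \<phi> ` B"
    then obtain b where b: "b \<in> B" "l = \<phi> b" by blast
    have "0 = blinfun_apply (\<Sum>b'\<in>B. f (\<phi> b') *\<^sub>R \<phi> b') b" using 0 inj by (simp add: sum.reindex)
    also have "\<dots> = (\<Sum>b'\<in>B. f (\<phi> b') * c b' b)"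
      by (simp add: blinfun.sum_left blinfun.bilinear_simps phi)
    also have "\<dots> = (\<Sum>b'\<in>B. if b' = b then f (\<phi> b') else 0)" using b delta by (intro sum.cong) auto
    also have "\<dots> = f (\<phi> b)" using b B by simp
    finally show "f l = 0" using b by simp
  qed (use B in auto)
  show "fixed_space (dual_op \<P>) \<in> grassmannian k"
    using B ind sp inj by (intro grassmannianI[of "\<phi> ` B"]) (auto simp: card_image)
  show "common_kernel (fixed_space (dual_op \<P>)) = null_space \<P>"
  proof (intro equalityI subsetI)
    fix v assume v: "v \<in> common_kernel (fixed_space (dual_op \<P>))"
    then have "c b v = 0" if "b \<in> B" for b using phiP[OF that] phi[OF that] by (auto simp: common_kernel_def)
    then have "\<P> v = 0" using expand[of v] by simp
    then show "v \<in> null_space \<P>" by (simp add: null_space_def)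
  next
    fix v assume "v \<in> null_space \<P>"
    then have v: "\<P> v = 0" by (simp add: null_space_def)
    have "blinfun_apply l v = 0" if "l \<in> fixed_space (dual_op \<P>)" for l
    proof -
      have "blinfun_apply l v = (l o\<^sub>L \<P>) v" using that by (simp add: fixed_space_def dual_op_apply)
      then show ?thesis by (simp add: v blinfun.bilinear_simps)
    qed
    then show "v \<in> common_kernel (fixed_space (dual_op \<P>))" by (simp add: common_kernel_def)
  qed
qed

lemma continuous_codim_bundle_null_space:
  fixes R :: "'x::metric_space \<Rightarrow> 'a::real_normed_vector \<Rightarrow>\<^sub>L 'a"
  assumes k: "k > 0" and R: "\<And>x. x \<in> A \<Longrightarrow> idempotent (R x)"
    "\<And>x. x \<in> A \<Longrightarrow> fixed_space (R x) \<in> grassmannian k" and cont: "continuous_on A R"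
  shows "continuous_codim_bundle k A (\<lambda>x. null_space (R x))"
  unfolding continuous_codim_bundle_def
proof (intro conjI ballI exI[of _ "\<lambda>x. fixed_space (dual_op (R x))"])
  fix x assume x: "x \<in> A"
  show "closed (null_space (R x))"
    unfolding null_space_def by (intro closed_Collect_eq continuous_intros)
  show "codimensional k (null_space (R x))"
    unfolding codimensional_def using R x is_direct_sum_projection subspace_null_space by blast
  show "fixed_space (dual_op (R x)) \<in> grassmannian k"
    "common_kernel (fixed_space (dual_op (R x))) = null_space (R x)"
    using dual_projection R x by blast+
next
  have "continuous_dim_bundle k A (\<lambda>x. fixed_space (dual_op (R x)))"
    using R dual_projection continuous_on_dual_op[OF cont]
    by (intro continuous_dim_bundle_fixed_space[OF k]) blast+
  then show "gap_continuous_on A (\<lambda>x. fixed_space (dual_op (R x)))"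
    by (simp add: continuous_dim_bundle_def)
qed

section \<open>The graph transform\<close>

text \<open>Banach's fixed point theorem for bounded sections over the bare set \<open>Z\<close>, where the value at \<open>x\<close> is
constrained by the values at \<open>x\<close> and at \<open>g x\<close>. The iteration starts at \<open>0\<close> and converges uniformly
at rate \<open>\<kappa> ^ n\<close>.\<close>

lemma fixed_section:
  fixes \<Phi> :: "'x \<Rightarrow> 'b::banach \<Rightarrow> 'b \<Rightarrow> 'b"
  assumes \<rho>: "0 \<le> \<rho>" and \<kappa>: "0 \<le> \<kappa>" "\<kappa> < 1" and g: "\<And>x. x \<in> Z \<Longrightarrow> g x \<in> Z"
    and ball: "\<And>x u v. x \<in> Z \<Longrightarrow> norm u \<le> \<rho> \<Longrightarrow> norm v \<le> \<rho> \<Longrightarrow> norm (\<Phi> x u v) \<le> \<rho>"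
    and contr: "\<And>x u v u' v'. x \<in> Z \<Longrightarrow> norm u \<le> \<rho> \<Longrightarrow> norm v \<le> \<rho> \<Longrightarrow> norm u' \<le> \<rho> \<Longrightarrow> norm v' \<le> \<rho> \<Longrightarrow>
      norm (\<Phi> x u v - \<Phi> x u' v') \<le> \<kappa> * max (norm (u - u')) (norm (v - v'))"
  obtains s where "\<And>x. x \<in> Z \<Longrightarrow> norm (s x) \<le> \<rho>" "\<And>x. x \<in> Z \<Longrightarrow> s x = \<Phi> x (s x) (s (g x))"
proof -
  define S where "S = rec_nat (\<lambda>x. 0) (\<lambda>n T x. \<Phi> x (T x) (T (g x)))"
  have S0: "S 0 x = 0" and SS: "S (Suc n) x = \<Phi> x (S n x) (S n (g x))" for n x by (auto simp: S_def)
  have Sb: "norm (S n x) \<le> \<rho>" if "x \<in> Z" for n x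
    using that by (induction n arbitrary: x) (auto simp: S0 SS \<rho> g ball)
  have Sd: "norm (S (Suc n) x - S n x) \<le> \<rho> * \<kappa> ^ n" if "x \<in> Z" for n x
    using that
  proof (induction n arbitrary: x)
    case 0
    then show ?case using Sb[of x 1] by (simp add: S0)
  next
    case (Suc n)
    have "norm (S (Suc (Suc n)) x - S (Suc n) x)
        \<le> \<kappa> * max (norm (S (Suc n) x - S n x)) (norm (S (Suc n) (g x) - S n (g x)))"
      unfolding SS[of "Suc n"] SS[of n x] using Suc.prems by (intro contr) (auto simp: Sb g simp flip: SS)
    also have "\<dots> \<le> \<kappa> * (\<rho> * \<kappa> ^ n)" using Suc g \<kappa> by (intro mult_left_mono) auto
    finally show ?case by (simp add: mult_ac)
  qed
  have "\<exists>l. (\<lambda>n. S n x) \<longlonglongrightarrow> l" if x: "x \<in> Z" for x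
  proof -
    have "summable (\<lambda>n. S (Suc n) x - S n x)"
      by (rule summable_comparison_test'[of "\<lambda>n. \<rho> * \<kappa> ^ n" 0])
        (use \<kappa> Sd[OF x] in \<open>auto intro!: summable_mult summable_geometric\<close>)
    then have "(\<lambda>n. \<Sum>i<n. S (Suc i) x - S i x) \<longlonglongrightarrow> (\<Sum>n. S (Suc n) x - S n x)"
      by (rule summable_LIMSEQ)
    then have "(\<lambda>n. S n x) \<longlonglongrightarrow> (\<Sum>n. S (Suc n) x - S n x)"
      unfolding sum_lessThan_telescope[of "\<lambda>i. S i x"] by (simp add: S0)
    then show ?thesis by blast
  qed
  then obtain s where s: "\<And>x. x \<in> Z \<Longrightarrow> (\<lambda>n. S n x) \<longlonglongrightarrow> s x" by metis
  have sb: "norm (s x) \<le> \<rho>" if "x \<in> Z" for x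
    using Lim_norm_ubound[OF _ s[OF that]] Sb[OF that] by (simp add: always_eventually)
  moreover have "s x = \<Phi> x (s x) (s (g x))" if x: "x \<in> Z" for x
  proof -
    have "(\<lambda>n. \<kappa> * max (norm (S n x - s x)) (norm (S n (g x) - s (g x)))) \<longlonglongrightarrow>
        \<kappa> * max (norm (s x - s x)) (norm (s (g x) - s (g x)))"
      using s[OF x] s[OF g[OF x]] by (intro tendsto_intros)
    then have lim0: "(\<lambda>n. \<kappa> * max (norm (S n x - s x)) (norm (S n (g x) - s (g x)))) \<longlonglongrightarrow> 0" by simp
    have "(\<lambda>n. S (Suc n) x - \<Phi> x (s x) (s (g x))) \<longlonglongrightarrow> 0"
      by (rule Lim_null_comparison[OF _ lim0], rule always_eventually)
        (use contr[OF x] Sb[OF x] Sb[OF g[OF x]] sb[OF x] sb[OF g[OF x]] in \<open>simp add: SS\<close>)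
    then have "(\<lambda>n. S (Suc n) x) \<longlonglongrightarrow> \<Phi> x (s x) (s (g x))" by (simp add: LIM_zero_iff)
    moreover have "(\<lambda>n. S (Suc n) x) \<longlonglongrightarrow> s x" using s[OF x] by (rule LIMSEQ_Suc)
    ultimately show ?thesis using LIMSEQ_unique by blast
  qed
  ultimately show ?thesis using that by blast
qed

text \<open>Instead of the Neumann series, the right inverse is obtained as the fixed point of \<open>S \<mapsto> 1 - E S\<close>; it is
also a left inverse because \<open>1 + E\<close> is injective.\<close>

lemma near_identity_invertible:
  fixes E :: "'a::banach \<Rightarrow>\<^sub>L 'a"
  assumes E: "norm E \<le> 1/2"
  obtains S :: "'a \<Rightarrow>\<^sub>L 'a" where "\<And>v. S v + E (S v) = v" "\<And>v. S (v + E v) = v" "norm S \<le> 2"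
proof -
  define \<Phi> :: "unit \<Rightarrow> ('a \<Rightarrow>\<^sub>L 'a) \<Rightarrow> ('a \<Rightarrow>\<^sub>L 'a) \<Rightarrow> ('a \<Rightarrow>\<^sub>L 'a)"
    where "\<Phi> = (\<lambda>x u v. id_blinfun - (E o\<^sub>L u))"
  have comp: "norm (E o\<^sub>L u) \<le> 1/2 * norm u" for u :: "'a \<Rightarrow>\<^sub>L 'a"
    using norm_blinfun_compose[of E u] mult_right_mono[OF E norm_ge_zero[of u]] by linarith
  obtain s where s: "norm (s ()) \<le> 2" "s () = \<Phi> () (s ()) (s ())"
  proof (rule fixed_section[of 2 "1/2" UNIV "\<lambda>x. x" \<Phi>])
    show "norm (\<Phi> x u v) \<le> 2" if "norm u \<le> 2" for x u v
    proof -
      have "norm (id_blinfun - (E o\<^sub>L u)) \<le> norm (id_blinfun :: 'a \<Rightarrow>\<^sub>L 'a) + norm (E o\<^sub>L u)"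
        by (rule norm_triangle_ineq4)
      then show ?thesis using comp[of u] that norm_blinfun_id_le[where 'a='a] by (simp add: \<Phi>_def)
    qed
    show "norm (\<Phi> x u v - \<Phi> x u' v') \<le> 1/2 * max (norm (u - u')) (norm (v - v'))" for x u v u' v'
    proof -
      have "\<Phi> x u v - \<Phi> x u' v' = E o\<^sub>L (u' - u)"
        by (auto intro!: blinfun_eqI simp: \<Phi>_def blinfun.bilinear_simps)
      then show ?thesis using comp[of "u' - u"] by (simp add: norm_minus_commute)
    qed
  qed auto
  define S where "S = s ()"
  have right: "S v + E (S v) = v" for v
  proof -
    have "S v = (id_blinfun - (E o\<^sub>L S)) v" using s(2) by (simp add: S_def \<Phi>_def)
    then show ?thesis by (simp add: blinfun.bilinear_simps eq_diff_eq)
  qed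
  have inj: "v = 0" if "v + E v = 0" for v
  proof -
    have "norm v = norm (E v)" using that by (metis add.commute add_eq_0_iff norm_minus_cancel)
    also have "\<dots> \<le> 1/2 * norm v" using norm_blinfun[of E v] mult_right_mono[OF E, of "norm v"] by simp
    finally show ?thesis by simp
  qed
  have "S (v + E v) = v" for v
  proof -
    have "(S (v + E v) - v) + E (S (v + E v) - v) = 0"
      using right[of "v + E v"] by (simp add: blinfun.bilinear_simps algebra_simps)
    then show ?thesis using inj[of "S (v + E v) - v"] by simp
  qed
  then show ?thesis using right s(1) by (intro that[of S]) (simp_all add: S_def)
qed

lemma norm_mult_norm_le:
  fixes f :: "'a::real_normed_vector \<Rightarrow>\<^sub>L 'b::real_normed_vector" and g :: "'c::real_normed_vector \<Rightarrow>\<^sub>L 'd::real_normed_vector"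
  assumes t: "0 \<le> t" and le: "\<And>v w. norm (f v) * norm (g w) \<le> t * (norm v * norm w)"
  shows "norm f * norm g \<le> t"
proof -
  have 1: "norm (g w) * norm f \<le> t * norm w" for w
  proof -
    have "norm (norm (g w) *\<^sub>R f) \<le> t * norm w"
      using t le[of _ w] by (intro norm_blinfun_bound) (auto simp: blinfun.bilinear_simps mult_ac)
    then show ?thesis by simp
  qed
  have "norm (norm f *\<^sub>R g) \<le> t"
    using t 1 by (intro norm_blinfun_bound) (auto simp: blinfun.bilinear_simps mult_ac)
  then show ?thesis by simp
qed

text \<open>The range-to-range block of \<open>A\<close> is injective between spaces of equal dimension, hence bijective;
\<open>\<alpha>\<close> is its inverse, extended by \<open>0\<close> along the null space of \<open>\<P>'\<close>.\<close>

lemma block_inverse: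
  fixes A \<P> \<P>' :: "'a::real_normed_vector \<Rightarrow>\<^sub>L 'a"
  assumes idem: "idempotent \<P>" "idempotent \<P>'"
    and G: "fixed_space \<P> \<in> grassmannian k" "fixed_space \<P>' \<in> grassmannian k"
    and m: "m > 0" and lower: "\<And>p. p \<in> fixed_space \<P> \<Longrightarrow> m * norm p \<le> norm (\<P>' (A p))"
  obtains \<alpha> :: "'a \<Rightarrow>\<^sub>L 'a" where "\<And>v. \<alpha> v \<in> fixed_space \<P>" "\<And>v. \<P>' (A (\<alpha> v)) = \<P>' v"
    "\<And>p. p \<in> fixed_space \<P> \<Longrightarrow> \<alpha> (\<P>' (A p)) = p" "\<And>v. m * norm (\<alpha> v) \<le> norm (\<P>' v)"
proof -
  define a where "a p = \<P>' (A p)" for p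
  have lin: "linear a" unfolding a_def
    by (intro linearI) (simp_all add: blinfun.bilinear_simps)
  have sub: "subspace (fixed_space \<P>)" by (rule subspace_fixed_space)
  have a0: "p = 0" if "p \<in> fixed_space \<P>" "a p = 0" for p
    using lower[OF that(1)] that(2) m by (simp add: a_def mult_le_0_iff)
  then have inj: "inj_on a (fixed_space \<P>)" using linear_inj_on_iff_eq_0[OF lin sub] by blast
  have "a ` fixed_space \<P> \<subseteq> fixed_space \<P>'" using idem by (auto simp: a_def fixed_space_def idempotent_def)
  then have im: "a ` fixed_space \<P> = fixed_space \<P>'"
    using grassmannian_subset_eq[OF grassmannian_inj_image[OF G(1) lin inj] G(2)] by blast
  have "\<exists>p. p \<in> fixed_space \<P> \<and> a p = \<P>' v" for v
  proof -
    have "\<P>' v \<in> fixed_space \<P>'" using idem by (simp add: fixed_space_def idempotent_def)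
    then have "\<P>' v \<in> a ` fixed_space \<P>" by (simp add: im)
    then show ?thesis by (metis imageE)
  qed
  then obtain \<beta> where \<beta>: "\<And>v. \<beta> v \<in> fixed_space \<P>" "\<And>v. a (\<beta> v) = \<P>' v" by metis
  have uniq: "\<beta> v = p" if "p \<in> fixed_space \<P>" "a p = \<P>' v" for p v
    using inj_onD[OF inj _ \<beta>(1) that(1)] \<beta>(2) that(2) by simp
  have bound: "m * norm (\<beta> v) \<le> norm (\<P>' v)" for v
    using lower[OF \<beta>(1)[of v]] \<beta>(2)[of v] by (simp add: a_def)
  have "bounded_linear \<beta>"
  proof (rule bounded_linear_intro[of _ "norm \<P>' / m"])
    show "\<beta> (u + v) = \<beta> u + \<beta> v" for u v
      by (intro uniq subspace_add sub \<beta>(1)) (simp add: linear_add[OF lin] \<beta>(2) blinfun.bilinear_simps)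
    show "\<beta> (c *\<^sub>R v) = c *\<^sub>R \<beta> v" for c v
      by (intro uniq subspace_scale sub \<beta>(1)) (simp add: linear_scale[OF lin] \<beta>(2) blinfun.bilinear_simps)
    show "norm (\<beta> v) \<le> norm v * (norm \<P>' / m)" for v
    proof -
      have "m * norm (\<beta> v) \<le> norm \<P>' * norm v" using bound[of v] norm_blinfun[of \<P>' v] by linarith
      then show ?thesis using m by (simp add: field_simps)
    qed
  qed
  then have ap: "blinfun_apply (Blinfun \<beta>) = \<beta>" by (simp add: bounded_linear_Blinfun_apply)
  show ?thesis
  proof
    show "blinfun_apply (Blinfun \<beta>) v \<in> fixed_space \<P>" for v using \<beta> by (simp add: ap)
    show "\<P>' (A (blinfun_apply (Blinfun \<beta>) v)) = \<P>' v" for v using \<beta>(2)[of v] by (simp add: ap a_def)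
    show "m * norm (blinfun_apply (Blinfun \<beta>) v) \<le> norm (\<P>' v)" for v using bound by (simp add: ap)
    show "blinfun_apply (Blinfun \<beta>) (\<P>' (A p)) = p" if "p \<in> fixed_space \<P>" for p
      unfolding ap using idem that by (intro uniq) (auto simp: a_def idempotent_def)
  qed
qed

lemma triple_product_difference:
  fixes u v u' v' a b c d :: "'a::real_normed_vector \<Rightarrow>\<^sub>L 'a"
  assumes "norm a \<le> na" "norm b \<le> nb" "norm c \<le> nc"
    and "norm v \<le> \<rho>" "norm u' \<le> \<rho>" 
  shows "norm ((a o\<^sub>L u o\<^sub>L b o\<^sub>L v o\<^sub>L c) - (a o\<^sub>L u' o\<^sub>L b o\<^sub>L v' o\<^sub>L c))
    \<le> 2 * (na * nb * nc * \<rho>) * max (norm (u - u')) (norm (v - v'))"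
proof -
  let ?M = "max (norm (u - u')) (norm (v - v'))"
  have five: "norm (a o\<^sub>L x o\<^sub>L b o\<^sub>L y o\<^sub>L c) \<le> na * nb * nc * (norm x * norm y)" for x y
  proof (rule norm_blinfun_bound)
    have n: "0 \<le> na" "0 \<le> nb" "0 \<le> nc" using assms norm_ge_zero order_trans by blast+
    then show "0 \<le> na * nb * nc * (norm x * norm y)" by simp
    fix w
    have "norm (a (x (b (y (c w))))) \<le> na * (norm x * (nb * (norm y * (nc * norm w))))"
      by (intro order_trans[OF norm_blinfun] mult_mono assms order_refl mult_nonneg_nonneg n norm_ge_zero)
    then show "norm (blinfun_apply (a o\<^sub>L x o\<^sub>L b o\<^sub>L y o\<^sub>L c) w) \<le> na * nb * nc * (norm x * norm y) * norm w"
      by (simp add: mult_ac)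
  qed
  have n: "0 \<le> na" "0 \<le> nb" "0 \<le> nc" "0 \<le> \<rho>" using assms norm_ge_zero order_trans by blast+
  have "(a o\<^sub>L u o\<^sub>L b o\<^sub>L v o\<^sub>L c) - (a o\<^sub>L u' o\<^sub>L b o\<^sub>L v' o\<^sub>L c)
      = (a o\<^sub>L (u - u') o\<^sub>L b o\<^sub>L v o\<^sub>L c) + (a o\<^sub>L u' o\<^sub>L b o\<^sub>L (v - v') o\<^sub>L c)"
    by (auto intro!: blinfun_eqI simp: blinfun.bilinear_simps)
  then have "norm ((a o\<^sub>L u o\<^sub>L b o\<^sub>L v o\<^sub>L c) - (a o\<^sub>L u' o\<^sub>L b o\<^sub>L v' o\<^sub>L c))
      \<le> na * nb * nc * (norm (u - u') * norm v) + na * nb * nc * (norm u' * norm (v - v'))"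
    using norm_triangle_le[OF add_mono[OF five[of "u - u'" v] five[of u' "v - v'"]]] by simp
  also have "\<dots> \<le> na * nb * nc * (?M * \<rho>) + na * nb * nc * (\<rho> * ?M)"
    using assms n by (intro add_mono mult_left_mono mult_mono) (auto simp: le_max_iff_disj)
  finally show ?thesis by (simp add: mult_ac)
qed

text \<open>In block form with respect to the projections, let \<open>A x\<close> have diagonal blocks \<open>a\<close>, \<open>d\<close> and off-diagonal
blocks \<open>b\<close>, \<open>c\<close>, and let \<open>\<alpha>\<close> be the inverse of \<open>a\<close>. The graph of \<open>\<sigma>\<close> over the
range is invariant iff \<open>\<sigma> (f x) (a + b \<sigma> x) = c + d \<sigma> x\<close>, and the graph of \<open>\<tau>\<close> over the null space iff
\<open>a \<tau> x + b = \<tau> (f x) (d + c \<tau> x)\<close>. Multiplying by \<open>\<alpha>\<close> turns both into fixed point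
equations without inverting any unknown; the linear part contracts because \<open>norm d * norm \<alpha>\<close> is small, and the
quadratic part because \<open>b\<close> and \<open>c\<close> are small. The first equation is solved along \<open>g\<close>, the second along \<open>f\<close>.
Finally \<open>1 + \<sigma> x + \<tau> x\<close> maps the reference splitting onto the invariant one, so conjugating the
reference projection by it gives the new projection.\<close>

lemma invariant_splitting_near:
  fixes A \<P> :: "'x \<Rightarrow> 'a::banach \<Rightarrow>\<^sub>L 'a"
  assumes f: "\<And>x. x \<in> Z \<Longrightarrow> f x \<in> Z" and g: "\<And>x. x \<in> Z \<Longrightarrow> g x \<in> Z"
    and fg: "\<And>x. x \<in> Z \<Longrightarrow> f (g x) = x" and gf: "\<And>x. x \<in> Z \<Longrightarrow> g (f x) = x"
    and idem: "\<And>x. x \<in> Z \<Longrightarrow> idempotent (\<P> x)"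
    and G: "\<And>x. x \<in> Z \<Longrightarrow> fixed_space (\<P> x) \<in> grassmannian k"
    and C: "0 \<le> C" "\<And>x. x \<in> Z \<Longrightarrow> norm (\<P> x) \<le> C"
    and m: "m > 0" and \<eta>: "0 \<le> \<eta>" and \<theta>: "0 \<le> \<theta>" and \<rho>: "0 < \<rho>" "\<rho> \<le> 1/4"
    and lower: "\<And>x p. x \<in> Z \<Longrightarrow> p \<in> fixed_space (\<P> x) \<Longrightarrow> m * norm p \<le> norm (\<P> (f x) (A x p))"
    and PQ: "\<And>x q. x \<in> Z \<Longrightarrow> q \<in> null_space (\<P> x) \<Longrightarrow> norm (\<P> (f x) (A x q)) \<le> \<eta> * norm q"
    and QP: "\<And>x p. x \<in> Z \<Longrightarrow> p \<in> fixed_space (\<P> x) \<Longrightarrow>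
      norm (A x p - \<P> (f x) (A x p)) \<le> \<eta> * norm p"
    and dom: "\<And>x p q. x \<in> Z \<Longrightarrow> p \<in> fixed_space (\<P> x) \<Longrightarrow> q \<in> null_space (\<P> x) \<Longrightarrow>
      norm (A x q - \<P> (f x) (A x q)) * norm p \<le> \<theta> * norm q * norm (\<P> (f x) (A x p))"
    and small: "\<theta> * (1 + C)^2 \<le> 1/4" "\<eta> * (1 + C)^3 \<le> m * \<rho> / 4"
  obtains R where "\<And>x. x \<in> Z \<Longrightarrow> idempotent (R x)" "\<And>x. x \<in> Z \<Longrightarrow> fixed_space (R x) \<in> grassmannian k"
    "\<And>x. x \<in> Z \<Longrightarrow> norm (R x - \<P> x) \<le> 8 * C * \<rho>"
    "\<And>x v. x \<in> Z \<Longrightarrow> A x (R x v) = R (f x) (A x v)"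
proof -
  define D where "D = 1 + C"
  have D: "D \<ge> 1" using C by (simp add: D_def)
  define N where "N x = id_blinfun - \<P> x" for x
  have Nv: "N x v = v - \<P> x v" for x v by (simp add: N_def blinfun.bilinear_simps)
  have PP: "\<P> x (\<P> x v) = \<P> x v" if "x \<in> Z" for x v
    using idem[OF that] by (simp add: idempotent_def)
  have Pfix: "\<P> x v \<in> fixed_space (\<P> x)" if "x \<in> Z" for x v using PP[OF that] by (simp add: fixed_space_def)
  have Nnull: "N x v \<in> null_space (\<P> x)" if "x \<in> Z" for x v
    using PP[OF that] by (simp add: null_space_def Nv blinfun.bilinear_simps)
  have Pn: "norm (\<P> x v) \<le> D * norm v" if "x \<in> Z" for x v
    using norm_blinfun[of "\<P> x" v] mult_right_mono[OF C(2)[OF that] norm_ge_zero[of v]] norm_ge_zero[of v]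
    unfolding D_def distrib_right by linarith
  have Nn: "norm (N x v) \<le> D * norm v" if "x \<in> Z" for x v
    using norm_triangle_ineq4[of v "\<P> x v"] norm_blinfun[of "\<P> x" v]
      mult_right_mono[OF C(2)[OF that] norm_ge_zero[of v]]
    unfolding Nv D_def by (simp add: algebra_simps)
  have Nop: "norm (N x) \<le> D" if "x \<in> Z" for x
    using Nn[OF that] D by (intro norm_blinfun_bound) auto
  define b c d where "b x = \<P> (f x) o\<^sub>L A x o\<^sub>L N x" and "c x = N (f x) o\<^sub>L A x o\<^sub>L \<P> x"
    and "d x = N (f x) o\<^sub>L A x o\<^sub>L N x" for x
  have bn: "norm (b x) \<le> \<eta> * D" if x: "x \<in> Z" for x
  proof (rule norm_blinfun_bound)
    fix v
    have "norm (b x v) \<le> \<eta> * norm (N x v)" unfolding b_def using PQ[OF x Nnull[OF x]] by simp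
    also have "\<dots> \<le> \<eta> * (D * norm v)" using Nn[OF x] \<eta> by (intro mult_left_mono)
    finally show "norm (b x v) \<le> \<eta> * D * norm v" by (simp add: mult_ac)
  qed (use \<eta> D in simp)
  have cn: "norm (c x) \<le> \<eta> * D" if x: "x \<in> Z" for x
  proof (rule norm_blinfun_bound)
    fix v
    have "norm (c x v) \<le> \<eta> * norm (\<P> x v)" unfolding c_def using QP[OF x Pfix[OF x]] by (simp add: Nv)
    also have "\<dots> \<le> \<eta> * (D * norm v)" using Pn[OF x] \<eta> by (intro mult_left_mono)
    finally show "norm (c x v) \<le> \<eta> * D * norm v" by (simp add: mult_ac)
  qed (use \<eta> D in simp)
  have "\<forall>x\<in>Z. \<exists>\<alpha> :: 'a \<Rightarrow>\<^sub>L 'a. (\<forall>v. \<alpha> v \<in> fixed_space (\<P> x)) \<and> (\<forall>v. \<P> (f x) (A x (\<alpha> v)) = \<P> (f x) v) \<and>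
    (\<forall>p \<in> fixed_space (\<P> x). \<alpha> (\<P> (f x) (A x p)) = p) \<and> (\<forall>v. m * norm (\<alpha> v) \<le> norm (\<P> (f x) v))"
  proof
    fix x assume x: "x \<in> Z"
    from block_inverse[OF idem[OF x] idem[OF f[OF x]] G[OF x] G[OF f[OF x]] m lower[OF x]]
    show "\<exists>\<alpha> :: 'a \<Rightarrow>\<^sub>L 'a. (\<forall>v. \<alpha> v \<in> fixed_space (\<P> x)) \<and> (\<forall>v. \<P> (f x) (A x (\<alpha> v)) = \<P> (f x) v) \<and>
    (\<forall>p \<in> fixed_space (\<P> x). \<alpha> (\<P> (f x) (A x p)) = p) \<and> (\<forall>v. m * norm (\<alpha> v) \<le> norm (\<P> (f x) v))"
      by metis
  qed
  then obtain \<alpha> where \<alpha>: "\<And>x v. x \<in> Z \<Longrightarrow> blinfun_apply (\<alpha> x) v \<in> fixed_space (\<P> x)"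
    "\<And>x v. x \<in> Z \<Longrightarrow> \<P> (f x) (A x (blinfun_apply (\<alpha> x) v)) = \<P> (f x) v"
    "\<And>x p. x \<in> Z \<Longrightarrow> p \<in> fixed_space (\<P> x) \<Longrightarrow> \<alpha> x (\<P> (f x) (A x p)) = p"
    "\<And>x v. x \<in> Z \<Longrightarrow> m * norm (\<alpha> x v) \<le> norm (\<P> (f x) v)"
    by metis
  have P\<alpha>: "\<P> x (\<alpha> x v) = \<alpha> x v" if "x \<in> Z" for x v
    using \<alpha>(1)[OF that] by (simp add: fixed_space_def)
  have \<alpha>0: "\<alpha> x v = 0" if "x \<in> Z" "\<P> (f x) v = 0" for x v
    using \<alpha>(4)[OF that(1), of v] that(2) m by (simp add: mult_le_0_iff)
  have \<alpha>n: "norm (\<alpha> x) \<le> D / m" if x: "x \<in> Z" for x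
  proof (rule norm_blinfun_bound)
    fix v
    have "m * norm (\<alpha> x v) \<le> D * norm v" using \<alpha>(4)[OF x, of v] Pn[OF f[OF x], of v] by linarith
    then show "norm (\<alpha> x v) \<le> D / m * norm v" using m by (simp add: field_simps)
  qed (use m D in simp)
  have d\<alpha>: "norm (d x) * norm (\<alpha> x) \<le> 1/4" if x: "x \<in> Z" for x
  proof -
    have "norm (d x) * norm (\<alpha> x) \<le> \<theta> * D^2"
    proof (rule norm_mult_norm_le)
      fix v w
      have "norm (d x v) * norm (\<alpha> x w) \<le> \<theta> * norm (N x v) * norm (\<P> (f x) (A x (\<alpha> x w)))"
        unfolding d_def using dom[OF x \<alpha>(1)[OF x, of w] Nnull[OF x, of v]] by (simp add: Nv)
      also have "\<dots> = \<theta> * norm (N x v) * norm (\<P> (f x) w)" using \<alpha>(2)[OF x] by simp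
      also have "\<dots> \<le> \<theta> * (D * norm v) * (D * norm w)"
        using Nn[OF x] Pn[OF f[OF x]] \<theta> D by (intro mult_mono mult_left_mono) auto
      finally show "norm (d x v) * norm (\<alpha> x w) \<le> \<theta> * D^2 * (norm v * norm w)"
        by (simp add: power2_eq_square mult_ac)
    qed (use \<theta> in simp)
    then show ?thesis using small(1) by (simp add: D_def)
  qed
  define E where "E = \<eta> * D * D / m"
  have E: "0 \<le> E" using \<eta> D m by (simp add: E_def)
  have ED: "E * D \<le> \<rho> / 4"
    using small(2) m unfolding E_def D_def[symmetric] by (simp add: field_simps power3_eq_cube)
  have E4: "E \<le> \<rho> / 4" using ED mult_left_mono[OF D E] by linarith
  define \<kappa> where "\<kappa> = 1/4 + 2 * (E * D * \<rho>)"
  have "E * D * \<rho> \<le> \<rho> / 4 * \<rho>" using ED \<rho> by (intro mult_right_mono) auto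
  also have "\<dots> \<le> 1/4 / 4 * 1" using \<rho> by (intro mult_mono) auto
  finally have ED\<rho>: "E * D * \<rho> \<le> 1/16" by simp
  have \<kappa>: "0 \<le> \<kappa>" "\<kappa> < 1" using ED\<rho> E D \<rho> by (auto simp: \<kappa>_def)
  have ball: "E + 1/4 * \<rho> + (E * D * \<rho>) * \<rho> \<le> \<rho>"
  proof -
    have "(E * D * \<rho>) * \<rho> \<le> 1/16 * \<rho>" using ED\<rho> \<rho> by (intro mult_right_mono) auto
    then show ?thesis using E4 \<rho> by linarith
  qed
  have comp2: "norm (a' o\<^sub>L b') \<le> x * y" if "norm a' \<le> x" "norm b' \<le> y" for a' b' :: "'a \<Rightarrow>\<^sub>L 'a" and x y
  proof -
    have "norm a' * norm b' \<le> x * y" using that order_trans[OF norm_ge_zero that(1)] by (intro mult_mono) auto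
    then show ?thesis using norm_blinfun_compose[of a' b'] by linarith
  qed
  \<comment> \<open>the factor \<open>N x\<close> forces \<open>\<sigma> x\<close> to take values in the null space; \<open>\<alpha> (g x)\<close> makes it vanish there\<close>
  define S where "S x u v = (c (g x) + (d (g x) o\<^sub>L v) - (N x o\<^sub>L u o\<^sub>L b (g x) o\<^sub>L v)) o\<^sub>L \<alpha> (g x)" for x u v
  have lin: "norm (d x o\<^sub>L v o\<^sub>L \<alpha> x) \<le> 1/4 * norm v" if x: "x \<in> Z" for x v
  proof -
    have "norm (d x o\<^sub>L v o\<^sub>L \<alpha> x) \<le> norm (d x) * norm v * norm (\<alpha> x)" by (intro comp2) auto
    also have "\<dots> = (norm (d x) * norm (\<alpha> x)) * norm v" by simp
    also have "\<dots> \<le> 1/4 * norm v" using d\<alpha>[OF x] by (intro mult_right_mono) auto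
    finally show ?thesis .
  qed
  have lin': "norm (\<alpha> x o\<^sub>L v o\<^sub>L d x) \<le> 1/4 * norm v" if x: "x \<in> Z" for x v
  proof -
    have "norm (\<alpha> x o\<^sub>L v o\<^sub>L d x) \<le> norm (\<alpha> x) * norm v * norm (d x)" by (intro comp2) auto
    also have "\<dots> = (norm (d x) * norm (\<alpha> x)) * norm v" by simp
    also have "\<dots> \<le> 1/4 * norm v" using d\<alpha>[OF x] by (intro mult_right_mono) auto
    finally show ?thesis .
  qed
  obtain \<sigma> where \<sigma>n: "\<And>x. x \<in> Z \<Longrightarrow> norm (\<sigma> x) \<le> \<rho>" and \<sigma>: "\<And>x. x \<in> Z \<Longrightarrow> \<sigma> x = S x (\<sigma> x) (\<sigma> (g x))"
  proof (rule fixed_section[of \<rho> \<kappa> Z g S])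
    fix x and u v u' v' :: "'a \<Rightarrow>\<^sub>L 'a" assume x: "x \<in> Z"
      and n: "norm u \<le> \<rho>" "norm v \<le> \<rho>" "norm u' \<le> \<rho>" "norm v' \<le> \<rho>"
    have y: "g x \<in> Z" using g x by blast
    have "S x u v - S x u' v' = (d (g x) o\<^sub>L (v - v') o\<^sub>L \<alpha> (g x)) -
        ((N x o\<^sub>L u o\<^sub>L b (g x) o\<^sub>L v o\<^sub>L \<alpha> (g x)) - (N x o\<^sub>L u' o\<^sub>L b (g x) o\<^sub>L v' o\<^sub>L \<alpha> (g x)))"
      unfolding S_def by (auto intro!: blinfun_eqI simp: blinfun.bilinear_simps)
    then have "norm (S x u v - S x u' v') \<le> 1/4 * norm (v - v') +
        2 * (D * (\<eta> * D) * (D / m) * \<rho>) * max (norm (u - u')) (norm (v - v'))"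
      using lin[OF y, of "v - v'"]
        triple_product_difference[OF Nop[OF x] bn[OF y] \<alpha>n[OF y] n(2,3), of u v'] norm_triangle_ineq4
      by (smt (verit))
    also have "D * (\<eta> * D) * (D / m) * \<rho> = E * D * \<rho>" by (simp add: E_def mult_ac)
    also have "1/4 * norm (v - v') + 2 * (E * D * \<rho>) * max (norm (u - u')) (norm (v - v')) \<le>
        \<kappa> * max (norm (u - u')) (norm (v - v'))"
      unfolding \<kappa>_def by (simp add: algebra_simps)
    finally show "norm (S x u v - S x u' v') \<le> \<kappa> * max (norm (u - u')) (norm (v - v'))" .
  next
    fix x and u v :: "'a \<Rightarrow>\<^sub>L 'a" assume x: "x \<in> Z" and n: "norm u \<le> \<rho>" "norm v \<le> \<rho>"
    have y: "g x \<in> Z" using g x by blast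
    have "S x u v = (c (g x) o\<^sub>L \<alpha> (g x)) + (d (g x) o\<^sub>L v o\<^sub>L \<alpha> (g x)) - (N x o\<^sub>L u o\<^sub>L b (g x) o\<^sub>L v o\<^sub>L \<alpha> (g x))"
      unfolding S_def by (auto intro!: blinfun_eqI simp: blinfun.bilinear_simps)
    then have "norm (S x u v) \<le> norm (c (g x) o\<^sub>L \<alpha> (g x)) + norm (d (g x) o\<^sub>L v o\<^sub>L \<alpha> (g x))
        + norm (N x o\<^sub>L u o\<^sub>L b (g x) o\<^sub>L v o\<^sub>L \<alpha> (g x))"
      using norm_triangle_ineq4 norm_triangle_ineq by (smt (verit))
    also have "\<dots> \<le> \<eta> * D * (D / m) + 1/4 * \<rho> + D * \<rho> * (\<eta> * D) * \<rho> * (D / m)"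
      using lin[OF y, of v] n comp2[OF cn[OF y] \<alpha>n[OF y]]
        comp2[OF comp2[OF comp2[OF comp2[OF Nop[OF x] n(1)] bn[OF y]] n(2)] \<alpha>n[OF y]] by linarith
    also have "\<dots> = E + 1/4 * \<rho> + (E * D * \<rho>) * \<rho>" by (simp add: E_def mult_ac)
    finally show "norm (S x u v) \<le> \<rho>" using ball by linarith
  qed (use \<rho> \<kappa> g in auto)
  \<comment> \<open>here \<open>\<alpha> x\<close> forces values in the range, and the right factors \<open>N x\<close> make \<open>\<tau> x\<close> vanish on the range\<close>
  define W where "W x u v = \<alpha> x o\<^sub>L ((v o\<^sub>L d x) + (v o\<^sub>L c x o\<^sub>L u o\<^sub>L N x) - b x)" for x u v
  obtain \<tau> where \<tau>n: "\<And>x. x \<in> Z \<Longrightarrow> norm (\<tau> x) \<le> \<rho>" and \<tau>: "\<And>x. x \<in> Z \<Longrightarrow> \<tau> x = W x (\<tau> x) (\<tau> (f x))"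
  proof (rule fixed_section[of \<rho> \<kappa> Z f W])
    fix x and u v u' v' :: "'a \<Rightarrow>\<^sub>L 'a" assume x: "x \<in> Z"
      and n: "norm u \<le> \<rho>" "norm v \<le> \<rho>" "norm u' \<le> \<rho>" "norm v' \<le> \<rho>"
    have "W x u v - W x u' v' = (\<alpha> x o\<^sub>L (v - v') o\<^sub>L d x) +
        ((\<alpha> x o\<^sub>L v o\<^sub>L c x o\<^sub>L u o\<^sub>L N x) - (\<alpha> x o\<^sub>L v' o\<^sub>L c x o\<^sub>L u' o\<^sub>L N x))"
      unfolding W_def by (auto intro!: blinfun_eqI simp: blinfun.bilinear_simps)
    then have "norm (W x u v - W x u' v') \<le> 1/4 * norm (v - v') +
        2 * ((D / m) * (\<eta> * D) * D * \<rho>) * max (norm (v - v')) (norm (u - u'))"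
      using lin'[OF x, of "v - v'"]
        triple_product_difference[OF \<alpha>n[OF x] cn[OF x] Nop[OF x] n(1,4), of v u'] norm_triangle_ineq
      by (smt (verit))
    also have "(D / m) * (\<eta> * D) * D * \<rho> = E * D * \<rho>" by (simp add: E_def mult_ac)
    also have "1/4 * norm (v - v') + 2 * (E * D * \<rho>) * max (norm (v - v')) (norm (u - u')) \<le>
        \<kappa> * max (norm (u - u')) (norm (v - v'))"
      unfolding \<kappa>_def by (simp add: algebra_simps max.commute)
    finally show "norm (W x u v - W x u' v') \<le> \<kappa> * max (norm (u - u')) (norm (v - v'))" .
  next
    fix x and u v :: "'a \<Rightarrow>\<^sub>L 'a" assume x: "x \<in> Z" and n: "norm u \<le> \<rho>" "norm v \<le> \<rho>"
    have "W x u v = (\<alpha> x o\<^sub>L v o\<^sub>L d x) + (\<alpha> x o\<^sub>L v o\<^sub>L c x o\<^sub>L u o\<^sub>L N x) - (\<alpha> x o\<^sub>L b x)"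
      unfolding W_def by (auto intro!: blinfun_eqI simp: blinfun.bilinear_simps)
    then have "norm (W x u v) \<le> norm (\<alpha> x o\<^sub>L v o\<^sub>L d x) + norm (\<alpha> x o\<^sub>L v o\<^sub>L c x o\<^sub>L u o\<^sub>L N x)
        + norm (\<alpha> x o\<^sub>L b x)"
      using norm_triangle_ineq4 norm_triangle_ineq by (smt (verit))
    also have "\<dots> \<le> 1/4 * \<rho> + (D / m) * \<rho> * (\<eta> * D) * \<rho> * D + (D / m) * (\<eta> * D)"
      using lin'[OF x, of v] n comp2[OF \<alpha>n[OF x] bn[OF x]]
        comp2[OF comp2[OF comp2[OF comp2[OF \<alpha>n[OF x] n(2)] cn[OF x]] n(1)] Nop[OF x]] by linarith
    also have "\<dots> = E + 1/4 * \<rho> + (E * D * \<rho>) * \<rho>" by (simp add: E_def mult_ac)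
    finally show "norm (W x u v) \<le> \<rho>" using ball by linarith
  qed (use \<rho> \<kappa> f in auto)
  have P\<sigma>: "\<P> x (\<sigma> x v) = 0" if x: "x \<in> Z" for x v
  proof -
    have "\<P> x (S x u w v) = 0" for u w
      unfolding S_def c_def d_def using fg[OF x] PP[OF x]
      by (simp add: blinfun.bilinear_simps Nv)
    then show ?thesis using \<sigma>[OF x] by metis
  qed
  have \<sigma>N: "\<sigma> x v = 0" if x: "x \<in> Z" and v: "\<P> x v = 0" for x v
  proof -
    have "\<alpha> (g x) v = 0" using \<alpha>0[OF g[OF x], of v] fg[OF x] v by simp
    then have "S x u w v = 0" for u w unfolding S_def by (simp add: blinfun.bilinear_simps)
    then show ?thesis using \<sigma>[OF x] by metis
  qed
  have P\<tau>: "\<P> x (\<tau> x v) = \<tau> x v" if x: "x \<in> Z" for x v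
  proof -
    have "\<P> x (W x u w v) = W x u w v" for u w
      unfolding W_def using P\<alpha>[OF x] by simp
    then show ?thesis using \<tau>[OF x] by metis
  qed
  have \<tau>N: "\<tau> x v = 0" if x: "x \<in> Z" and v: "\<P> x v = v" for x v
  proof -
    have "N x v = 0" using v by (simp add: Nv)
    then have "W x u w v = 0" for u w unfolding W_def b_def d_def by (simp add: blinfun.bilinear_simps)
    then show ?thesis using \<tau>[OF x] by metis
  qed
  have inv\<sigma>: "A x (p + \<sigma> x p) = \<P> (f x) (A x (p + \<sigma> x p)) + \<sigma> (f x) (\<P> (f x) (A x (p + \<sigma> x p)))"
    if x: "x \<in> Z" and p: "\<P> x p = p" for x p
  proof -
    define s where "s = \<sigma> x p"
    have Ns: "N x s = s" using P\<sigma>[OF x] by (simp add: Nv s_def)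
    have bs: "b x s = \<P> (f x) (A x s)" by (simp add: b_def Ns)
    have "\<sigma> (f x) (\<P> (f x) (A x p)) = S (f x) (\<sigma> (f x)) (\<sigma> x) (\<P> (f x) (A x p))"
      using \<sigma>[OF f[OF x]] gf[OF x] by simp
    also have "\<dots> = c x p + d x s - N (f x) (\<sigma> (f x) (b x s))"
      unfolding S_def gf[OF x] using \<alpha>(3)[OF x, of p] p
      by (simp add: blinfun.bilinear_simps fixed_space_def s_def)
    also have "N (f x) (\<sigma> (f x) (b x s)) = \<sigma> (f x) (b x s)" using P\<sigma>[OF f[OF x]] by (simp add: Nv)
    also have "c x p = N (f x) (A x p)" using p by (simp add: c_def)
    also have "d x s = N (f x) (A x s)" using Ns by (simp add: d_def)
    finally have "\<sigma> (f x) (\<P> (f x) (A x p)) + \<sigma> (f x) (\<P> (f x) (A x s)) = N (f x) (A x p) + N (f x) (A x s)"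
      by (simp add: bs)
    then show ?thesis by (simp add: s_def[symmetric] blinfun.bilinear_simps Nv algebra_simps)
  qed
  have inv\<tau>: "A x (q + \<tau> x q) = N (f x) (A x (q + \<tau> x q)) + \<tau> (f x) (N (f x) (A x (q + \<tau> x q)))"
    if x: "x \<in> Z" and q: "\<P> x q = 0" for x q
  proof -
    define t where "t = \<tau> x q"
    have Nq: "N x q = q" using q by (simp add: Nv)
    have Pt: "\<P> x t = t" using P\<tau>[OF x] by (simp add: t_def)
    have "t = \<alpha> x (\<tau> (f x) (d x q) + \<tau> (f x) (c x t) - b x q)"
      using arg_cong[OF \<tau>[OF x], of "\<lambda>l. blinfun_apply l q"] unfolding W_def
      by (simp add: t_def[symmetric] blinfun.bilinear_simps Nq)
    then have "\<P> (f x) (A x t) = \<P> (f x) (\<tau> (f x) (d x q) + \<tau> (f x) (c x t) - b x q)"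
      using \<alpha>(2)[OF x] by metis
    also have "\<dots> = \<tau> (f x) (d x q) + \<tau> (f x) (c x t) - b x q"
      using P\<tau>[OF f[OF x]] PP[OF f[OF x]] by (simp add: blinfun.bilinear_simps b_def)
    also have "d x q = N (f x) (A x q)" by (simp add: d_def Nq)
    also have "c x t = N (f x) (A x t)" by (simp add: c_def Pt)
    also have "b x q = \<P> (f x) (A x q)" by (simp add: b_def Nq)
    finally have "\<P> (f x) (A x t) + \<P> (f x) (A x q) = \<tau> (f x) (N (f x) (A x q)) + \<tau> (f x) (N (f x) (A x t))"
      by (simp add: algebra_simps)
    then show ?thesis by (simp add: t_def[symmetric] blinfun.bilinear_simps Nv algebra_simps)
  qed
  have "\<exists>T :: 'a \<Rightarrow>\<^sub>L 'a. (\<forall>v. blinfun_apply T v + (\<sigma> x + \<tau> x) (blinfun_apply T v) = v) \<and> (\<forall>v. blinfun_apply T (v + (\<sigma> x + \<tau> x) v) = v) \<and> norm T \<le> 2"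
    if x: "x \<in> Z" for x
  proof -
    have "norm (\<sigma> x + \<tau> x) \<le> 1/2" using norm_triangle_ineq[of "\<sigma> x" "\<tau> x"] \<sigma>n[OF x] \<tau>n[OF x] \<rho> by linarith
    then show ?thesis using near_identity_invertible by metis
  qed
  then obtain T where T: "\<And>x v. x \<in> Z \<Longrightarrow> blinfun_apply (T x) v + (\<sigma> x + \<tau> x) (T x v) = v"
    "\<And>x v. x \<in> Z \<Longrightarrow> T x (v + (\<sigma> x + \<tau> x) v) = v" "\<And>x. x \<in> Z \<Longrightarrow> norm (T x) \<le> 2" by metis
  define V where "V x = id_blinfun + (\<sigma> x + \<tau> x)" for x
  have Vv: "V x v = v + (\<sigma> x + \<tau> x) v" for x v by (simp add: V_def blinfun.bilinear_simps)
  have VT: "V x (T x v) = v" and TV: "T x (V x v) = v" if "x \<in> Z" for x v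
    using T(1,2)[OF that] by (simp_all add: Vv)
  have VP: "V x p = p + \<sigma> x p" if "x \<in> Z" "\<P> x p = p" for x p
    using \<tau>N[OF that] by (simp add: Vv blinfun.bilinear_simps)
  have VN: "V x q = q + \<tau> x q" if "x \<in> Z" "\<P> x q = 0" for x q
    using \<sigma>N[OF that] by (simp add: Vv blinfun.bilinear_simps)
  define R where "R x = V x o\<^sub>L \<P> x o\<^sub>L T x" for x
  show ?thesis
  proof
    fix x assume x: "x \<in> Z"
    show "idempotent (R x)" by (simp add: R_def idempotent_def TV[OF x] PP[OF x])
    have "fixed_space (R x) = V x ` fixed_space (\<P> x)"
    proof (intro equalityI subsetI)
      fix v assume "v \<in> fixed_space (R x)"
      then have "v = V x (\<P> x (T x v))" by (simp add: R_def fixed_space_def)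
      then show "v \<in> V x ` fixed_space (\<P> x)" using Pfix[OF x] by blast
    next
      fix v assume "v \<in> V x ` fixed_space (\<P> x)"
      then show "v \<in> fixed_space (R x)" by (auto simp: R_def fixed_space_def TV[OF x])
    qed
    moreover have "inj_on (V x) (fixed_space (\<P> x))" using TV[OF x] by (metis inj_onI)
    moreover have "linear (V x)" by (intro linearI) (simp_all add: blinfun.bilinear_simps)
    ultimately show "fixed_space (R x) \<in> grassmannian k" using grassmannian_inj_image[OF G[OF x]] by metis
    show "norm (R x - \<P> x) \<le> 8 * C * \<rho>"
    proof -
      define e where "e = \<sigma> x + \<tau> x"
      have e: "norm e \<le> 2 * \<rho>" unfolding e_def
        using norm_triangle_ineq[of "\<sigma> x" "\<tau> x"] \<sigma>n[OF x] \<tau>n[OF x] by linarith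
      have "R x v - \<P> x v = (e o\<^sub>L \<P> x o\<^sub>L T x) v - (\<P> x o\<^sub>L e o\<^sub>L T x) v" for v
      proof -
        have "\<P> x v = \<P> x (T x v) + \<P> x (e (T x v))"
          using VT[OF x, of v] unfolding Vv e_def[symmetric] by (metis blinfun.add_right)
        moreover have "R x v = \<P> x (T x v) + e (\<P> x (T x v))" by (simp add: R_def Vv e_def)
        ultimately show ?thesis by simp
      qed
      then have "R x - \<P> x = (e o\<^sub>L \<P> x o\<^sub>L T x) - (\<P> x o\<^sub>L e o\<^sub>L T x)"
        by (intro blinfun_eqI) (simp add: blinfun.bilinear_simps)
      then have "norm (R x - \<P> x) \<le> norm (e o\<^sub>L \<P> x o\<^sub>L T x) + norm (\<P> x o\<^sub>L e o\<^sub>L T x)"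
        by (metis norm_triangle_ineq4)
      also have "\<dots> \<le> 2 * \<rho> * C * 2 + C * (2 * \<rho>) * 2"
        by (intro add_mono comp2 e C(2) T(3) x)
      finally show ?thesis by simp
    qed
    fix v
    define w where "w = T x v"
    define p q where "p = \<P> x w" and "q = N x w"
    have p: "\<P> x p = p" and q: "\<P> x q = 0" using PP[OF x] by (simp_all add: p_def q_def Nv blinfun.bilinear_simps)
    have v: "v = V x p + V x q"
    proof -
      have "v = V x w" by (simp add: w_def VT[OF x])
      also have "w = p + q" by (simp add: p_def q_def Nv)
      finally show ?thesis by (simp add: blinfun.bilinear_simps)
    qed
    define r where "r = \<P> (f x) (A x (p + \<sigma> x p))"
    define r' where "r' = N (f x) (A x (q + \<tau> x q))"
    have fx: "f x \<in> Z" using f x by blast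
    have r: "\<P> (f x) r = r" and r': "\<P> (f x) r' = 0"
      using PP[OF fx] by (simp_all add: r_def r'_def Nv blinfun.bilinear_simps)
    have 1: "A x (V x p) = V (f x) r" using inv\<sigma>[OF x p] VP[OF x p] VP[OF fx r] by (simp add: r_def)
    have 2: "A x (V x q) = V (f x) r'" using inv\<tau>[OF x q] VN[OF x q] VN[OF fx r'] by (simp add: r'_def)
    have "R (f x) (A x v) = V (f x) r"
      by (simp add: v blinfun.bilinear_simps 1 2 R_def TV[OF fx] r r')
    moreover have "R x v = V x p" by (simp add: R_def w_def[symmetric] p_def)
    ultimately show "A x (R x v) = R (f x) (A x v)" by (simp add: 1)
  qed
qed

section \<open>Dominated splittings along an orbit\<close>

text \<open>Besides domination and invariance (as commutation with the projections) this asks for the lower bound \<open>m\<close> on the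
ranges. Domination is stated homogeneously, without division, so that it is meaningful for zero vectors and can be
iterated by multiplying inequalities.\<close>

definition dominated_splitting ::
  "'x set \<Rightarrow> ('x \<Rightarrow> 'x) \<Rightarrow> ('x \<Rightarrow> 'a::real_normed_vector \<Rightarrow>\<^sub>L 'a) \<Rightarrow> ('x \<Rightarrow> 'a \<Rightarrow>\<^sub>L 'a)
    \<Rightarrow> real \<Rightarrow> real \<Rightarrow> bool" where
  "dominated_splitting Z f A R m \<theta> \<longleftrightarrow>
    (\<forall>x\<in>Z. f x \<in> Z \<and> idempotent (R x) \<and> (\<forall>v. A x (R x v) = R (f x) (A x v)) \<and>
      (\<forall>p\<in>fixed_space (R x). m * norm p \<le> norm (A x p)) \<and>
      (\<forall>p\<in>fixed_space (R x). \<forall>q\<in>null_space (R x).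
         norm (A x q) * norm p \<le> \<theta> * norm q * norm (A x p)))"

lemma dominated_splittingD:
  assumes "dominated_splitting Z f A R m \<theta>" "x \<in> Z"
  shows "f x \<in> Z" "idempotent (R x)" "A x (R x v) = R (f x) (A x v)"
    "p \<in> fixed_space (R x) \<Longrightarrow> m * norm p \<le> norm (A x p)"
    "p \<in> fixed_space (R x) \<Longrightarrow> q \<in> null_space (R x) \<Longrightarrow>
       norm (A x q) * norm p \<le> \<theta> * norm q * norm (A x p)"
    "p \<in> fixed_space (R x) \<Longrightarrow> A x p \<in> fixed_space (R (f x))"
    "q \<in> null_space (R x) \<Longrightarrow> A x q \<in> null_space (R (f x))"
    "R x v \<in> fixed_space (R x)" "v - R x v \<in> null_space (R x)"
proof -
  have inv: "A x (R x w) = R (f x) (A x w)" for w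
    using assms unfolding dominated_splitting_def by blast
  show "p \<in> fixed_space (R x) \<Longrightarrow> A x p \<in> fixed_space (R (f x))"
    using inv[of p] by (simp add: fixed_space_def)
  show "q \<in> null_space (R x) \<Longrightarrow> A x q \<in> null_space (R (f x))"
    using inv[of q] by (simp add: null_space_def blinfun.bilinear_simps)
  have idem: "idempotent (R x)" using assms unfolding dominated_splitting_def by blast
  then show "R x v \<in> fixed_space (R x)" "v - R x v \<in> null_space (R x)"
    by (simp_all add: fixed_space_def null_space_def idempotent_def blinfun.bilinear_simps)
qed (use assms in \<open>unfold dominated_splitting_def, blast+\<close>)

lemma cocycle_iter_add:
  "cocycle_iter f H (m + n) x = cocycle_iter f H m ((f ^^ n) x) o\<^sub>L cocycle_iter f H n x"
proof (induction m)
  case (Suc m)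
  have "(f ^^ m) ((f ^^ n) x) = (f ^^ (m + n)) x" by (simp add: funpow_add)
  then show ?case using Suc by (auto intro!: blinfun_eqI)
qed (auto intro!: blinfun_eqI)

lemma cocycle_iter_mult:
  "cocycle_iter (f ^^ N) (cocycle_iter f H N) j x = cocycle_iter f H (N * j) x"
proof (induction j)
  case (Suc j)
  have "cocycle_iter f H (N * Suc j) x = cocycle_iter f H N ((f ^^ (N * j)) x) o\<^sub>L cocycle_iter f H (N * j) x"
    using cocycle_iter_add[of f H N "N * j" x] by simp
  then show ?case using Suc by (simp add: funpow_mult)
qed simp

lemma cocycle_iter_1: "cocycle_iter f H (Suc 0) x = H x"
  by (auto intro!: blinfun_eqI)

lemma cocycle_iter_commute:
  "cocycle_iter f H n (f x) (H x v) = H ((f ^^ n) x) (cocycle_iter f H n x v)"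
proof -
  have "cocycle_iter f H (n + Suc 0) x = cocycle_iter f H (Suc 0 + n) x" by simp
  then have "cocycle_iter f H n (f x) o\<^sub>L H x = H ((f ^^ n) x) o\<^sub>L cocycle_iter f H n x"
    unfolding cocycle_iter_add cocycle_iter_1 by simp
  then show ?thesis by (metis blinfun_apply_blinfun_compose)
qed

lemma funpow_mem: "(\<And>x. x \<in> Z \<Longrightarrow> f x \<in> Z) \<Longrightarrow> x \<in> Z \<Longrightarrow> (f ^^ n) x \<in> Z"
  by (induction n) auto

lemma funpow_image_eq: "f ` Z = Z \<Longrightarrow> (f ^^ n) ` Z = Z"
proof (induction n)
  case (Suc n)
  have "(f ^^ Suc n) ` Z = f ` ((f ^^ n) ` Z)" by (simp add: image_image)
  then show ?case using Suc by simp
qed simp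

lemma dominated_splitting_iter:
  assumes dom: "dominated_splitting Z f A R m \<theta>" and m: "m > 0" and \<theta>: "\<theta> \<ge> 0"
  shows "dominated_splitting Z (f ^^ n) (cocycle_iter f A n) R (m ^ n) (\<theta> ^ n)"
proof (induction n)
  case 0
  then show ?case using dom by (auto simp: dominated_splitting_def mult_ac)
next
  case (Suc n)
  show ?case
    unfolding dominated_splitting_def
  proof (intro ballI conjI allI)
    fix x assume x: "x \<in> Z"
    note D = dominated_splittingD[OF Suc x]
    note D' = dominated_splittingD[OF dom D(1)]
    show "(f ^^ Suc n) x \<in> Z" using D'(1) by simp
    show "idempotent (R x)" by (rule D(2))
    show "cocycle_iter f A (Suc n) x (R x v) = R ((f ^^ Suc n) x) (cocycle_iter f A (Suc n) x v)" for v
      using D(3)[of v] D'(3)[of "cocycle_iter f A n x v"] by simp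
    fix p assume p: "p \<in> fixed_space (R x)"
    define p' where "p' = cocycle_iter f A n x p"
    have p': "p' \<in> fixed_space (R ((f ^^ n) x))" unfolding p'_def by (rule D(6)[OF p])
    have low: "m ^ n * norm p \<le> norm p'" unfolding p'_def by (rule D(4)[OF p])
    have "m * (m ^ n * norm p) \<le> m * norm p'" using low m by (intro mult_left_mono) auto
    also have "\<dots> \<le> norm (A ((f ^^ n) x) p')" by (rule D'(4)[OF p'])
    finally show "m ^ Suc n * norm p \<le> norm (cocycle_iter f A (Suc n) x p)" by (simp add: p'_def mult_ac)
    fix q assume q: "q \<in> null_space (R x)"
    define q' where "q' = cocycle_iter f A n x q"
    have q': "q' \<in> null_space (R ((f ^^ n) x))" unfolding q'_def by (rule D(7)[OF q])
    have 1: "norm q' * norm p \<le> \<theta> ^ n * norm q * norm p'" unfolding q'_def p'_def by (rule D(5)[OF p q])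
    have 2: "norm (A ((f ^^ n) x) q') * norm p' \<le> \<theta> * norm q' * norm (A ((f ^^ n) x) p')"
      by (rule D'(5)[OF p' q'])
    have "norm (A ((f ^^ n) x) q') * norm p \<le> \<theta> ^ Suc n * norm q * norm (A ((f ^^ n) x) p')"
    proof (cases "p' = 0")
      case True
      then have "norm p = 0" using low zero_less_power[OF m, of n] by (simp add: mult_le_0_iff)
      then show ?thesis using \<theta> by simp
    next
      case False
      have "(norm (A ((f ^^ n) x) q') * norm p') * norm p \<le> (\<theta> * norm q' * norm (A ((f ^^ n) x) p')) * norm p"
        using 2 by (rule mult_right_mono) simp
      also have "\<dots> = (\<theta> * norm (A ((f ^^ n) x) p')) * (norm q' * norm p)" by (simp add: mult_ac)
      also have "\<dots> \<le> (\<theta> * norm (A ((f ^^ n) x) p')) * (\<theta> ^ n * norm q * norm p')"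
        using 1 \<theta> by (intro mult_left_mono) auto
      finally have "norm p' * (norm (A ((f ^^ n) x) q') * norm p) \<le>
          norm p' * (\<theta> ^ Suc n * norm q * norm (A ((f ^^ n) x) p'))" by (simp add: mult_ac)
      then show ?thesis using False by simp
    qed
    then show "norm (cocycle_iter f A (Suc n) x q) * norm p
        \<le> \<theta> ^ Suc n * norm q * norm (cocycle_iter f A (Suc n) x p)"
      by (simp add: p'_def q'_def)
  qed
qed

lemma dominated_splitting_onto:
  assumes dom: "dominated_splitting Z f A R m \<theta>" and m: "m > 0" and x: "x \<in> Z"
    and G: "\<And>x. x \<in> Z \<Longrightarrow> fixed_space (R x) \<in> grassmannian k"
  shows "A x ` fixed_space (R x) = fixed_space (R (f x))"
proof -
  note D = dominated_splittingD[OF dom x]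
  have lin: "linear (A x)" by (intro linearI) (simp_all add: blinfun.bilinear_simps)
  have "p = 0" if "p \<in> fixed_space (R x)" "A x p = 0" for p
    using D(4)[OF that(1)] that(2) m by (simp add: mult_le_0_iff)
  then have "inj_on (A x) (fixed_space (R x))"
    using linear_inj_on_iff_eq_0[OF lin subspace_fixed_space] by blast
  then show ?thesis
    using grassmannian_subset_eq[OF grassmannian_inj_image[OF G[OF x] lin] G[OF D(1)]] D(6) by blast
qed


section \<open>Domination under perturbation of a single operator\<close>

text \<open>\<open>\<P>\<close> and \<open>\<P>0\<close> are the unperturbed projections at a point and at its image, and \<open>\<P>'\<close> is the reference
projection at the image of the perturbed point. The conclusions are the four block hypotheses of
\<open>invariant_splitting_near\<close>.\<close>

lemma perturbed_block_estimates:
  fixes A A0 \<P> \<P>0 \<P>' :: "'a::real_normed_vector \<Rightarrow>\<^sub>L 'a"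
  assumes inv: "\<And>v. A0 (\<P> v) = \<P>0 (A0 v)" and idem: "idempotent \<P>"
    and m: "m > 0" and \<theta>: "\<theta> \<ge> 0"
    and lower: "\<And>p. p \<in> fixed_space \<P> \<Longrightarrow> m * norm p \<le> norm (A0 p)"
    and dom: "\<And>p q. p \<in> fixed_space \<P> \<Longrightarrow> q \<in> null_space \<P> \<Longrightarrow>
      norm (A0 q) * norm p \<le> \<theta> * norm q * norm (A0 p)"
    and e: "norm (A - A0) \<le> e" "norm ((\<P>' o\<^sub>L A) - (\<P>0 o\<^sub>L A0)) \<le> e" "e \<le> m / 2"
    and p: "p \<in> fixed_space \<P>" and q: "q \<in> null_space \<P>"
  shows "m / 2 * norm p \<le> norm (\<P>' (A p))" "norm (\<P>' (A q)) \<le> e * norm q"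
    "norm (A p - \<P>' (A p)) \<le> 2 * e * norm p"
    "norm (A q - \<P>' (A q)) * norm p \<le> (2 * \<theta> + 4 * e / m) * norm q * norm (\<P>' (A p))"
proof -
  have e0: "0 \<le> e" using e(1) norm_ge_zero order_trans by blast
  have d1: "norm (A v - A0 v) \<le> e * norm v" for v
    using norm_blinfun[of "A - A0" v] mult_right_mono[OF e(1) norm_ge_zero[of v]]
    by (simp add: blinfun.bilinear_simps)
  have d2: "norm (\<P>' (A v) - \<P>0 (A0 v)) \<le> e * norm v" for v
    using norm_blinfun[of "(\<P>' o\<^sub>L A) - (\<P>0 o\<^sub>L A0)" v] mult_right_mono[OF e(2) norm_ge_zero[of v]]
    by (simp add: blinfun.bilinear_simps)
  have P0p: "\<P>0 (A0 p) = A0 p" using inv[of p] p by (simp add: fixed_space_def)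
  have P0q: "\<P>0 (A0 q) = 0" using inv[of q] q by (simp add: null_space_def blinfun.bilinear_simps)
  have dp: "norm (\<P>' (A p) - A0 p) \<le> e * norm p" using d2[of p] P0p by simp
  have ep: "e * norm p \<le> m / 2 * norm p" using e(3) by (intro mult_right_mono) auto
  have tri: "norm (A0 p) \<le> norm (\<P>' (A p)) + norm (\<P>' (A p) - A0 p)"
    using norm_triangle_ineq4[of "\<P>' (A p)" "\<P>' (A p) - A0 p"] by simp
  show low: "m / 2 * norm p \<le> norm (\<P>' (A p))"
    using lower[OF p] tri dp ep by (simp add: field_simps)
  show "norm (\<P>' (A q)) \<le> e * norm q" using d2[of q] P0q by simp
  have "A p - \<P>' (A p) = (A p - A0 p) - (\<P>' (A p) - A0 p)" by simp
  then have "norm (A p - \<P>' (A p)) \<le> norm (A p - A0 p) + norm (\<P>' (A p) - A0 p)"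
    by (metis norm_triangle_ineq4)
  then show "norm (A p - \<P>' (A p)) \<le> 2 * e * norm p" using d1[of p] dp by linarith
  have eq: "A q - \<P>' (A q) = A0 q + ((A q - A0 q) - (\<P>' (A q) - \<P>0 (A0 q)))" by (simp add: P0q)
  have "norm (A q - \<P>' (A q)) \<le> norm (A0 q) + (norm (A q - A0 q) + norm (\<P>' (A q) - \<P>0 (A0 q)))"
    by (subst eq) (rule order_trans[OF norm_triangle_ineq add_left_mono[OF norm_triangle_ineq4]])
  then have nq: "norm (A q - \<P>' (A q)) \<le> norm (A0 q) + 2 * e * norm q" using d1[of q] d2[of q] by linarith
  have A0p: "norm (A0 p) \<le> 2 * norm (\<P>' (A p))"
    using tri dp ep lower[OF p] by (simp add: field_simps)
  have "norm (A q - \<P>' (A q)) * norm p \<le> (norm (A0 q) + 2 * e * norm q) * norm p"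
    using nq by (intro mult_right_mono) auto
  also have "\<dots> = norm (A0 q) * norm p + 2 * e * norm q * norm p" by (simp add: algebra_simps)
  also have "\<dots> \<le> \<theta> * norm q * (2 * norm (\<P>' (A p))) + 2 * e * norm q * (2 / m * norm (\<P>' (A p)))"
  proof (rule add_mono)
    show "norm (A0 q) * norm p \<le> \<theta> * norm q * (2 * norm (\<P>' (A p)))"
      using dom[OF p q] mult_left_mono[OF A0p, of "\<theta> * norm q"] \<theta> by simp
    show "2 * e * norm q * norm p \<le> 2 * e * norm q * (2 / m * norm (\<P>' (A p)))"
      using low m e0 by (intro mult_left_mono) (auto simp: field_simps)
  qed
  also have "\<dots> = (2 * \<theta> + 4 * e / m) * norm q * norm (\<P>' (A p))"
    by (simp add: algebra_simps)
  finally show "norm (A q - \<P>' (A q)) * norm p \<le> (2 * \<theta> + 4 * e / m) * norm q * norm (\<P>' (A p))" .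
qed

text \<open>Once the new splitting is known to be close to the reference one, domination for the perturbed operator is
compared directly with domination for \<open>A0\<close>: projecting vectors of the new range or null space by \<open>\<P>\<close> or
\<open>1 - \<P>\<close> changes them by at most the fraction \<open>r\<close> of their norm, and \<open>s\<close> collects all resulting errors.\<close>

lemma perturbed_domination:
  fixes A A0 \<P> R :: "'a::real_normed_vector \<Rightarrow>\<^sub>L 'a"
  assumes idem: "idempotent \<P>" 
    and m: "m > 0" and \<theta>: "\<theta> \<ge> 0"
    and lower: "\<And>p. p \<in> fixed_space \<P> \<Longrightarrow> m * norm p \<le> norm (A0 p)"
    and dom: "\<And>p q. p \<in> fixed_space \<P> \<Longrightarrow> q \<in> null_space \<P> \<Longrightarrow>
      norm (A0 q) * norm p \<le> \<theta> * norm q * norm (A0 p)"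
    and close: "norm (A - A0) \<le> e" "norm (R - \<P>) \<le> r" "r \<le> 1/2" "norm A0 * r + e \<le> s" "s \<le> m / 4"
    and p: "p \<in> fixed_space R" and q: "q \<in> null_space R"
  shows "norm (A p - A0 (\<P> p)) \<le> s * norm p" "m / 4 * norm p \<le> norm (A p)"
    "norm (A q) * norm p \<le> (8 * \<theta> + 4 * s / m) * norm q * norm (A p)"
proof -
  have d1: "norm (A v - A0 v) \<le> e * norm v" for v
    using norm_blinfun[of "A - A0" v] mult_right_mono[OF close(1) norm_ge_zero[of v]]
    by (simp add: blinfun.bilinear_simps)
  have dR: "norm (R v - \<P> v) \<le> r * norm v" for v
    using norm_blinfun[of "R - \<P>" v] mult_right_mono[OF close(2) norm_ge_zero[of v]]
    by (simp add: blinfun.bilinear_simps)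
  have r0: "0 \<le> r" and e0: "0 \<le> e" using close(1,2) norm_ge_zero order_trans by blast+
  have s0: "0 \<le> s" using close(4) r0 e0 by (metis add_nonneg_nonneg mult_nonneg_nonneg norm_ge_zero order_trans)
  have shift: "norm (A v - A0 u) \<le> s * norm v" if "norm (v - u) \<le> r * norm v" for u v
  proof -
    have "A v - A0 u = (A v - A0 v) + A0 (v - u)" by (simp add: blinfun.bilinear_simps)
    then have "norm (A v - A0 u) \<le> norm (A v - A0 v) + norm (A0 (v - u))" by (metis norm_triangle_ineq)
    also have "\<dots> \<le> e * norm v + norm A0 * (r * norm v)"
      using d1[of v] norm_blinfun[of A0 "v - u"] mult_left_mono[OF that, of "norm A0"] by simp
    also have "\<dots> = (norm A0 * r + e) * norm v" by (simp add: algebra_simps)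
    also have "\<dots> \<le> s * norm v" using close(4) by (intro mult_right_mono) auto
    finally show ?thesis .
  qed
  define p0 where "p0 = \<P> p"
  define q0 where "q0 = q - \<P> q"
  have p0: "p0 \<in> fixed_space \<P>" and q0: "q0 \<in> null_space \<P>"
    using idem by (simp_all add: p0_def q0_def fixed_space_def null_space_def idempotent_def blinfun.bilinear_simps)
  have pp0: "norm (p - p0) \<le> r * norm p" using dR[of p] p by (simp add: p0_def fixed_space_def)
  have qq0: "norm (q - q0) \<le> r * norm q" using dR[of q] q by (simp add: q0_def null_space_def)
  have rh: "r * norm v \<le> 1/2 * norm v" for v :: 'a using close(3) by (intro mult_right_mono) auto
  have p0n: "norm p \<le> 2 * norm p0"
    using norm_triangle_ineq[of "p - p0" p0] pp0 rh[of p] by simp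
  have q0n: "norm q0 \<le> 2 * norm q"
  proof -
    have "norm q0 \<le> norm q + norm (q - q0)" using norm_triangle_ineq4[of q "q - q0"] by simp
    then show ?thesis using qq0 rh[of q] norm_ge_zero[of q] by linarith
  qed
  show *: "norm (A p - A0 (\<P> p)) \<le> s * norm p" using shift[OF pp0] by (simp add: p0_def)
  have sp: "s * norm p \<le> m / 4 * norm p" using close(5) by (intro mult_right_mono) auto
  have tri: "norm (A0 p0) \<le> norm (A p) + s * norm p"
    using norm_triangle_ineq4[of "A p" "A p - A0 p0"] * by (simp add: p0_def)
  have mp: "m * norm p \<le> 2 * norm (A0 p0)"
    using lower[OF p0] mult_left_mono[OF p0n less_imp_le[OF m]] by linarith
  show low: "m / 4 * norm p \<le> norm (A p)" using tri sp mp by (simp add: field_simps)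
  have A0p0: "norm (A0 p0) \<le> 2 * norm (A p)" using tri sp mp by (simp add: field_simps)
  have Aq: "norm (A q) \<le> norm (A0 q0) + s * norm q"
    using norm_triangle_ineq[of "A q - A0 q0" "A0 q0"] shift[OF qq0] by simp
  have "norm (A q) * norm p \<le> (norm (A0 q0) + s * norm q) * norm p"
    using Aq by (intro mult_right_mono) auto
  also have "\<dots> = norm (A0 q0) * norm p + s * norm q * norm p" by (simp add: algebra_simps)
  also have "\<dots> \<le> 8 * \<theta> * norm q * norm (A p) + s * norm q * (4 / m * norm (A p))"
  proof (rule add_mono)
    have "norm (A0 q0) * norm p \<le> norm (A0 q0) * (2 * norm p0)" using p0n by (intro mult_left_mono) auto
    also have "\<dots> \<le> 2 * (\<theta> * norm q0 * norm (A0 p0))" using dom[OF p0 q0] by simp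
    also have "\<dots> \<le> 2 * (\<theta> * (2 * norm q) * (2 * norm (A p)))"
      using q0n A0p0 \<theta> by (intro mult_left_mono mult_mono) auto
    finally show "norm (A0 q0) * norm p \<le> 8 * \<theta> * norm q * norm (A p)" by simp
    show "s * norm q * norm p \<le> s * norm q * (4 / m * norm (A p))"
      using low m s0 by (intro mult_left_mono) (auto simp: field_simps)
  qed
  also have "\<dots> = (8 * \<theta> + 4 * s / m) * norm q * norm (A p)" by (simp add: algebra_simps)
  finally show "norm (A q) * norm p \<le> (8 * \<theta> + 4 * s / m) * norm q * norm (A p)" .
qed


section \<open>Invariance under the generator, and continuity\<close>

lemma le_geometric_imp_zero:
  fixes a b c :: real
  assumes "\<And>n::nat. a \<le> b * c ^ n" "0 \<le> c" "c < 1"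
  shows "a \<le> 0"
proof -
  have "(\<lambda>n. b * c ^ n) \<longlonglongrightarrow> b * 0" using assms by (intro tendsto_mult tendsto_const LIMSEQ_power_zero) auto
  then have "(\<lambda>n. b * c ^ n) \<longlonglongrightarrow> 0" by simp
  then show ?thesis using assms(1) LIMSEQ_le_const by blast
qed

text \<open>A vector \<open>p\<close> of the range at \<open>x\<close> has preimages \<open>p'\<close> under all iterates, and \<open>G\<close> maps them to preimages of
\<open>G x p\<close>. Transversality bounds the null space component of \<open>G p'\<close> by its range component,
so domination over \<open>j\<close> steps bounds that of \<open>G x p\<close> by \<open>\<theta> ^ j\<close> times its range component.
Hence ranges are mapped into ranges. For \<open>q\<close> in a null space, the range component of \<open>G x q\<close> is \<open>G x p\<close> for
some \<open>p\<close> in the range; its orbit is dominated by the orbit of \<open>q\<close>, although it grows like the orbit of \<open>p\<close>,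
which forces \<open>p = 0\<close>.\<close>

lemma dominated_splitting_generator_invariant:
  fixes G R :: "'x \<Rightarrow> 'a::real_normed_vector \<Rightarrow>\<^sub>L 'a"
  assumes bij: "f ` Z = Z"
    and dom: "dominated_splitting Z (f ^^ N) (cocycle_iter f G N) R m \<theta>"
    and m: "m > 0" and \<theta>: "0 \<le> \<theta>" "\<theta> < 1"
    and G: "\<And>x. x \<in> Z \<Longrightarrow> fixed_space (R x) \<in> grassmannian k"
    and c: "c > 0" and lower: "\<And>x p. x \<in> Z \<Longrightarrow> p \<in> fixed_space (R x) \<Longrightarrow> c * norm p \<le> norm (G x p)"
    and transverse: "\<And>x p. x \<in> Z \<Longrightarrow> p \<in> fixed_space (R x) \<Longrightarrow>
      norm (G x p - R (f x) (G x p)) \<le> norm (R (f x) (G x p))"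
    and B: "\<And>x. x \<in> Z \<Longrightarrow> norm (G x) \<le> B" "\<And>x. x \<in> Z \<Longrightarrow> norm (R x) \<le> C"
    and x: "x \<in> Z"
  shows "G x (R x v) = R (f x) (G x v)"
proof -
  define A where "A j = cocycle_iter (f ^^ N) (cocycle_iter f G N) j" for j
  define F where "F j = (f ^^ N) ^^ j" for j
  have dj: "dominated_splitting Z (F j) (A j) R (m ^ j) (\<theta> ^ j)" for j
    unfolding A_def F_def by (rule dominated_splitting_iter[OF dom m \<theta>(1)])
  have AG: "A j (f y) (G y w) = G (F j y) (A j y w)" for j y w
    unfolding A_def F_def cocycle_iter_mult cocycle_iter_commute by (simp add: funpow_mult)
  have Fonto: "F j ` Z = Z" for j unfolding F_def using bij by (intro funpow_image_eq)
  have fZ: "f y \<in> Z" if "y \<in> Z" for y using bij that by blast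
  have P: "G x p \<in> fixed_space (R (f x))" if x: "x \<in> Z" and p: "p \<in> fixed_space (R x)" for x p
  proof -
    define u where "u = G x p"
    have "norm (u - R (f x) u) \<le> norm (R (f x) u) * \<theta> ^ j" for j
    proof -
      obtain y where y: "y \<in> Z" "F j y = x" using Fonto[of j] x by (metis imageE)
      obtain p' where p': "p' \<in> fixed_space (R y)" "A j y p' = p"
        using dominated_splitting_onto[OF dj[of j] _ y(1) G] m p y(2) by (metis imageE zero_less_power)
      define u' where "u' = G y p'"
      note D = dominated_splittingD[OF dj[of j] fZ[OF y(1)]]
      have Fx: "F j (f y) = f x" using y(2) by (metis F_def funpow_mult funpow_swap1)
      have Au: "A j (f y) u' = u" unfolding u'_def u_def AG using y(2) p'(2) by simp
      have tr: "norm (u' - R (f y) u') \<le> norm (R (f y) u')" unfolding u'_def by (rule transverse[OF y(1) p'(1)])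
      have AR: "A j (f y) (R (f y) u') = R (f x) u" using D(3)[of u'] Au Fx by simp
      have AN: "A j (f y) (u' - R (f y) u') = u - R (f x) u" using AR Au by (simp add: blinfun.bilinear_simps)
      have main: "norm (u - R (f x) u) * norm (R (f y) u') \<le> \<theta> ^ j * norm (u' - R (f y) u') * norm (R (f x) u)"
        using D(5)[OF D(8)[of u'] D(9)[of u']] unfolding AR AN .
      show ?thesis
      proof (cases "R (f y) u' = 0")
        case True
        then have "u' = 0" using tr by simp
        then have "u = 0" using Au by (simp add: blinfun.bilinear_simps)
        then show ?thesis by (simp add: blinfun.bilinear_simps)
      next
        case False
        have "norm (u - R (f x) u) * norm (R (f y) u') \<le> \<theta> ^ j * norm (R (f y) u') * norm (R (f x) u)"
          using main mult_right_mono[OF mult_left_mono[OF tr, of "\<theta> ^ j"], of "norm (R (f x) u)"] \<theta> by simp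
        then have "norm (R (f y) u') * norm (u - R (f x) u) \<le> norm (R (f y) u') * (norm (R (f x) u) * \<theta> ^ j)"
          by (simp add: mult_ac)
        then show ?thesis using False by simp
      qed
    qed
    then have "norm (u - R (f x) u) \<le> 0" using le_geometric_imp_zero \<theta> by blast
    then show ?thesis by (simp add: u_def fixed_space_def)
  qed
  have Q: "R (f x) (G x q) = 0" if q: "q \<in> null_space (R x)" for q
  proof -
    define p' where "p' = R (f x) (G x q)"
    have C0: "0 \<le> C" "0 \<le> B" using B[OF x] norm_ge_zero order_trans by blast+
    have lin: "linear (G x)" by (intro linearI) (simp_all add: blinfun.bilinear_simps)
    have "p = 0" if "p \<in> fixed_space (R x)" "G x p = 0" for p
      using lower[OF x that(1)] that(2) c by (simp add: mult_le_0_iff)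
    then have "inj_on (G x) (fixed_space (R x))"
      using linear_inj_on_iff_eq_0[OF lin subspace_fixed_space] by blast
    then have "G x ` fixed_space (R x) = fixed_space (R (f x))"
      using grassmannian_subset_eq[OF grassmannian_inj_image[OF G[OF x] lin] G[OF fZ[OF x]]] P[OF x] by blast
    moreover have p'fix: "p' \<in> fixed_space (R (f x))"
      unfolding p'_def by (rule dominated_splittingD(8)[OF dom fZ[OF x]])
    ultimately obtain p where p: "p \<in> fixed_space (R x)" "G x p = p'" by (metis imageE)
    show ?thesis
    proof (rule ccontr)
      assume "R (f x) (G x q) \<noteq> 0"
      then have p'0: "p' \<noteq> 0" by (simp add: p'_def)
      have "c * norm p \<le> (C * B * norm q) * \<theta> ^ j" for j
      proof -
        note D = dominated_splittingD[OF dj[of j] x]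
        note D' = dominated_splittingD[OF dj[of j] fZ[OF x]]
        have Fx: "F j x \<in> Z" by (rule D(1))
        define a where "a = norm (A j (f x) p')"
        have "m ^ j * norm p' \<le> a" unfolding a_def by (rule D'(4)[OF p'fix])
        then have a: "a > 0" using p'0 m by (smt (verit) mult_pos_pos zero_less_norm_iff zero_less_power)
        have "A j (f x) p' = R (F j (f x)) (G (F j x) (A j x q))"
          using D'(3)[of "G x q"] AG[of j x q] by (simp add: p'_def)
        then have "a \<le> norm (R (F j (f x))) * norm (G (F j x) (A j x q))" unfolding a_def
          by (metis norm_blinfun)
        also have "\<dots> \<le> C * (B * norm (A j x q))"
          using B(2)[OF D'(1)] order_trans[OF norm_blinfun mult_right_mono[OF B(1)[OF Fx] norm_ge_zero]] C0
          by (intro mult_mono) auto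
        finally have aq: "a \<le> C * B * norm (A j x q)" by simp
        have "c * norm (A j x p) \<le> norm (G (F j x) (A j x p))" by (rule lower[OF Fx D(6)[OF p(1)]])
        also have "\<dots> = a" unfolding a_def AG[symmetric] p(2) by simp
        finally have ap: "c * norm (A j x p) \<le> a" .
        have "a * (c * norm p) \<le> (C * B * norm (A j x q)) * (c * norm p)"
          using aq c by (intro mult_right_mono) auto
        also have "\<dots> = (C * B * c) * (norm (A j x q) * norm p)" by (simp add: mult_ac)
        also have "\<dots> \<le> (C * B * c) * (\<theta> ^ j * norm q * norm (A j x p))"
          using D(5)[OF p(1) q] C0 c by (intro mult_left_mono) auto
        also have "\<dots> = (C * B * \<theta> ^ j * norm q) * (c * norm (A j x p))" by (simp add: mult_ac)
        also have "\<dots> \<le> (C * B * \<theta> ^ j * norm q) * a" using ap C0 \<theta> by (intro mult_left_mono) auto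
        finally have "a * (c * norm p) \<le> a * ((C * B * norm q) * \<theta> ^ j)" by (simp add: mult_ac)
        then show ?thesis using a by simp
      qed
      then have "c * norm p \<le> 0" using le_geometric_imp_zero \<theta> by blast
      then have "p = 0" using c by (simp add: mult_le_0_iff)
      then show False using p(2) p'0 by (simp add: blinfun.bilinear_simps)
    qed
  qed
  note D = dominated_splittingD[OF dom x]
  have "R (f x) (G x v) = R (f x) (G x (R x v)) + R (f x) (G x (v - R x v))"
    by (simp add: blinfun.bilinear_simps)
  then show ?thesis using P[OF x D(8)[of v]] Q[OF D(9)[of v]] by (simp add: fixed_space_def)
qed

lemma continuous_on_funpow:
  fixes f :: "'x::topological_space \<Rightarrow> 'x"
  assumes "continuous_on Z f" "\<And>x. x \<in> Z \<Longrightarrow> f x \<in> Z"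
  shows "continuous_on Z (f ^^ n)"
proof (induction n)
  case (Suc n)
  have "continuous_on Z (f \<circ> (f ^^ n))"
    by (intro continuous_on_compose Suc continuous_on_subset[OF assms(1)]) (auto intro: funpow_mem assms(2))
  then show ?case by simp
qed (simp add: id_def)

lemma continuous_on_cocycle_iter:
  fixes f :: "'x::topological_space \<Rightarrow> 'x" and H :: "'x \<Rightarrow> 'a::real_normed_vector \<Rightarrow>\<^sub>L 'a"
  assumes "continuous_on Z f" "\<And>x. x \<in> Z \<Longrightarrow> f x \<in> Z" "continuous_on Z H"
  shows "continuous_on Z (cocycle_iter f H n)"
proof (induction n)
  case (Suc n)
  have "continuous_on Z (\<lambda>x. H ((f ^^ n) x))"
    by (rule continuous_on_compose2[OF assms(3) continuous_on_funpow[OF assms(1,2)]])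
      (auto intro: funpow_mem assms(2))
  then show ?case
    using bounded_bilinear.continuous_on[OF bounded_bilinear_blinfun_compose _ Suc] by simp
qed simp

text \<open>Domination upgrades rough continuity, with jumps of at most \<open>1/2\<close>, to continuity. For the ranges
compare the orbits of length \<open>n\<close> that end at \<open>x\<close> and \<open>x0\<close>: by the rough continuity the ranges at their starting
points are transverse to the null spaces, and domination contracts the discrepancy by \<open>\<theta> ^ n\<close>. For the null
spaces compare orbits that start at \<open>x\<close> and \<open>x0\<close> in the same way. With \<open>n\<close> fixed, the two pieces of orbit converge to each other as
\<open>x\<close> tends to \<open>x0\<close>.\<close>

lemma dominated_splitting_continuous:
  fixes R :: "'x::metric_space \<Rightarrow> 'a::real_normed_vector \<Rightarrow>\<^sub>L 'a"
  assumes f: "continuous_on Z f" and g: "continuous_on Z g" "\<And>x. x \<in> Z \<Longrightarrow> g x \<in> Z" "\<And>x. x \<in> Z \<Longrightarrow> f (g x) = x"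
    and A: "continuous_on Z A"
    and dom: "dominated_splitting Z f A R m \<theta>" and m: "m > 0" and \<theta>: "0 \<le> \<theta>" "\<theta> < 1"
    and G: "\<And>x. x \<in> Z \<Longrightarrow> fixed_space (R x) \<in> grassmannian k"
    and C: "\<And>x. x \<in> Z \<Longrightarrow> norm (R x) \<le> C"
    and \<delta>: "\<delta> > 0" "\<And>x y. x \<in> Z \<Longrightarrow> y \<in> Z \<Longrightarrow> dist x y < \<delta> \<Longrightarrow> norm (R x - R y) \<le> 1/2"
  shows "continuous_on Z R"
  unfolding continuous_on_def
proof (intro ballI tendstoI)
  fix x0 and e :: real assume x0: "x0 \<in> Z" and e: "e > 0"
  have fZ: "f x \<in> Z" if "x \<in> Z" for x using dominated_splittingD(1)[OF dom that] .
  have C0: "0 \<le> C" using C[OF x0] norm_ge_zero order_trans by blast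
  define E where "E = 1 + 2 * norm (R x0)"
  define a where "a = min (1/4) (e / (4 * E))"
  have E: "E > 0" by (simp add: E_def add_pos_nonneg)
  have a: "0 < a" "a \<le> 1/4" "a * (4 * E) \<le> e" using e E by (auto simp: a_def min_def field_simps)
  \<comment> \<open>\<open>n\<close> controls the domination error and \<open>t\<close>, relative to the lower bound \<open>m ^ n\<close>, the error of replacing one piece of orbit by the other\<close>
  define t where "t = min 1 (a / (2 * (1 + 2 * C)))"
  have t: "0 < t" "t \<le> 1" using a C0 by (auto simp: t_def)
  have tC: "(1 + 2 * C) * t \<le> a / 2" 
  proof -
    have "(1 + 2 * C) * t \<le> (1 + 2 * C) * (a / (2 * (1 + 2 * C)))" using C0 by (intro mult_left_mono) (auto simp: t_def)
    also have "\<dots> = a / 2" using C0 by (simp add: field_simps)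
    finally show ?thesis .
  qed
  obtain n where n: "\<theta> ^ n < a / (4 * (1 + C))"
    using real_arch_pow_inv[of "a / (4 * (1 + C))" \<theta>] a C0 \<theta> by auto
  have nC: "\<theta> ^ n * (2 * (1 + C)) \<le> a / 2" using n C0 by (simp add: field_simps)
  have \<theta>n: "0 \<le> \<theta> ^ n" "\<theta> ^ n \<le> 1" using \<theta> by (auto intro: power_le_one)
  define An where "An = cocycle_iter f A n"
  define fn where "fn = f ^^ n"
  define gn where "gn = g ^^ n"
  have cA: "continuous_on Z An" unfolding An_def by (rule continuous_on_cocycle_iter[OF f fZ A])
  have cf: "continuous_on Z fn" unfolding fn_def by (rule continuous_on_funpow[OF f fZ])
  have cg: "continuous_on Z gn" unfolding gn_def by (rule continuous_on_funpow[OF g(1,2)])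
  have gZ: "gn x \<in> Z" if "x \<in> Z" for x unfolding gn_def using funpow_mem g(2) that by metis
  have fg: "fn (gn x) = x" if "x \<in> Z" for x
  proof -
    have "(f ^^ i) ((g ^^ i) x) = x" for i
    proof (induction i)
      case (Suc i)
      have "(f ^^ Suc i) ((g ^^ Suc i) x) = (f ^^ i) (f (g ((g ^^ i) x)))" by (simp add: funpow_swap1)
      then show ?case using Suc g(3)[OF funpow_mem[of Z g, OF g(2) that]] by simp
    qed simp
    then show ?thesis by (simp add: fn_def gn_def)
  qed
  have dn: "dominated_splitting Z fn An R (m ^ n) (\<theta> ^ n)"
    unfolding fn_def An_def by (rule dominated_splitting_iter[OF dom m \<theta>(1)])
  define \<mu> where "\<mu> = m ^ n"
  have \<mu>: "\<mu> > 0" using m by (simp add: \<mu>_def)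
  have cAg: "continuous_on Z (\<lambda>x. An (gn x))"
    by (rule continuous_on_compose2[OF cA cg]) (use gZ in auto)
  have ev: "\<forall>\<^sub>F x in at x0 within Z. dist (An (gn x)) (An (gn x0)) < t * \<mu>"
    "\<forall>\<^sub>F x in at x0 within Z. dist (An x) (An x0) < t * \<mu>"
    "\<forall>\<^sub>F x in at x0 within Z. dist (gn x) (gn x0) < \<delta>"
    "\<forall>\<^sub>F x in at x0 within Z. dist (fn x) (fn x0) < \<delta>"
    using cAg cA cg cf x0 \<mu> t \<delta>(1) by (auto simp: continuous_on_def intro: tendstoD)
  have "\<forall>\<^sub>F x in at x0 within Z. x \<in> Z" by (simp add: eventually_at_filter)
  with ev show "\<forall>\<^sub>F x in at x0 within Z. dist (R x) (R x0) < e"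
  proof eventually_elim
    case (elim x)
    then have x: "x \<in> Z" by simp
    have "norm (R x - R x0) \<le> 2 * a * (1 + 2 * norm (R x0))"
    proof (rule projection_difference)
      show "idempotent (R x)" by (rule dominated_splittingD(2)[OF dom x])
      show "0 \<le> a" "a \<le> 1/4" using a by auto
    next
      fix p assume p: "p \<in> fixed_space (R x)"
      define y y0 where "y = gn x" and "y0 = gn x0"
      have y: "y \<in> Z" "y0 \<in> Z" using gZ x x0 by (auto simp: y_def y0_def)
      note Dy = dominated_splittingD[OF dn y(1)] and D0 = dominated_splittingD[OF dn y(2)]
      have fy: "fn y = x" "fn y0 = x0" using fg x x0 by (auto simp: y_def y0_def)
      obtain u where u: "u \<in> fixed_space (R y)" "An y u = p"
        using dominated_splitting_onto[OF dn _ y(1) G] m p fy(1) by (metis imageE zero_less_power)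
      define u0 where "u0 = R y0 u"
      define w where "w = u - u0"
      have wu: "norm w \<le> 1/2 * norm u"
      proof -
        have "w = (R y - R y0) u" using u by (simp add: w_def u0_def fixed_space_def blinfun.bilinear_simps)
        then have "norm w \<le> norm (R y - R y0) * norm u" by (simp add: norm_blinfun)
        also have "\<dots> \<le> 1/2 * norm u"
          using \<delta>(2)[OF y] elim(3) by (intro mult_right_mono) (auto simp: y_def y0_def)
        finally show ?thesis .
      qed
      have wu0: "norm w \<le> norm u0" using wu norm_triangle_ineq[of u0 w] by (simp add: w_def)
      have up: "\<mu> * norm u \<le> norm p" using Dy(4)[OF u(1)] u(2) by (simp add: \<mu>_def)
      define z where "z = An y u - An y0 u"
      have "norm z \<le> norm (An y - An y0) * norm u"
        unfolding z_def by (metis blinfun.diff_left norm_blinfun)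
      also have "\<dots> \<le> (t * \<mu>) * norm u"
        using elim(1) by (intro mult_right_mono) (auto simp: dist_norm y_def y0_def)
      also have "\<dots> \<le> t * norm p" using mult_left_mono[OF up, of t] t by (simp add: mult_ac)
      finally have z: "norm z \<le> t * norm p" .
      have R0: "R x0 (An y0 u) = An y0 u0" using D0(3)[of u] fy by (simp add: u0_def)
      have "p - R x0 p = (z - R x0 z) + An y0 w"
        using R0 u(2) by (simp add: z_def w_def blinfun.bilinear_simps)
      then have np: "norm (p - R x0 p) \<le> norm (z - R x0 z) + norm (An y0 w)" by (metis norm_triangle_ineq)
      have Rx0: "norm (R x0 v) \<le> C * norm v" for v
        using norm_blinfun[of "R x0" v] mult_right_mono[OF C[OF x0] norm_ge_zero[of v]] by linarith
      have n1: "norm (z - R x0 z) \<le> (1 + C) * (t * norm p)"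
      proof -
        have "norm (z - R x0 z) \<le> norm z + C * norm z" using norm_triangle_ineq4[of z "R x0 z"] Rx0[of z] by linarith
        also have "\<dots> = (1 + C) * norm z" by (simp add: algebra_simps)
        finally show ?thesis using mult_left_mono[OF z, of "1 + C"] C0 by linarith
      qed
      have A0u: "norm (An y0 u) \<le> 2 * norm p"
      proof -
        have "norm (An y0 u) \<le> norm p + norm z" using norm_triangle_ineq4[of p z] u(2) by (simp add: z_def)
        also have "\<dots> \<le> norm p + 1 * norm p" using z t mult_right_mono[OF t(2) norm_ge_zero[of p]] by linarith
        finally show ?thesis by simp
      qed
      have n2: "norm (An y0 w) \<le> \<theta> ^ n * (C * (2 * norm p))"
      proof (cases "u0 = 0")
        case True
        then have "w = 0" using wu0 by simp
        then show ?thesis using \<theta>n C0 by (simp add: blinfun.bilinear_simps)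
      next
        case False
        have "norm (An y0 w) * norm u0 \<le> \<theta> ^ n * norm w * norm (An y0 u0)"
          unfolding w_def u0_def by (rule D0(5)[OF D0(8) D0(9)])
        also have "\<dots> \<le> \<theta> ^ n * norm u0 * norm (An y0 u0)"
          using wu0 \<theta>n by (intro mult_right_mono mult_left_mono) auto
        finally have "norm u0 * norm (An y0 w) \<le> norm u0 * (\<theta> ^ n * norm (An y0 u0))" by (simp add: mult_ac)
        then have "norm (An y0 w) \<le> \<theta> ^ n * norm (An y0 u0)" using False by simp
        also have "\<dots> \<le> \<theta> ^ n * (C * (2 * norm p))"
          unfolding R0[symmetric] using \<theta>n Rx0[of "An y0 u"] mult_left_mono[OF A0u C0]
          by (intro mult_left_mono) linarith+
        finally show ?thesis .
      qed
      have "norm (p - R x0 p) \<le> ((1 + C) * t + \<theta> ^ n * (2 * C)) * norm p"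
        using np n1 n2 by (simp add: algebra_simps)
      also have "\<dots> \<le> a * norm p"
      proof (rule mult_right_mono)
        have "(1 + C) * t \<le> (1 + 2 * C) * t" using C0 t by (intro mult_right_mono) auto
        moreover have "\<theta> ^ n * (2 * C) \<le> \<theta> ^ n * (2 * (1 + C))" using \<theta>n by (intro mult_left_mono) auto
        ultimately show "(1 + C) * t + \<theta> ^ n * (2 * C) \<le> a" using tC nC by linarith
      qed simp
      finally show "norm (p - R x0 p) \<le> a * norm p" .
    next
      fix q assume q: "q \<in> null_space (R x)"
      note Dx = dominated_splittingD[OF dn x] and D0 = dominated_splittingD[OF dn x0]
      define p where "p = R x0 q"
      define q' where "q' = q - p"
      define z z0 where "z = fn x" and "z0 = fn x0"
      have zZ: "z \<in> Z" "z0 \<in> Z" using Dx(1) D0(1) by (auto simp: z_def z0_def)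
      define v where "v = An x q"
      define w where "w = An x q - An x0 q"
      have Rn: "norm (R y v) \<le> C * norm v" if "y \<in> Z" for y v
        using norm_blinfun[of "R y" v] mult_right_mono[OF C[OF that] norm_ge_zero[of v]] by linarith
      have "norm w \<le> norm (An x - An x0) * norm q"
        unfolding w_def by (metis blinfun.diff_left norm_blinfun)
      also have "\<dots> \<le> (t * \<mu>) * norm q"
        using elim(2) by (intro mult_right_mono) (auto simp: dist_norm)
      finally have w: "norm w \<le> t * \<mu> * norm q" .
      have "R z v = 0" using Dx(7)[OF q] by (simp add: v_def z_def null_space_def)
      then have "R z0 v = (R z0 - R z) v" by (simp add: blinfun.bilinear_simps)
      then have "norm (R z0 v) \<le> norm (R z0 - R z) * norm v" by (simp add: norm_blinfun)
      also have "\<dots> \<le> 1/2 * norm v"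
        using \<delta>(2)[OF zZ(2,1)] elim(4) by (intro mult_right_mono) (auto simp: z_def z0_def dist_commute)
      finally have v1: "norm (R z0 v) \<le> 1/2 * norm v" .
      have v2: "norm (R z0 v) \<le> norm (v - R z0 v)"
        using v1 norm_triangle_ineq[of "R z0 v" "v - R z0 v"] by simp
      have Ap: "An x0 p = R z0 v - R z0 w" using D0(3)[of q] by (simp add: p_def v_def w_def z0_def blinfun.bilinear_simps)
      have Aq': "An x0 q' = (v - R z0 v) - (w - R z0 w)"
        using Ap by (simp add: q'_def v_def w_def blinfun.bilinear_simps)
      have "norm (An x0 p) \<le> norm (R z0 v) + norm (R z0 w)" unfolding Ap by (rule norm_triangle_ineq4)
      also have "\<dots> \<le> norm (v - R z0 v) + norm (R z0 w)" using v2 by simp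
      also have "v - R z0 v = An x0 q' + (w - R z0 w)" unfolding Aq' by simp
      also have "norm (An x0 q' + (w - R z0 w)) \<le> norm (An x0 q') + (norm w + norm (R z0 w))"
        using norm_triangle_ineq[of "An x0 q'" "w - R z0 w"] norm_triangle_ineq4[of w "R z0 w"] by linarith
      finally have "norm (An x0 p) \<le> norm (An x0 q') + norm w + 2 * norm (R z0 w)" by linarith
      also have "\<dots> \<le> norm (An x0 q') + (1 + 2 * C) * norm w" using Rn[OF zZ(2), of w] by (simp add: algebra_simps)
      also have "\<dots> \<le> norm (An x0 q') + (1 + 2 * C) * (t * \<mu> * norm q)"
        using w C0 by (intro add_left_mono mult_left_mono) auto
      also have "\<dots> = norm (An x0 q') + ((1 + 2 * C) * t) * (\<mu> * norm q)" by simp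
      also have "\<dots> \<le> norm (An x0 q') + a / 2 * (\<mu> * norm q)"
        using tC \<mu> by (intro add_left_mono mult_right_mono) auto
      finally have main: "norm (An x0 p) \<le> norm (An x0 q') + a / 2 * (\<mu> * norm q)" .
      have pfix: "p \<in> fixed_space (R x0)" unfolding p_def by (rule D0(8))
      have q'null: "q' \<in> null_space (R x0)" unfolding q'_def p_def by (rule D0(9))
      have low: "\<mu> * norm p \<le> norm (An x0 p)" using D0(4)[OF pfix] by (simp add: \<mu>_def)
      have "norm q' \<le> (1 + C) * norm q"
        using norm_triangle_ineq4[of q p] Rn[OF x0, of q] by (simp add: q'_def p_def algebra_simps)
      then have nq': "\<theta> ^ n * norm q' \<le> \<theta> ^ n * ((1 + C) * norm q)" using \<theta>n by (intro mult_left_mono)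
      show "norm (R x0 q) \<le> a * norm q"
      proof (rule ccontr)
        assume "\<not> ?thesis"
        \<comment> \<open>a range component larger than \<open>a * norm q\<close> would have to dominate the image of \<open>q'\<close>, but then \<open>main\<close> bounds it from above\<close>
        then have big: "a * norm q < norm p" by (simp add: p_def)
        then have p0: "norm p > 0" using a by (smt (verit) mult_nonneg_nonneg norm_ge_zero)
        have "\<theta> ^ n * ((1 + C) * norm q) \<le> a / 4 * norm q"
          using mult_right_mono[OF nC, of "norm q / 2"] by (simp add: algebra_simps)
        also have "\<dots> < 1/4 * norm p" using big by simp
        finally have q4: "\<theta> ^ n * norm q' \<le> 1/4 * norm p" using nq' by linarith
        have "norm (An x0 q') * norm p \<le> \<theta> ^ n * norm q' * norm (An x0 p)" by (rule D0(5)[OF pfix q'null])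
        also have "\<dots> \<le> 1/4 * norm p * norm (An x0 p)" using q4 by (intro mult_right_mono) auto
        finally have "norm p * norm (An x0 q') \<le> norm p * (1/4 * norm (An x0 p))" by (simp add: mult_ac)
        then have "norm (An x0 q') \<le> 1/4 * norm (An x0 p)" using p0 by simp
        then have "3/4 * (\<mu> * norm p) \<le> a / 2 * (\<mu> * norm q)" using main low by linarith
        then have "\<mu> * (3/4 * norm p) \<le> \<mu> * (1/2 * (a * norm q))" by (simp add: mult_ac)
        then have "3/4 * norm p \<le> 1/2 * (a * norm q)" using \<mu> by simp
        then show False using big p0 by linarith
      qed
    qed
    also have "\<dots> = a * (4 * E) / 2" by (simp add: E_def)
    also have "\<dots> < e" using a e by linarith
    finally show ?case by (simp add: dist_norm)
  qed
qed

section \<open>Orbits near a compact invariant set\<close>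

text \<open>In an infinite-dimensional space neighbourhoods of \<open>K\<close> are not compact, but comparisons with points of \<open>K\<close>
are still uniform; this is what makes the constants depend on the unperturbed data alone.\<close>

lemma uniformly_continuous_near_compact:
  fixes \<phi> :: "'x::metric_space \<Rightarrow> 'y::metric_space"
  assumes K: "compact K" "K \<subseteq> U" and \<phi>: "continuous_on U \<phi>" and e: "e > 0"
  obtains d where "d > 0" "\<And>x y. x \<in> K \<Longrightarrow> y \<in> U \<Longrightarrow> dist x y < d \<Longrightarrow> dist (\<phi> x) (\<phi> y) < e"
proof -
  have "\<forall>z\<in>K. \<exists>d>0. \<forall>y\<in>U. dist y z < d \<longrightarrow> dist (\<phi> y) (\<phi> z) < e / 2"
  proof
    fix z assume "z \<in> K"
    then have "z \<in> U" using K by blast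
    then show "\<exists>d>0. \<forall>y\<in>U. dist y z < d \<longrightarrow> dist (\<phi> y) (\<phi> z) < e / 2"
      using \<phi> e unfolding continuous_on_iff by (meson half_gt_zero)
  qed
  then obtain d where d: "\<And>z. z \<in> K \<Longrightarrow> d z > 0"
    "\<And>z y. z \<in> K \<Longrightarrow> y \<in> U \<Longrightarrow> dist y z < d z \<Longrightarrow> dist (\<phi> y) (\<phi> z) < e / 2" by metis
  define \<G> where "\<G> = (\<lambda>z. ball z (d z)) ` K"
  have "K \<subseteq> \<Union>\<G>" using d(1) unfolding \<G>_def by auto
  moreover have "open B" if "B \<in> \<G>" for B using that by (auto simp: \<G>_def)
  ultimately obtain r where r: "0 < r" "\<And>x. x \<in> K \<Longrightarrow> \<exists>B\<in>\<G>. ball x r \<subseteq> B"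
    using Heine_Borel_lemma[OF K(1)] by metis
  have "dist (\<phi> x) (\<phi> y) < e" if x: "x \<in> K" and y: "y \<in> U" "dist x y < r" for x y
  proof -
    obtain z where z: "z \<in> K" "ball x r \<subseteq> ball z (d z)" using r(2)[OF x] by (auto simp: \<G>_def)
    have "dist x z < d z" "dist y z < d z" using z(2) y(2) r(1) by (auto simp: subset_iff dist_commute)
    then have "dist (\<phi> x) (\<phi> z) < e / 2" "dist (\<phi> y) (\<phi> z) < e / 2" using d(2)[OF z(1)] x y K by auto
    then show ?thesis by (metis dist_triangle_half_l dist_commute)
  qed
  with r(1) that show ?thesis by blast
qed

definition perturbation ::
  "'a::real_normed_vector set \<Rightarrow> ('a \<Rightarrow> 'a) \<Rightarrow> ('a \<Rightarrow> 'a \<Rightarrow>\<^sub>L 'a) \<Rightarrow> real \<Rightarrow>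
    'a set \<Rightarrow> ('a \<Rightarrow> 'a) \<Rightarrow> ('a \<Rightarrow> 'a) \<Rightarrow> ('a \<Rightarrow> 'a \<Rightarrow>\<^sub>L 'a) \<Rightarrow> bool" where
  "perturbation K F T d Kt h Ft G \<longleftrightarrow>
     Kt \<subseteq> unit_nbhd K \<and> h ` Kt \<subseteq> K \<and> Ft ` Kt = Kt \<and>
     (\<forall>x\<in>Kt. norm (h x - x) \<le> d) \<and> (\<forall>x\<in>unit_nbhd K. norm (Ft x - F x) \<le> d) \<and>
     (\<forall>x\<in>unit_nbhd K. norm (T x - G x) \<le> d)"

lemma perturbation_mono: "perturbation K F T d Kt h Ft G \<Longrightarrow> d \<le> d' \<Longrightarrow> perturbation K F T d' Kt h Ft G"
  unfolding perturbation_def by (meson order_trans)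

lemma subset_unit_nbhd: "K \<subseteq> unit_nbhd K"
  by (auto simp: unit_nbhd_def)

lemma compact_operator_bound:
  fixes T :: "'x::metric_space \<Rightarrow> 'a::real_normed_vector \<Rightarrow>\<^sub>L 'b::real_normed_vector"
  assumes "compact K" "continuous_on K T"
  obtains B where "B \<ge> 1" "\<And>x. x \<in> K \<Longrightarrow> norm (T x) \<le> B"
proof -
  have "bounded (T ` K)" using assms by (intro compact_imp_bounded compact_continuous_image)
  then obtain B where "\<forall>x\<in>T ` K. norm x \<le> B" by (auto simp: bounded_iff)
  then show ?thesis by (intro that[of "max 1 B"]) auto
qed

text \<open>Under \<open>h\<close> the perturbed orbit is a pseudo-orbit of \<open>F\<close> in \<open>K\<close>, and for a fixed number of steps it stays
close to the true orbit.\<close>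

lemma perturbed_iterates_close:
  fixes K :: "'a::real_normed_vector set"
  assumes K: "compact K" and F: "continuous_on (unit_nbhd K) F" "F ` K \<subseteq> K"
    and T: "continuous_on (unit_nbhd K) T" and e: "e > 0"
  shows "\<exists>d>0. \<forall>Kt h Ft G. perturbation K F T d Kt h Ft G \<longrightarrow> (\<forall>x\<in>Kt.
    dist (h ((Ft ^^ n) x)) ((F ^^ n) (h x)) < e \<and>
    norm (cocycle_iter Ft G n x - cocycle_iter F T n (h x)) < e)"
  using e
proof (induction n arbitrary: e)
  case 0
  then show ?case by (intro exI[of _ 1]) auto
next
  case (Suc n)
  let ?U = "unit_nbhd K"
  have KU: "K \<subseteq> ?U" by (rule subset_unit_nbhd)
  have FK: "F y \<in> K" if "y \<in> K" for y using F(2) that by blast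
  obtain B where B: "B \<ge> 1" "\<And>y. y \<in> K \<Longrightarrow> norm (T y) \<le> B"
    using compact_operator_bound[OF K continuous_on_subset[OF T KU]] by blast
  obtain Bn where Bn: "Bn \<ge> 1" "\<And>y. y \<in> K \<Longrightarrow> norm (cocycle_iter F T n y) \<le> Bn"
    using compact_operator_bound[OF K continuous_on_cocycle_iter[OF continuous_on_subset[OF F(1) KU] FK
          continuous_on_subset[OF T KU]]] by blast
  define s where "s = e / (6 * (Bn + 1))"
  have s: "s > 0" "s * (6 * (Bn + 1)) = e" using Suc.prems Bn(1) by (auto simp: s_def)
  obtain d1 where d1: "d1 > 0" "\<And>x y. x \<in> K \<Longrightarrow> y \<in> ?U \<Longrightarrow> dist x y < d1 \<Longrightarrow> dist (F x) (F y) < e / 4"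
    using uniformly_continuous_near_compact[OF K KU F(1), of "e/4"] Suc.prems by auto
  obtain d2 where d2: "d2 > 0" "\<And>x y. x \<in> K \<Longrightarrow> y \<in> ?U \<Longrightarrow> dist x y < d2 \<Longrightarrow> dist (T x) (T y) < s"
    using uniformly_continuous_near_compact[OF K KU T s(1)] by auto
  define e' where "e' = Min {1, d1, d2, e / (2 * B)}"
  have e': "e' > 0" "e' \<le> 1" "e' \<le> d1" "e' \<le> d2" "e' \<le> e / (2 * B)"
    using d1(1) d2(1) Suc.prems B(1) by (auto simp: e'_def)
  from Suc.IH[OF e'(1)] obtain d0 where d0: "d0 > 0"
    "\<And>Kt h Ft G x. perturbation K F T d0 Kt h Ft G \<Longrightarrow> x \<in> Kt \<Longrightarrow>
      dist (h ((Ft ^^ n) x)) ((F ^^ n) (h x)) < e' \<and>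
      norm (cocycle_iter Ft G n x - cocycle_iter F T n (h x)) < e'" by blast
  define d where "d = Min {d0, d1 / 2, d2 / 2, e / 8, s}"
  have d: "d > 0" "d \<le> d0" "d < d1" "d < d2" "d \<le> e / 8" "d \<le> s"
    using d0(1) d1(1) d2(1) s Suc.prems by (auto simp: d_def)
  show ?case
  proof (intro exI[of _ d] conjI allI impI ballI d(1))
    fix Kt h Ft G x assume per: "perturbation K F T d Kt h Ft G" and x: "x \<in> Kt"
    have IH: "dist (h ((Ft ^^ n) x)) ((F ^^ n) (h x)) < e'"
      "norm (cocycle_iter Ft G n x - cocycle_iter F T n (h x)) < e'"
      using d0(2)[OF perturbation_mono[OF per d(2)] x] by auto
    have Ktm: "Ft y \<in> Kt" if "y \<in> Kt" for y using per that by (auto simp: perturbation_def)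
    have hK: "h y \<in> K" and yU: "y \<in> ?U" and hy: "dist (h y) y \<le> d"
      and Fty: "dist (Ft y) (F y) \<le> d" and Gy: "norm (G y - T y) \<le> d" if "y \<in> Kt" for y
      using per that by (auto simp: perturbation_def dist_norm norm_minus_commute)
    define y where "y = (Ft ^^ n) x"
    define z where "z = (F ^^ n) (h x)"
    have y: "y \<in> Kt" unfolding y_def using funpow_mem[of Kt Ft, OF Ktm x] .
    have z: "z \<in> K" unfolding z_def using funpow_mem[of K F, OF FK hK[OF x]] .
    have hyz: "dist (h y) z < e'" using IH(1) by (simp add: y_def z_def)
    have hyd: "dist (h y) y < d1" "dist (h y) y < d2" using hy[OF y] d by linarith+
    have hzd: "dist (h y) z < d1" "dist (h y) z < d2" using hyz e' by linarith+
    have "dist (h (Ft y)) (F z) \<le> dist (h (Ft y)) (Ft y) + dist (Ft y) (F y) + dist (F (h y)) (F y) + dist (F (h y)) (F z)"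
      by (smt (verit, best) dist_commute dist_triangle)
    also have "\<dots> < d + d + e/4 + e/4"
      using hy[OF Ktm[OF y]] Fty[OF y] d1(2)[OF hK[OF y] yU[OF y] hyd(1)]
        d1(2)[OF hK[OF y] subsetD[OF KU z] hzd(1)] by linarith
    also have "\<dots> \<le> e" using d Suc.prems by linarith
    finally show "dist (h ((Ft ^^ Suc n) x)) ((F ^^ Suc n) (h x)) < e" by (simp add: y_def z_def)
    define a where "a = cocycle_iter Ft G n x"
    define b where "b = cocycle_iter F T n (h x)"
    have ab: "norm (a - b) < e'" using IH(2) by (simp add: a_def b_def)
    have nb: "norm b \<le> Bn" unfolding b_def by (rule Bn(2)[OF hK[OF x]])
    have na: "norm a \<le> Bn + 1" using norm_triangle_ineq[of "a - b" b] ab nb e'(2) by simp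
    have eq: "G y - T z = (G y - T y) - (T (h y) - T y) + (T (h y) - T z)" by simp
    have "norm (G y - T z) \<le> norm (G y - T y) + norm (T (h y) - T y) + norm (T (h y) - T z)"
      by (subst eq) (rule order_trans[OF norm_triangle_ineq add_right_mono[OF norm_triangle_ineq4]])
    also have "\<dots> < 3 * s"
      using Gy[OF y] d(6) d2(2)[OF hK[OF y] yU[OF y] hyd(2)] d2(2)[OF hK[OF y] subsetD[OF KU z] hzd(2)]
      by (simp add: dist_norm)
    finally have GT: "norm (G y - T z) < 3 * s" .
    have "(G y o\<^sub>L a) - (T z o\<^sub>L b) = ((G y - T z) o\<^sub>L a) + (T z o\<^sub>L (a - b))"
      by (auto intro!: blinfun_eqI simp: blinfun.bilinear_simps)
    then have "norm ((G y o\<^sub>L a) - (T z o\<^sub>L b)) \<le> norm ((G y - T z) o\<^sub>L a) + norm (T z o\<^sub>L (a - b))"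
      by (metis norm_triangle_ineq)
    also have "\<dots> \<le> norm (G y - T z) * norm a + norm (T z) * norm (a - b)"
      by (intro add_mono norm_blinfun_compose)
    also have "\<dots> \<le> 3 * s * (Bn + 1) + B * norm (a - b)"
      using GT na B(1) B(2)[OF z] s by (intro add_mono mult_mono) auto
    also have "\<dots> < 3 * s * (Bn + 1) + B * e'" using ab B(1) by simp
    also have "\<dots> \<le> 3 * s * (Bn + 1) + B * (e / (2 * B))" using e'(5) B(1) by (intro add_left_mono mult_left_mono) auto
    also have "\<dots> = e" using s(2) B(1) by (simp add: field_simps)
    finally show "norm (cocycle_iter Ft G (Suc n) x - cocycle_iter F T (Suc n) (h x)) < e"
      by (simp add: a_def b_def y_def z_def)
  qed
qed

text \<open>A lower bound at \<open>y\<close> persists, with a quarter of the constant, at all points near \<open>y\<close>, because \<open>T\<close> composed with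
the projection is continuous; finitely many such neighbourhoods cover \<open>K\<close>.\<close>

lemma uniform_lower_bound:
  fixes T R :: "'x::metric_space \<Rightarrow> 'a::real_normed_vector \<Rightarrow>\<^sub>L 'a"
  assumes K: "compact K" "K \<noteq> {}" and T: "continuous_on K T" and R: "continuous_on K R"
    and idem: "\<And>x. x \<in> K \<Longrightarrow> idempotent (R x)"
    and G: "\<And>x. x \<in> K \<Longrightarrow> fixed_space (R x) \<in> grassmannian k"
    and inj: "\<And>x p. x \<in> K \<Longrightarrow> p \<in> fixed_space (R x) \<Longrightarrow> T x p = 0 \<Longrightarrow> p = 0"
  shows "\<exists>m>0. \<forall>x\<in>K. \<forall>p\<in>fixed_space (R x). m * norm p \<le> norm (T x p)"
proof -
  have "\<exists>c d. c > 0 \<and> d > 0 \<and> (\<forall>z\<in>K. dist z y < d \<longrightarrow> (\<forall>p\<in>fixed_space (R z). c * norm p \<le> norm (T z p)))"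
    if y: "y \<in> K" for y
  proof -
    obtain c where c: "c > 0" "\<And>p. p \<in> fixed_space (R y) \<Longrightarrow> c * norm p \<le> norm (T y p)"
    proof (rule grassmannian_bounded_below[OF G[OF y], of "\<lambda>p. norm (T y p)"])
      show "continuous_on (fixed_space (R y)) (\<lambda>p. norm (T y p))" by (intro continuous_intros)
      show "norm (T y (a *\<^sub>R v)) = \<bar>a\<bar> * norm (T y v)" for a v by (simp add: blinfun.bilinear_simps)
      show "norm (T y v) > 0" if "v \<in> fixed_space (R y)" "v \<noteq> 0" for v using inj[OF y] that by auto
    qed blast
    have cTR: "continuous_on K (\<lambda>z. T z o\<^sub>L R z)"
      using bounded_bilinear.continuous_on[OF bounded_bilinear_blinfun_compose T R] .
    obtain d1 where d1: "d1 > 0" "\<And>z. z \<in> K \<Longrightarrow> dist z y < d1 \<Longrightarrow> dist (T z o\<^sub>L R z) (T y o\<^sub>L R y) < c / 4"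
      using cTR y c(1) unfolding continuous_on_iff by (metis zero_less_divide_iff zero_less_numeral)
    obtain d2 where d2: "d2 > 0" "\<And>z. z \<in> K \<Longrightarrow> dist z y < d2 \<Longrightarrow> dist (R z) (R y) < 1/2"
      using R y unfolding continuous_on_iff by (metis zero_less_divide_1_iff zero_less_numeral)
    have "c / 4 * norm p \<le> norm (T z p)" if z: "z \<in> K" "dist z y < min d1 d2" and p: "p \<in> fixed_space (R z)" for z p
    proof -
      have Rp: "R z p = p" using p by (simp add: fixed_space_def)
      define p0 where "p0 = R y p"
      have "p - p0 = (R z - R y) p" using Rp by (simp add: p0_def blinfun.bilinear_simps)
      then have "norm (p - p0) \<le> norm (R z - R y) * norm p" by (simp add: norm_blinfun)
      also have "\<dots> \<le> 1/2 * norm p" using d2(2)[OF z(1)] z(2) by (intro mult_right_mono) (auto simp: dist_norm)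
      finally have pp0: "norm p \<le> 2 * norm p0" using norm_triangle_ineq[of "p - p0" p0] by simp
      have p0: "p0 \<in> fixed_space (R y)" using idem[OF y] by (simp add: p0_def fixed_space_def idempotent_def)
      have "c * norm p \<le> c * (2 * norm p0)" using pp0 c(1) by (intro mult_left_mono) auto
      then have 1: "c / 2 * norm p \<le> norm (T y p0)" using c(2)[OF p0] by linarith
      have "T z p - T y p0 = ((T z o\<^sub>L R z) - (T y o\<^sub>L R y)) p"
        using Rp by (simp add: p0_def blinfun.bilinear_simps)
      then have "norm (T z p - T y p0) \<le> norm ((T z o\<^sub>L R z) - (T y o\<^sub>L R y)) * norm p" by (simp add: norm_blinfun)
      also have "\<dots> \<le> c / 4 * norm p" using d1(2)[OF z(1)] z(2) by (intro mult_right_mono) (auto simp: dist_norm)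
      finally have "norm (T y p0) \<le> norm (T z p) + c / 4 * norm p"
        using norm_triangle_ineq4[of "T z p" "T z p - T y p0"] by simp
      then show ?thesis using 1 by (simp add: field_simps)
    qed
    then show ?thesis using c(1) d1(1) d2(1) by (intro exI[of _ "c/4"] exI[of _ "min d1 d2"]) auto
  qed
  then obtain c d where cd: "\<And>y. y \<in> K \<Longrightarrow> c y > (0::real)" "\<And>y. y \<in> K \<Longrightarrow> d y > 0"
    "\<And>y z p. y \<in> K \<Longrightarrow> z \<in> K \<Longrightarrow> dist z y < d y \<Longrightarrow> p \<in> fixed_space (R z) \<Longrightarrow> c y * norm p \<le> norm (T z p)"
    by metis
  obtain D where D: "D \<subseteq> K" "finite D" "K \<subseteq> (\<Union>y\<in>D. ball y (d y))"
    by (rule compactE_image[OF K(1), of K "\<lambda>y. ball y (d y)"]) (use cd(2) in auto)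
  have ne: "D \<noteq> {}" using D(3) K(2) by auto
  define m where "m = Min (c ` D)"
  have "m > 0" unfolding m_def using D ne cd(1) by (subst Min_gr_iff) auto
  moreover have "m * norm p \<le> norm (T x p)" if x: "x \<in> K" and p: "p \<in> fixed_space (R x)" for x p
  proof -
    obtain y where y: "y \<in> D" "dist x y < d y" using D(3) x by (auto simp: dist_commute)
    have "m \<le> c y" unfolding m_def using D y by auto
    then have "m * norm p \<le> c y * norm p" by (intro mult_right_mono) auto
    also have "\<dots> \<le> norm (T x p)" using cd(3)[OF _ x y(2) p] y(1) D(1) by blast
    finally show ?thesis .
  qed
  ultimately show ?thesis by blast
qed

section \<open>Separating bundles described by projections\<close>

text \<open>The content of a separating pair of bundles apart from its continuity and dimension, with
the estimates freed from normalization.\<close>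

definition separating_projections ::
    "'x set \<Rightarrow> ('x \<Rightarrow> 'x) \<Rightarrow> ('x \<Rightarrow> 'a::real_normed_vector \<Rightarrow>\<^sub>L 'a) \<Rightarrow> ('x \<Rightarrow> 'a \<Rightarrow>\<^sub>L 'a)
      \<Rightarrow> real \<Rightarrow> real \<Rightarrow> bool" where
  "separating_projections A f H R M \<gamma> \<longleftrightarrow> M > 0 \<and> 0 < \<gamma> \<and> \<gamma> < 1 \<and> (\<forall>x\<in>A. idempotent (R x) \<and> (\<forall>n.
     (\<forall>v. cocycle_iter f H n x (R x v) = R ((f ^^ n) x) (cocycle_iter f H n x v)) \<and>
     (\<forall>p\<in>fixed_space (R x). cocycle_iter f H n x p = 0 \<longrightarrow> p = 0) \<and>
     cocycle_iter f H n x ` fixed_space (R x) = fixed_space (R ((f ^^ n) x)) \<and>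
     (\<forall>p\<in>fixed_space (R x). \<forall>q\<in>null_space (R x).
       norm (cocycle_iter f H n x q) * norm p \<le> M * \<gamma> ^ n * norm q * norm (cocycle_iter f H n x p))))"

lemma separating_projectionsD:
  assumes "separating_projections A f H R M \<gamma>"
  shows "M > 0" "0 < \<gamma>" "\<gamma> < 1"
    "x \<in> A \<Longrightarrow> idempotent (R x)"
    "x \<in> A \<Longrightarrow> cocycle_iter f H n x (R x v) = R ((f ^^ n) x) (cocycle_iter f H n x v)"
    "x \<in> A \<Longrightarrow> p \<in> fixed_space (R x) \<Longrightarrow> cocycle_iter f H n x p = 0 \<Longrightarrow> p = 0"
    "x \<in> A \<Longrightarrow> cocycle_iter f H n x ` fixed_space (R x) = fixed_space (R ((f ^^ n) x))"
    "x \<in> A \<Longrightarrow> p \<in> fixed_space (R x) \<Longrightarrow> q \<in> null_space (R x) \<Longrightarrow>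
       norm (cocycle_iter f H n x q) * norm p \<le> M * \<gamma> ^ n * norm q * norm (cocycle_iter f H n x p)"
  using assms unfolding separating_projections_def by simp_all

lemma separating_bundles_projections:
  fixes A :: "'x::metric_space set" and H :: "'x \<Rightarrow> 'a::real_normed_vector \<Rightarrow>\<^sub>L 'a"
  assumes k: "k > 0" and sep: "separating_bundles k A f H P Q" and fA: "\<And>x. x \<in> A \<Longrightarrow> f x \<in> A"
  obtains R M \<gamma> where "separating_projections A f H R M \<gamma>" "continuous_on A R"
    "\<And>x. x \<in> A \<Longrightarrow> fixed_space (R x) = P x" "\<And>x. x \<in> A \<Longrightarrow> null_space (R x) = Q x"
proof -
  have P: "continuous_dim_bundle k A P" and Q: "continuous_codim_bundle k A Q"
    and sum: "\<forall>x\<in>A. is_direct_sum (P x) (Q x)"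
    and inv: "\<And>x. x \<in> A \<Longrightarrow> H x ` P x = P (f x)" "\<And>x. x \<in> A \<Longrightarrow> H x ` Q x \<subseteq> Q (f x)"
    using sep unfolding separating_bundles_def by blast+
  have "\<exists>M \<gamma>. M > 0 \<and> 0 < \<gamma> \<and> \<gamma> < 1 \<and>
        (\<forall>x\<in>A. \<forall>v\<in>P x \<inter> sphere 0 1. \<forall>w\<in>Q x \<inter> sphere 0 1. \<forall>n.
           norm (cocycle_iter f H n x w) \<le> M * \<gamma> ^ n * norm (cocycle_iter f H n x v))"
    using sep unfolding separating_bundles_def by (elim conjE)
  then obtain M \<gamma> where M: "M > 0" "0 < \<gamma>" "\<gamma> < 1"
    and dom: "\<forall>x\<in>A. \<forall>v\<in>P x \<inter> sphere 0 1. \<forall>w\<in>Q x \<inter> sphere 0 1. \<forall>n.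
           norm (cocycle_iter f H n x w) \<le> M * \<gamma> ^ n * norm (cocycle_iter f H n x v)"
    by (elim exE conjE)
  obtain R where R: "\<And>x. x \<in> A \<Longrightarrow> idempotent (R x)" "\<And>x. x \<in> A \<Longrightarrow> fixed_space (R x) = P x"
    "\<And>x. x \<in> A \<Longrightarrow> null_space (R x) = Q x" "continuous_on A R"
    using bundle_projections[OF k P Q sum] by blast
  have PG: "P x \<in> grassmannian k" if "x \<in> A" for x using P that by (simp add: continuous_dim_bundle_def)
  have inv1: "H x (R x v) = R (f x) (H x v)" if x: "x \<in> A" for x v
  proof -
    have "R x v \<in> fixed_space (R x)" "v - R x v \<in> null_space (R x)"
      using R(1)[OF x] by (simp_all add: fixed_space_def null_space_def idempotent_def blinfun.bilinear_simps)
    then have "H x (R x v) \<in> P (f x)" "H x (v - R x v) \<in> Q (f x)" using inv[OF x] R(2,3)[OF x] by blast+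
    then have "H x (R x v) \<in> fixed_space (R (f x))" "H x (v - R x v) \<in> null_space (R (f x))"
      using R(2,3)[OF fA[OF x]] by simp_all
    then have "R (f x) (H x (R x v)) = H x (R x v)" "R (f x) (H x (v - R x v)) = 0"
      by (simp_all add: fixed_space_def null_space_def)
    then show ?thesis by (simp add: blinfun.bilinear_simps)
  qed
  have fnA: "(f ^^ n) x \<in> A" if "x \<in> A" for x n using funpow_mem[of A f, OF fA that] .
  have invn: "cocycle_iter f H n x (R x v) = R ((f ^^ n) x) (cocycle_iter f H n x v)" if "x \<in> A" for x n v
    using inv1[OF fnA[OF that]] by (induction n) auto
  have onto: "cocycle_iter f H n x ` P x = P ((f ^^ n) x)" if "x \<in> A" for x n
  proof (induction n)
    case (Suc n)
    have "cocycle_iter f H (Suc n) x ` P x = H ((f ^^ n) x) ` (cocycle_iter f H n x ` P x)"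
      by (simp add: image_image)
    then show ?case using Suc inv(1)[OF fnA[OF that]] by simp
  qed auto
  have inj: "p = 0" if x: "x \<in> A" and p: "p \<in> P x" "cocycle_iter f H n x p = 0" for x n p
  proof -
    have l: "linear (cocycle_iter f H n x)" by (intro linearI) (simp_all add: blinfun.bilinear_simps)
    have "inj_on (cocycle_iter f H n x) (P x)"
      using onto[OF x] PG[OF x] PG[OF fnA[OF x]] l by (intro grassmannian_surj_imp_inj) auto
    then show ?thesis using p linear_inj_on_iff_eq_0[OF l grassmannian_subspace[OF PG[OF x]]] by blast
  qed
  have dom': "norm (cocycle_iter f H n x q) * norm p \<le> M * \<gamma> ^ n * norm q * norm (cocycle_iter f H n x p)"
    if x: "x \<in> A" and p: "p \<in> P x" and q: "q \<in> Q x" for x n p q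
  proof (cases "p = 0 \<or> q = 0")
    case True
    then show ?thesis by (auto simp: blinfun.bilinear_simps)
  next
    case False
    have sP: "subspace (P x)" "subspace (Q x)" using sum x by (auto simp: is_direct_sum_def)
    have "inverse (norm p) *\<^sub>R p \<in> P x \<inter> sphere 0 1" "inverse (norm q) *\<^sub>R q \<in> Q x \<inter> sphere 0 1"
      using False p q sP by (auto simp: subspace_scale)
    with dom x have "norm (cocycle_iter f H n x (inverse (norm q) *\<^sub>R q)) \<le>
        M * \<gamma> ^ n * norm (cocycle_iter f H n x (inverse (norm p) *\<^sub>R p))" by blast
    then have "inverse (norm q) * norm (cocycle_iter f H n x q) \<le>
        M * \<gamma> ^ n * (inverse (norm p) * norm (cocycle_iter f H n x p))"
      by (simp add: blinfun.bilinear_simps)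
    then show ?thesis using False by (simp add: field_simps)
  qed
  have "separating_projections A f H R M \<gamma>"
    unfolding separating_projections_def
  proof (intro conjI ballI allI impI M)
    fix x n assume x: "x \<in> A"
    show "idempotent (R x)" by (rule R(1)[OF x])
    show "cocycle_iter f H n x (R x v) = R ((f ^^ n) x) (cocycle_iter f H n x v)" for v by (rule invn[OF x])
    show "p = 0" if "p \<in> fixed_space (R x)" "cocycle_iter f H n x p = 0" for p
      using inj[OF x] that R(2)[OF x] by blast
    show "cocycle_iter f H n x ` fixed_space (R x) = fixed_space (R ((f ^^ n) x))"
      using onto[OF x] R(2)[OF x] R(2)[OF fnA[OF x]] by simp
    show "norm (cocycle_iter f H n x q) * norm p \<le> M * \<gamma> ^ n * norm q * norm (cocycle_iter f H n x p)"
      if "p \<in> fixed_space (R x)" "q \<in> null_space (R x)" for p q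
      using dom'[OF x] that R(2,3)[OF x] by blast
  qed
  then show ?thesis using that R(2-4) by blast
qed

text \<open>Writing \<open>n = r + N * j\<close> with \<open>r < N\<close>, the remainder costs a constant factor, and the rate per step is the
\<open>N\<close>-th root of the rate \<open>1/2\<close> of the iterate.\<close>

lemma exponential_separation_from_iterate:
  fixes Z :: "'x::metric_space set" and H R :: "'x \<Rightarrow> 'a::real_normed_vector \<Rightarrow>\<^sub>L 'a"
  assumes k: "k > 0" and f: "f ` Z = Z" and R: "continuous_on Z R"
    and G: "\<And>x. x \<in> Z \<Longrightarrow> fixed_space (R x) \<in> grassmannian k"
    and N: "N > 0" and dom: "dominated_splitting Z (f ^^ N) (cocycle_iter f H N) R m (1/2)" "m > 0"
    and inv: "\<And>x v. x \<in> Z \<Longrightarrow> H x (R x v) = R (f x) (H x v)"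
    and c: "0 < c" and lower: "\<And>x p. x \<in> Z \<Longrightarrow> p \<in> fixed_space (R x) \<Longrightarrow> c * norm p \<le> norm (H x p)"
    and B: "\<And>x. x \<in> Z \<Longrightarrow> norm (H x) \<le> B"
  shows "exponential_separation k Z f H"
proof -
  define c' where "c' = min c 1"
  define B' where "B' = max B 1"
  have c': "0 < c'" "c' \<le> 1" "c' \<le> c" using c by (auto simp: c'_def)
  have B': "B' \<ge> 1" "B \<le> B'" by (auto simp: B'_def)
  have fZ: "f x \<in> Z" if "x \<in> Z" for x using f that by blast
  have fnZ: "(f ^^ n) x \<in> Z" if "x \<in> Z" for x n using funpow_mem[of Z f, OF fZ that] .
  have idem: "idempotent (R x)" if "x \<in> Z" for x using dominated_splittingD(2)[OF dom(1) that] .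
  have invP: "H x p \<in> fixed_space (R (f x))" if "x \<in> Z" "p \<in> fixed_space (R x)" for x p
    using inv[OF that(1), of p] that(2) by (simp add: fixed_space_def)
  have lown: "c' ^ n * norm p \<le> norm (cocycle_iter f H n x p) \<and> cocycle_iter f H n x p \<in> fixed_space (R ((f ^^ n) x))"
    if x: "x \<in> Z" and p: "p \<in> fixed_space (R x)" for x p n
  proof (induction n)
    case (Suc n)
    let ?w = "cocycle_iter f H n x p"
    have "c' * (c' ^ n * norm p) \<le> c * norm ?w" using Suc c' by (intro mult_mono) auto
    also have "\<dots> \<le> norm (H ((f ^^ n) x) ?w)" using lower[OF fnZ[OF x]] Suc by blast
    finally show ?case using invP[OF fnZ[OF x]] Suc by (simp add: mult_ac)
  qed (use p in auto)
  have upn: "norm (cocycle_iter f H n x w) \<le> B' ^ n * norm w" if x: "x \<in> Z" for x w n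
  proof (induction n)
    case (Suc n)
    let ?w = "cocycle_iter f H n x w"
    have "norm (H ((f ^^ n) x) ?w) \<le> norm (H ((f ^^ n) x)) * norm ?w" by (rule norm_blinfun)
    also have "\<dots> \<le> B' * (B' ^ n * norm w)"
      using B[OF fnZ[OF x]] B' Suc by (intro mult_mono) (auto intro: order_trans)
    finally show ?case by (simp add: mult_ac)
  qed simp
  define \<gamma> where "\<gamma> = root N (1/2)"
  have \<gamma>: "0 < \<gamma>" "\<gamma> < 1" "\<gamma> ^ N = 1/2" using N by (auto simp: \<gamma>_def)
  define M where "M = 2 * B' ^ N / c' ^ N"
  have M: "M > 0" using B' c' by (simp add: M_def)
  have main: "norm (cocycle_iter f H n x w) \<le> M * \<gamma> ^ n * norm (cocycle_iter f H n x v)"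
    if x: "x \<in> Z" and v: "v \<in> fixed_space (R x) \<inter> sphere 0 1" and w: "w \<in> null_space (R x) \<inter> sphere 0 1"
    for x v w n
  proof -
    define j r where "j = n div N" and "r = n mod N"
    have n: "n = r + N * j" by (simp add: j_def r_def)
    have r: "r < N" using N by (simp add: r_def)
    define y where "y = (f ^^ (N * j)) x"
    have y: "y \<in> Z" unfolding y_def by (rule fnZ[OF x])
    define v' where "v' = cocycle_iter f H (N * j) x v"
    define w' where "w' = cocycle_iter f H (N * j) x w"
    have cv: "cocycle_iter f H n x v = cocycle_iter f H r y v'" and cw: "cocycle_iter f H n x w = cocycle_iter f H r y w'"
      unfolding n cocycle_iter_add by (simp_all add: y_def v'_def w'_def)
    have "dominated_splitting Z ((f ^^ N) ^^ j) (cocycle_iter (f ^^ N) (cocycle_iter f H N) j) R (m ^ j) ((1/2) ^ j)"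
      by (rule dominated_splitting_iter[OF dom]) simp
    from dominated_splittingD(5)[OF this x, of v w] v w
    have wv: "norm w' \<le> (1/2) ^ j * norm v'" by (simp add: cocycle_iter_mult v'_def w'_def)
    have v'fix: "v' \<in> fixed_space (R y)" using lown[OF x] v by (simp add: v'_def y_def)
    have "norm (cocycle_iter f H r y w') \<le> B' ^ r * norm w'" by (rule upn[OF y])
    also have "\<dots> \<le> B' ^ N * norm w'" using B' r by (intro mult_right_mono power_increasing) auto
    also have "\<dots> \<le> B' ^ N * ((1/2) ^ j * norm v')" using wv B' by (intro mult_left_mono) auto
    finally have 1: "norm (cocycle_iter f H r y w') \<le> B' ^ N * (1/2) ^ j * norm v'" by simp
    have "c' ^ N * norm v' \<le> c' ^ r * norm v'" using c' r by (intro mult_right_mono power_decreasing) auto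
    also have "\<dots> \<le> norm (cocycle_iter f H r y v')" using lown[OF y v'fix] by blast
    finally have 2: "norm v' \<le> norm (cocycle_iter f H r y v') / c' ^ N" using c' by (simp add: field_simps)
    have "\<gamma> ^ N \<le> \<gamma> ^ r" using \<gamma> r by (intro power_decreasing) auto
    then have "1/2 * (1/2) ^ j \<le> \<gamma> ^ r * (1/2) ^ j" unfolding \<gamma>(3) by (intro mult_right_mono) auto
    also have "\<dots> = \<gamma> ^ n" unfolding n by (simp add: power_add power_mult \<gamma>(3))
    finally have 3: "(1/2) ^ j \<le> 2 * \<gamma> ^ n" by simp
    have "norm (cocycle_iter f H r y w') \<le> B' ^ N * (1/2) ^ j * (norm (cocycle_iter f H r y v') / c' ^ N)"
      using 1 mult_left_mono[OF 2, of "B' ^ N * (1/2) ^ j"] B' by simp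
    also have "\<dots> \<le> B' ^ N * (2 * \<gamma> ^ n) * (norm (cocycle_iter f H r y v') / c' ^ N)"
      using 3 B' c' by (intro mult_right_mono mult_left_mono) auto
    also have "\<dots> = M * \<gamma> ^ n * norm (cocycle_iter f H r y v')" by (simp add: M_def)
    finally show ?thesis by (simp add: cv cw)
  qed
  have onto: "H x ` fixed_space (R x) = fixed_space (R (f x))" if x: "x \<in> Z" for x
  proof -
    have lin: "linear (H x)" by (intro linearI) (simp_all add: blinfun.bilinear_simps)
    have "p = 0" if "p \<in> fixed_space (R x)" "H x p = 0" for p
      using lower[OF x that(1)] that(2) c by (simp add: mult_le_0_iff)
    then have "inj_on (H x) (fixed_space (R x))"
      using linear_inj_on_iff_eq_0[OF lin subspace_fixed_space] by blast
    then show ?thesis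
      using grassmannian_subset_eq[OF grassmannian_inj_image[OF G[OF x] lin] G[OF fZ[OF x]]] invP[OF x] by blast
  qed
  have "separating_bundles k Z f H (\<lambda>x. fixed_space (R x)) (\<lambda>x. null_space (R x))"
    unfolding separating_bundles_def
  proof (intro conjI ballI)
    show "continuous_dim_bundle k Z (\<lambda>x. fixed_space (R x))"
      by (rule continuous_dim_bundle_fixed_space[OF k idem G R])
    show "continuous_codim_bundle k Z (\<lambda>x. null_space (R x))"
      by (rule continuous_codim_bundle_null_space[OF k idem G R])
    fix x assume x: "x \<in> Z"
    show "is_direct_sum (fixed_space (R x)) (null_space (R x))" by (rule is_direct_sum_projection[OF idem[OF x]])
    show "H x ` fixed_space (R x) = fixed_space (R (f x))" by (rule onto[OF x])
    show "H x ` null_space (R x) \<subseteq> null_space (R (f x))"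
    proof
      fix v assume "v \<in> H x ` null_space (R x)"
      then obtain q where "R x q = 0" "v = H x q" by (auto simp: null_space_def)
      then show "v \<in> null_space (R (f x))" using inv[OF x, of q] by (simp add: null_space_def blinfun.bilinear_simps)
    qed
  next
    show "\<exists>M \<gamma>. M > 0 \<and> 0 < \<gamma> \<and> \<gamma> < 1 \<and>
        (\<forall>x\<in>Z. \<forall>v\<in>fixed_space (R x) \<inter> sphere 0 1. \<forall>w\<in>null_space (R x) \<inter> sphere 0 1. \<forall>n.
           norm (cocycle_iter f H n x w) \<le> M * \<gamma> ^ n * norm (cocycle_iter f H n x v))"
      using M \<gamma>(1,2) main by (intro exI[of _ M] exI[of _ \<gamma>]) simp
  qed
  then show ?thesis unfolding exponential_separation_def by blast
qed

section \<open>Uniqueness over a compact base\<close>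

text \<open>A vector outside the null space eventually behaves like its range component, hence dominates every orbit that
starts in the null space.\<close>

lemma null_space_orbit_dominated:
  fixes A :: "'x::metric_space set" and H R :: "'x \<Rightarrow> 'a::real_normed_vector \<Rightarrow>\<^sub>L 'a"
  assumes R: "separating_projections A f H R M \<gamma>" and x: "x \<in> A" and fn: "\<And>n. (f ^^ n) x \<in> A"
    and C: "\<And>y. y \<in> A \<Longrightarrow> norm (R y) \<le> C"
    and w: "R x w \<noteq> 0" and v: "R x v = 0"
  obtains c where "c \<ge> 0" "\<And>n. norm (cocycle_iter f H n x v) \<le> c * \<gamma> ^ n * norm (cocycle_iter f H n x w)"
    "\<And>n. cocycle_iter f H n x w \<noteq> 0"
proof
  note \<gamma> = separating_projectionsD(1-3)[OF R] and idem = separating_projectionsD(4)[OF R x]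
    and R = separating_projectionsD(5,6,8)[OF R x]
  define p where "p = R x w"
  have p: "p \<in> fixed_space (R x)" "p \<noteq> 0"
    using idem w by (simp_all add: p_def fixed_space_def idempotent_def)
  have C0: "0 \<le> C" using C[OF x] norm_ge_zero order_trans by blast
  show "M * norm v * C / norm p \<ge> 0" using C0 \<gamma> by simp
  show "cocycle_iter f H n x w \<noteq> 0" for n
  proof
    assume "cocycle_iter f H n x w = 0"
    then have "cocycle_iter f H n x p = 0" using R(1)[of n w] by (simp add: p_def blinfun.bilinear_simps)
    then show False using R(2)[OF p(1)] p(2) by blast
  qed
  show "norm (cocycle_iter f H n x v) \<le> M * norm v * C / norm p * \<gamma> ^ n * norm (cocycle_iter f H n x w)" for n
  proof -
    have vn: "v \<in> null_space (R x)" using v by (simp add: null_space_def)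
    have "norm (cocycle_iter f H n x p) \<le> norm (R ((f ^^ n) x)) * norm (cocycle_iter f H n x w)"
      using R(1)[of n w] norm_blinfun by (simp add: p_def)
    also have "\<dots> \<le> C * norm (cocycle_iter f H n x w)" using C[OF fn] by (intro mult_right_mono) auto
    finally have cp: "norm (cocycle_iter f H n x p) \<le> C * norm (cocycle_iter f H n x w)" .
    have "norm (cocycle_iter f H n x v) * norm p \<le> M * \<gamma> ^ n * norm v * norm (cocycle_iter f H n x p)"
      by (rule R(3)[OF p(1) vn])
    also have "\<dots> \<le> M * \<gamma> ^ n * norm v * (C * norm (cocycle_iter f H n x w))"
      using cp \<gamma> by (intro mult_left_mono) auto
    finally show ?thesis using p(2) by (simp add: field_simps)
  qed
qed

text \<open>The null spaces have the same finite codimension: the projection \<open>R'\<close> factors over \<open>R\<close>, so it maps the range of \<open>R\<close>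
onto the range of \<open>R'\<close> and is therefore injective on it.\<close>

lemma null_space_subset_imp_eq:
  fixes R R' :: "'a::real_normed_vector \<Rightarrow>\<^sub>L 'a"
  assumes idem: "idempotent R" "idempotent R'"
    and G: "fixed_space R \<in> grassmannian k" "fixed_space R' \<in> grassmannian k"
    and sub: "null_space R \<subseteq> null_space R'"
  shows "null_space R = null_space R'"
proof -
  have lin: "linear R'" by (intro linearI) (simp_all add: blinfun.bilinear_simps)
  have R'R: "R' (R v) = R' v" for v
  proof -
    have "v - R v \<in> null_space R" using idem by (simp add: idempotent_def null_space_def blinfun.bilinear_simps)
    then have "R' (v - R v) = 0" using sub by (auto simp: null_space_def)
    then show ?thesis by (simp add: blinfun.bilinear_simps)
  qed
  have Rf: "R v \<in> fixed_space R" for v using idem by (simp add: idempotent_def fixed_space_def)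
  have "R' ` fixed_space R = fixed_space R'"
  proof (intro equalityI subsetI)
    fix v assume "v \<in> fixed_space R'"
    then have "v = R' (R v)" using R'R by (simp add: fixed_space_def)
    then show "v \<in> R' ` fixed_space R" using Rf by blast
  qed (use idem in \<open>auto simp: idempotent_def fixed_space_def\<close>)
  then have "inj_on R' (fixed_space R)" using G lin by (intro grassmannian_surj_imp_inj) auto
  then have inj: "v = 0" if "v \<in> fixed_space R" "R' v = 0" for v
    using that linear_inj_on_iff_eq_0[OF lin subspace_fixed_space] by blast
  have "R v = 0" if "v \<in> null_space R'" for v
    using inj[OF Rf[of v]] R'R[of v] that by (simp add: null_space_def)
  then show ?thesis using sub by (auto simp: null_space_def)
qed

text \<open>If neither \<open>Q x\<close> nor \<open>Q' x\<close> contained the other, vectors \<open>v\<close> and \<open>w\<close> in the two differences would each have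
an orbit exponentially smaller than that of the other; equal codimension then gives equality. For the ranges, \<open>P'\<close> is
uniformly transverse to \<open>Q' = Q\<close> since the projections are bounded on the compact base, so that
pulling a vector of \<open>P' x\<close> back along its orbit shows that its component in \<open>Q x\<close> vanishes.\<close>

lemma separating_bundles_unique:
  fixes A :: "'x::metric_space set" and H :: "'x \<Rightarrow> 'a::real_normed_vector \<Rightarrow>\<^sub>L 'a"
  assumes k: "k > 0" and A: "compact A" and f: "f ` A = A"
    and sep: "separating_bundles k A f H P Q" "separating_bundles k A f H P' Q'"
    and x: "x \<in> A"
  shows "P x = P' x" "Q x = Q' x"
proof -
  have fA: "f y \<in> A" if "y \<in> A" for y using f that by blast
  have fnA: "(f ^^ n) y \<in> A" if "y \<in> A" for n y using funpow_mem[of A f, OF fA that] .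
  have "continuous_dim_bundle k A P" using sep(1) unfolding separating_bundles_def by (elim conjE)
  moreover have "continuous_dim_bundle k A P'" using sep(2) unfolding separating_bundles_def by (elim conjE)
  ultimately have PG: "P y \<in> grassmannian k" "P' y \<in> grassmannian k" if "y \<in> A" for y
    using that unfolding continuous_dim_bundle_def by simp_all
  obtain R M \<gamma> where SR: "separating_projections A f H R M \<gamma>" and contR: "continuous_on A R"
    and fixR: "\<And>x. x \<in> A \<Longrightarrow> fixed_space (R x) = P x" and nullR: "\<And>x. x \<in> A \<Longrightarrow> null_space (R x) = Q x"
    using separating_bundles_projections[where f=f, OF k sep(1) fA] by blast
  obtain R' M' \<gamma>' where SR': "separating_projections A f H R' M' \<gamma>'" and contR': "continuous_on A R'"
    and fixR': "\<And>x. x \<in> A \<Longrightarrow> fixed_space (R' x) = P' x" and nullR': "\<And>x. x \<in> A \<Longrightarrow> null_space (R' x) = Q' x"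
    using separating_bundles_projections[where f=f, OF k sep(2) fA] by blast
  note D = separating_projectionsD[OF SR] and D' = separating_projectionsD[OF SR']
  obtain C where C: "\<And>y. y \<in> A \<Longrightarrow> norm (R y) \<le> C" using compact_operator_bound[OF A contR] by blast
  obtain C' where C': "C' \<ge> 1" "\<And>y. y \<in> A \<Longrightarrow> norm (R' y) \<le> C'" using compact_operator_bound[OF A contR'] by blast
  have Qeq: "Q x = Q' x" if x: "x \<in> A" for x
  proof -
    have "Q x \<subseteq> Q' x \<or> Q' x \<subseteq> Q x"
    proof (rule ccontr)
      assume "\<not> ?thesis"
      then obtain v w where v: "v \<in> Q x" "v \<notin> Q' x" and w: "w \<in> Q' x" "w \<notin> Q x" by blast
      have vw: "R x v = 0" "R' x v \<noteq> 0" "R' x w = 0" "R x w \<noteq> 0"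
        using v w nullR[OF x] nullR'[OF x] by (auto simp: null_space_def)
      obtain c where c: "c \<ge> 0" "\<And>n. norm (cocycle_iter f H n x v) \<le> c * \<gamma> ^ n * norm (cocycle_iter f H n x w)"
        "\<And>n. cocycle_iter f H n x w \<noteq> 0"
        by (rule null_space_orbit_dominated[OF SR x _ C vw(4,1)])
          (use fnA[OF x] in blast)+
      obtain c' where c': "c' \<ge> 0" "\<And>n. norm (cocycle_iter f H n x w) \<le> c' * \<gamma>' ^ n * norm (cocycle_iter f H n x v)"
        by (rule null_space_orbit_dominated[OF SR' x _ C'(2) vw(2,3)])
          (use fnA[OF x] in blast)+
      have "1 \<le> (c' * c) * \<gamma> ^ n" for n
      proof -
        have "norm (cocycle_iter f H n x w) \<le> c' * \<gamma>' ^ n * norm (cocycle_iter f H n x v)" by (rule c'(2))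
        also have "\<dots> \<le> c' * 1 * (c * \<gamma> ^ n * norm (cocycle_iter f H n x w))"
          using c c' D'(2,3) by (intro mult_mono power_le_one mult_nonneg_nonneg) auto
        finally have "1 * norm (cocycle_iter f H n x w) \<le> (c' * c * \<gamma> ^ n) * norm (cocycle_iter f H n x w)"
          by (simp add: mult_ac)
        then show ?thesis by (rule mult_right_le_imp_le) (simp add: c(3))
      qed
      then have "(1::real) \<le> 0" using le_geometric_imp_zero D(2,3) by (metis less_eq_real_def)
      then show False by simp
    qed
    then show ?thesis
      using null_space_subset_imp_eq[of "R x" "R' x" k] null_space_subset_imp_eq[of "R' x" "R x" k]
        D(4)[OF x] D'(4)[OF x] fixR[OF x] fixR'[OF x] nullR[OF x] nullR'[OF x] PG[OF x] by auto
  qed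
  show "Q x = Q' x" by (rule Qeq[OF x])
  have "v - R x v = 0" if v: "v \<in> P' x" for v
  proof -
    have "norm (v - R x v) \<le> (M * (1 + C') * norm (R x v)) * \<gamma> ^ n" for n
    proof -
      obtain y where y: "y \<in> A" "(f ^^ n) y = x" using funpow_image_eq[OF f, of n] x by (metis imageE)
      obtain v' where v': "v' \<in> P' y" "cocycle_iter f H n y v' = v" using D'(7)[OF y(1), of n] fixR'[OF y(1)] fixR'[OF x] v y(2) by (metis imageE)
      define p where "p = R y v'"
      define q where "q = v' - p"
      have p: "p \<in> fixed_space (R y)" and q: "q \<in> null_space (R y)"
        using D(4)[OF y(1)] by (simp_all add: p_def q_def fixed_space_def null_space_def idempotent_def blinfun.bilinear_simps)
      have Ap: "cocycle_iter f H n y p = R x v" using D(5)[OF y(1), of n v'] y(2) v'(2) by (simp add: p_def)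
      then have Aq: "cocycle_iter f H n y q = v - R x v" using v'(2) by (simp add: q_def blinfun.bilinear_simps)
      have "q \<in> null_space (R' y)" using q Qeq[OF y(1)] nullR[OF y(1)] nullR'[OF y(1)] by simp
      then have "R' y v' = R' y p" by (simp add: q_def null_space_def blinfun.bilinear_simps)
      moreover have "R' y v' = v'" using v'(1) fixR'[OF y(1)] by (auto simp: fixed_space_def)
      ultimately have vp: "norm v' \<le> C' * norm p"
        using norm_blinfun[of "R' y" p] mult_right_mono[OF C'(2)[OF y(1)] norm_ge_zero[of p]] by simp
      have nq: "norm q \<le> (1 + C') * norm p"
        using vp norm_triangle_ineq4[of v' p] by (simp add: q_def algebra_simps)
      show ?thesis
      proof (cases "p = 0")
        case True
        then have "v' = 0" using vp by simp
        then have "v = 0" using v'(2) by (simp add: blinfun.bilinear_simps)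
        then show ?thesis by (simp add: blinfun.bilinear_simps)
      next
        case False
        have "norm (v - R x v) * norm p \<le> M * \<gamma> ^ n * norm q * norm (R x v)"
          using D(8)[OF y(1) p q, of n] unfolding Ap Aq .
        also have "\<dots> \<le> M * \<gamma> ^ n * ((1 + C') * norm p) * norm (R x v)"
          using nq D(1,2) by (intro mult_right_mono mult_left_mono) auto
        finally have "norm (v - R x v) * norm p \<le> ((M * (1 + C') * norm (R x v)) * \<gamma> ^ n) * norm p"
          by (simp add: mult_ac)
        then show ?thesis by (rule mult_right_le_imp_le) (simp add: False)
      qed
    qed
    then have "norm (v - R x v) \<le> 0" using le_geometric_imp_zero D(2,3) by (metis less_eq_real_def)
    then show ?thesis by simp
  qed
  then have "P' x \<subseteq> P x" unfolding fixR[OF x, symmetric] by (auto simp: fixed_space_def)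
  then show "P x = P' x" using grassmannian_subset_eq[OF PG(2)[OF x] PG(1)[OF x]] by blast
qed

section \<open>Persistence of exponential separation\<close>

text \<open>The quantitative form of the theorem: the iterate supplies the domination, the single step transports the
ranges. The bounds on \<open>r\<close> keep the new
splitting dominated and transverse, and those on \<open>e\<close> and \<open>\<rho>\<close> make the graph transform contract graphs
of norm at most \<open>\<rho>\<close>, which are \<open>8 * C * \<rho>\<close>-close to the reference splitting.\<close>

lemma exponential_separation_persists:
  fixes K :: "'x::metric_space set" and Kt :: "'z::metric_space set"
    and T R0 :: "'x \<Rightarrow> 'a::banach \<Rightarrow>\<^sub>L 'a" and G :: "'z \<Rightarrow> 'a \<Rightarrow>\<^sub>L 'a"
  assumes k: "k > 0" and N: "N > 0"
    and domN: "dominated_splitting K (F ^^ N) (cocycle_iter F T N) R0 m0 \<theta>0" and m0: "m0 > 0" and \<theta>0: "\<theta>0 \<ge> 0"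
    and dom1: "dominated_splitting K F T R0 m1 \<theta>1" and m1: "m1 > 0" and \<theta>1: "\<theta>1 \<ge> 0"
    and GR: "\<And>y. y \<in> K \<Longrightarrow> fixed_space (R0 y) \<in> grassmannian k"
    and C: "0 \<le> C" "\<And>y. y \<in> K \<Longrightarrow> norm (R0 y) \<le> C"
    and B: "1 \<le> B" "\<And>y. y \<in> K \<Longrightarrow> norm (T y) \<le> B" "\<And>y. y \<in> K \<Longrightarrow> norm (cocycle_iter F T N y) \<le> B"
    and \<theta>s: "\<theta>0 \<le> 1/32" "\<theta>0 * (1 + C)^2 \<le> 1/16"
    and r: "0 < r" "r \<le> 1/16" "B * r \<le> m0 / 32" "64 * (C + 2) * (B * r) \<le> m1"
    and e: "0 \<le> e" "e \<le> 1/16" "e \<le> m0 / 32" "64 * (C + 2) * e \<le> m1"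
    and \<rho>: "0 < \<rho>" "\<rho> \<le> 1/4" "8 * C * \<rho> \<le> r" "16 * (1 + C)^3 * ((B + 1 + C) * e) \<le> m0 * \<rho>"
    and hom: "homeomorphism Kt Kt Ft g" and Gc: "continuous_on Kt G" and h: "h ` Kt \<subseteq> K"
    and close: "\<And>x. x \<in> Kt \<Longrightarrow> norm (G x - T (h x)) \<le> e"
      "\<And>x. x \<in> Kt \<Longrightarrow> norm (cocycle_iter Ft G N x - cocycle_iter F T N (h x)) \<le> e"
      "\<And>x. x \<in> Kt \<Longrightarrow> norm (R0 (h (Ft x)) - R0 (F (h x))) \<le> e"
      "\<And>x. x \<in> Kt \<Longrightarrow> norm (R0 (h ((Ft ^^ N) x)) - R0 ((F ^^ N) (h x))) \<le> e"
    and \<delta>: "\<delta> > 0" "\<And>x y. x \<in> Kt \<Longrightarrow> y \<in> Kt \<Longrightarrow> dist x y < \<delta> \<Longrightarrow> norm (R0 (h x) - R0 (h y)) \<le> 1/4"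
  shows "exponential_separation k Kt Ft G"
proof -
  define f where "f = Ft ^^ N"
  define gN where "gN = g ^^ N"
  define A where "A = cocycle_iter Ft G N"
  define A0 where "A0 x = cocycle_iter F T N (h x)" for x
  define P where "P x = R0 (h x)" for x
  define P0 where "P0 x = R0 ((F ^^ N) (h x))" for x
  define E where "E = (B + 1 + C) * e"
  have Ft: "continuous_on Kt Ft" "Ft ` Kt = Kt" "continuous_on Kt g" "\<And>x. x \<in> Kt \<Longrightarrow> Ft (g x) = x"
    "\<And>x. x \<in> Kt \<Longrightarrow> g (Ft x) = x" "g ` Kt = Kt"
    using hom by (auto simp: homeomorphism_def)
  have FtZ: "Ft x \<in> Kt" and gZ: "g x \<in> Kt" if "x \<in> Kt" for x using Ft that by blast+
  have fZ: "f x \<in> Kt" if "x \<in> Kt" for x unfolding f_def using funpow_mem[of Kt Ft, OF FtZ that] .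
  have gNZ: "gN x \<in> Kt" if "x \<in> Kt" for x unfolding gN_def using funpow_mem[of Kt g, OF gZ that] .
  have inv_pow: "(a ^^ n) ((b ^^ n) x) = x" if "x \<in> Kt" "\<And>y. y \<in> Kt \<Longrightarrow> a (b y) = y" "\<And>y. y \<in> Kt \<Longrightarrow> b y \<in> Kt"
    for a b x n
  proof (induction n)
    case (Suc n)
    have "(a ^^ Suc n) ((b ^^ Suc n) x) = (a ^^ n) (a (b ((b ^^ n) x)))" by (simp add: funpow_swap1)
    then show ?case using Suc that(2)[OF funpow_mem[of Kt b, OF that(3,1)]] by simp
  qed simp
  have fg: "f (gN x) = x" and gf: "gN (f x) = x" if "x \<in> Kt" for x
    unfolding f_def gN_def using inv_pow[OF that] Ft(4,5) FtZ gZ by blast+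
  have hK: "h x \<in> K" if "x \<in> Kt" for x using h that by blast
  have idemP: "idempotent (P x)" if "x \<in> Kt" for x unfolding P_def using dominated_splittingD(2)[OF dom1 hK[OF that]] .
  have GP: "fixed_space (P x) \<in> grassmannian k" if "x \<in> Kt" for x unfolding P_def using GR[OF hK[OF that]] .
  have CP: "norm (P x) \<le> C" if "x \<in> Kt" for x unfolding P_def using C(2)[OF hK[OF that]] .
  have CP0: "norm (P0 x) \<le> C" if "x \<in> Kt" for x
    unfolding P0_def using C(2)[OF dominated_splittingD(1)[OF domN hK[OF that]]] .
  have D0: "A0 x (P x v) = P0 x (A0 x v)" if "x \<in> Kt" for x v
    unfolding A0_def P_def P0_def by (rule dominated_splittingD(3)[OF domN hK[OF that]])
  have D0low: "m0 * norm p \<le> norm (A0 x p)" if "x \<in> Kt" "p \<in> fixed_space (P x)" for x p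
    using dominated_splittingD(4)[OF domN hK[OF that(1)]] that(2) unfolding A0_def P_def by blast
  have D0dom: "norm (A0 x q) * norm p \<le> \<theta>0 * norm q * norm (A0 x p)"
    if "x \<in> Kt" "p \<in> fixed_space (P x)" "q \<in> null_space (P x)" for x p q
    using dominated_splittingD(5)[OF domN hK[OF that(1)]] that(2,3) unfolding A0_def P_def by blast
  have D1low: "m1 * norm p \<le> norm (T (h x) p)" if "x \<in> Kt" "p \<in> fixed_space (P x)" for x p
    using dominated_splittingD(4)[OF dom1 hK[OF that(1)]] that(2) unfolding P_def by blast
  have D1dom: "norm (T (h x) q) * norm p \<le> \<theta>1 * norm q * norm (T (h x) p)"
    if "x \<in> Kt" "p \<in> fixed_space (P x)" "q \<in> null_space (P x)" for x p q
    using dominated_splittingD(5)[OF dom1 hK[OF that(1)]] that(2,3) unfolding P_def by blast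
  have AA0: "norm (A x - A0 x) \<le> e" if "x \<in> Kt" for x unfolding A_def A0_def using close(2)[OF that] .
  have An: "norm (A x) \<le> B + 1" if x: "x \<in> Kt" for x
    using norm_triangle_sub[of "A x" "A0 x"] AA0[OF x] e(2) B(3)[OF hK[OF x]] by (simp add: A0_def)
  have eE: "e \<le> E"
    unfolding E_def using mult_right_mono[of 1 "B + 1 + C" e] B(1) C(1) e(1) by simp
  have block: "norm ((P (f x) o\<^sub>L A x) - (P0 x o\<^sub>L A0 x)) \<le> E" if x: "x \<in> Kt" for x
  proof -
    have "(P (f x) o\<^sub>L A x) - (P0 x o\<^sub>L A0 x) = ((P (f x) - P0 x) o\<^sub>L A x) + (P0 x o\<^sub>L (A x - A0 x))"
      by (auto intro!: blinfun_eqI simp: blinfun.bilinear_simps)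
    then have "norm ((P (f x) o\<^sub>L A x) - (P0 x o\<^sub>L A0 x)) \<le>
        norm ((P (f x) - P0 x) o\<^sub>L A x) + norm (P0 x o\<^sub>L (A x - A0 x))"
      by (metis norm_triangle_ineq)
    also have "\<dots> \<le> norm (P (f x) - P0 x) * norm (A x) + norm (P0 x) * norm (A x - A0 x)"
      by (intro add_mono norm_blinfun_compose)
    also have "\<dots> \<le> e * (B + 1) + C * e"
      using close(4)[OF x] An[OF x] CP0[OF x] AA0[OF x] C(1) e(1)
      by (intro add_mono mult_mono) (auto simp: P_def P0_def f_def)
    finally show ?thesis by (simp add: E_def algebra_simps)
  qed
  have E0: "0 \<le> E" using eE e by linarith
  have E3: "16 * (1 + C)^3 * E \<le> m0 * \<rho>" using \<rho>(4) by (simp add: E_def)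
  have m0\<rho>: "m0 * \<rho> \<le> m0 / 4" using mult_left_mono[OF \<rho>(2), of m0] m0 by simp
  have E2: "16 * (1 + C)^2 * E \<le> m0 / 4"
  proof -
    have "(1 + C)^2 \<le> (1 + C)^3" using C(1) by (intro power_increasing) auto
    then have "16 * (1 + C)^2 * E \<le> 16 * (1 + C)^3 * E" using E0 by (intro mult_right_mono mult_left_mono) auto
    then show ?thesis using E3 m0\<rho> by linarith
  qed
  have E1: "E \<le> m0 / 2"
  proof -
    have "1 \<le> (1 + C)^2" using C(1) by simp
    then have "16 * 1 * E \<le> 16 * (1 + C)^2 * E" using E0 by (intro mult_right_mono mult_left_mono) auto
    then show ?thesis using E2 m0 by linarith
  qed
  have small1: "(2 * \<theta>0 + 4 * E / m0) * (1 + C)^2 \<le> 1/4"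
  proof -
    have "4 * E / m0 * (1 + C)^2 \<le> 1/16" using E2 m0 by (simp add: field_simps)
    moreover have "2 * \<theta>0 * (1 + C)^2 \<le> 1/8" using \<theta>s(2) by simp
    ultimately show ?thesis by (simp add: distrib_right)
  qed
  have small2: "2 * E * (1 + C)^3 \<le> m0 / 2 * \<rho> / 4" using E3 by (simp add: mult_ac)
  obtain R where Ridem: "\<And>x. x \<in> Kt \<Longrightarrow> idempotent (R x)"
    and RG: "\<And>x. x \<in> Kt \<Longrightarrow> fixed_space (R x) \<in> grassmannian k"
    and RP': "\<And>x. x \<in> Kt \<Longrightarrow> norm (R x - P x) \<le> 8 * C * \<rho>"
    and Rinv: "\<And>x v. x \<in> Kt \<Longrightarrow> A x (R x v) = R (f x) (A x v)"
  proof (rule invariant_splitting_near[where Z=Kt and f=f and g=gN and A=A and \<P>=P and k=k and C=C and m="m0/2"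
        and \<eta>="2*E" and \<theta>="2 * \<theta>0 + 4 * E / m0" and \<rho>=\<rho>])
    fix x p q assume x: "x \<in> Kt"
    note est = perturbed_block_estimates[of "A0 x" "P x" "P0 x" m0 \<theta>0 "A x" E "P (f x)", OF D0[OF x] idemP[OF x]
        m0 \<theta>0 D0low[OF x] D0dom[OF x] order_trans[OF AA0[OF x] eE] block[OF x] E1]
    have z: "0 \<in> fixed_space (P x)" "0 \<in> null_space (P x)" by (simp_all add: fixed_space_def null_space_def blinfun.bilinear_simps)
    show "m0 / 2 * norm p \<le> norm (P (f x) (A x p))" if "p \<in> fixed_space (P x)" by (rule est(1)[OF _ _ _ that z(2)])
    show "norm (P (f x) (A x q)) \<le> 2 * E * norm q" if "q \<in> null_space (P x)"
    proof -
      have "norm (P (f x) (A x q)) \<le> E * norm q" by (rule est(2)[OF _ _ _ z(1) that])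
      moreover have "0 \<le> E * norm q" using E0 by simp
      ultimately show ?thesis by linarith
    qed
    show "norm (A x p - P (f x) (A x p)) \<le> 2 * E * norm p" if "p \<in> fixed_space (P x)" by (rule est(3)[OF _ _ _ that z(2)])
    show "norm (A x q - P (f x) (A x q)) * norm p \<le> (2 * \<theta>0 + 4 * E / m0) * norm q * norm (P (f x) (A x p))"
      if "p \<in> fixed_space (P x)" "q \<in> null_space (P x)" by (rule est(4)[OF _ _ _ that])
  qed (use fZ gNZ fg gf idemP GP CP C(1) m0 E0 \<theta>0 \<rho> small1 small2 in auto)
  have RP: "norm (R x - P x) \<le> r" if "x \<in> Kt" for x using RP'[OF that] \<rho>(3) by linarith
  have Rn: "norm (R x) \<le> C + 1" if "x \<in> Kt" for x
    using norm_triangle_sub[of "R x" "P x"] RP[OF that] CP[OF that] r(2) by linarith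
  have rh: "r \<le> 1/2" using r by simp
  have sN: "norm (A0 x) * r + e \<le> m0 / 16" if "x \<in> Kt" for x
    using mult_right_mono[OF B(3)[OF hK[OF that]] less_imp_le[OF r(1)]] r(3) e(3) unfolding A0_def by linarith
  have Rdom: "dominated_splitting Kt f A R (m0 / 4) (1/2)"
    unfolding dominated_splitting_def
  proof (intro ballI conjI allI)
    fix x assume x: "x \<in> Kt"
    note pd = perturbed_domination[of "P x" m0 \<theta>0 "A0 x" "A x" e "R x" r "m0/16", OF idemP[OF x] m0 \<theta>0 D0low[OF x] D0dom[OF x]
        AA0[OF x] RP[OF x] rh sN[OF x]]
    have z: "0 \<in> null_space (R x)" by (simp add: null_space_def blinfun.bilinear_simps)
    show "f x \<in> Kt" "idempotent (R x)" by (rule fZ[OF x], rule Ridem[OF x])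
    show "A x (R x v) = R (f x) (A x v)" for v by (rule Rinv[OF x])
    fix p assume p: "p \<in> fixed_space (R x)"
    show "m0 / 4 * norm p \<le> norm (A x p)" using pd(2)[OF _ _ _ _ p z] m0 by simp
    fix q assume q: "q \<in> null_space (R x)"
    have "norm (A x q) * norm p \<le> (8 * \<theta>0 + 4 * (m0 / 16) / m0) * norm q * norm (A x p)"
      using pd(3)[OF _ _ _ _ p q] m0 by simp
    also have "\<dots> \<le> 1/2 * norm q * norm (A x p)"
      using \<theta>s(1) m0 by (intro mult_right_mono) auto
    finally show "norm (A x q) * norm p \<le> 1/2 * norm q * norm (A x p)" .
  qed
  define s where "s = m1 / (32 * (C + 2))"
  have s0: "0 \<le> s" using m1 C(1) by (simp add: s_def)
  have sC: "32 * (C + 2) * s = m1" using C(1) by (simp add: s_def)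
  have s4: "s \<le> m1 / 64"
  proof -
    have "64 * s \<le> 32 * (C + 2) * s" using C(1) s0 by (intro mult_right_mono) auto
    then show ?thesis using sC by simp
  qed
  have s1: "norm (T (h x)) * r + e \<le> s" if "x \<in> Kt" for x
  proof -
    have "64 * (C + 2) * (B * r + e) \<le> m1 + m1" using r(4) e(4) by (simp only: distrib_left)
    moreover have "64 * (C + 2) * s = m1 + m1" using sC by linarith
    ultimately have "(64 * (C + 2)) * (B * r + e) \<le> (64 * (C + 2)) * s" by linarith
    then have "B * r + e \<le> s" by (rule mult_left_le_imp_le) (use C(1) in simp)
    moreover have "norm (T (h x)) * r \<le> B * r" using B(2)[OF hK[OF that]] r(1) by (intro mult_right_mono) auto
    ultimately show ?thesis by linarith
  qed
  have s14: "s \<le> m1 / 4" using s4 m1 by linarith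
  have Glow: "m1 / 4 * norm p \<le> norm (G x p)" and Gnear: "norm (G x p - T (h x) (P x p)) \<le> s * norm p"
    if x: "x \<in> Kt" and p: "p \<in> fixed_space (R x)" for x p
  proof -
    note pd = perturbed_domination[of "P x" m1 \<theta>1 "T (h x)" "G x" e "R x" r s, OF idemP[OF x] m1 \<theta>1 D1low[OF x] D1dom[OF x]
        close(1)[OF x] RP[OF x] rh s1[OF x] s14 p]
    have z: "0 \<in> null_space (R x)" by (simp add: null_space_def blinfun.bilinear_simps)
    show "m1 / 4 * norm p \<le> norm (G x p)" "norm (G x p - T (h x) (P x p)) \<le> s * norm p"
      using pd(1)[OF _ _ _ z] pd(2)[OF _ _ _ z] by simp_all
  qed
  \<comment> \<open>on the new range, \<open>G x p\<close> is close to \<open>w\<close>, which lies exactly in the reference range at \<open>F (h x)\<close>\<close>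
  have trans: "norm (G x p - R (Ft x) (G x p)) \<le> norm (R (Ft x) (G x p))"
    if x: "x \<in> Kt" and p: "p \<in> fixed_space (R x)" for x p
  proof -
    define u where "u = G x p"
    define w where "w = T (h x) (P x p)"
    define Q where "Q = R0 (F (h x))"
    have Qw: "Q w = w"
      using dominated_splittingD(3)[OF dom1 hK[OF x], of "P x p"] idemP[OF x]
      by (simp add: Q_def w_def P_def idempotent_def)
    have uw: "norm (u - w) \<le> s * norm p" unfolding u_def w_def by (rule Gnear[OF x p])
    have pu: "m1 * norm p \<le> 4 * norm u" using Glow[OF x p] by (simp add: u_def)
    have "m1 * ((C + 2) * norm (u - w)) \<le> m1 * ((C + 2) * (s * norm p))"
      using uw m1 C(1) by (intro mult_left_mono) auto
    also have "\<dots> = (C + 2) * s * (m1 * norm p)" by (simp add: mult_ac)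
    also have "\<dots> \<le> (C + 2) * s * (4 * norm u)" using pu C(1) s0 by (intro mult_left_mono) auto
    also have "\<dots> = m1 * (norm u / 8)" unfolding sC[symmetric] by simp
    finally have uw1: "(C + 2) * norm (u - w) \<le> norm u / 8" using m1 by simp
    have uw2: "norm (u - w) \<le> norm u / 8"
      using uw1 mult_right_mono[of 1 "C + 2" "norm (u - w)"] C(1) by simp
    have wn: "norm w \<le> 2 * norm u"
    proof -
      have "norm w \<le> norm u + norm (u - w)" using norm_triangle_ineq4[of u "u - w"] by simp
      then show ?thesis using uw2 norm_ge_zero[of u] by linarith
    qed
    have "norm (R (Ft x) - Q) \<le> norm (R (Ft x) - P (Ft x)) + norm (P (Ft x) - Q)"
      using norm_triangle_ineq[of "R (Ft x) - P (Ft x)" "P (Ft x) - Q"] by simp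
    then have RQ: "norm (R (Ft x) - Q) \<le> 1/8"
      using RP[OF FtZ[OF x]] close(3)[OF x] r(2) e(2) by (simp add: Q_def P_def)
    have Rv: "norm (R (Ft x) v) \<le> (C + 1) * norm v" for v
      using norm_blinfun[of "R (Ft x)" v] mult_right_mono[OF Rn[OF FtZ[OF x]] norm_ge_zero[of v]] by linarith
    have "norm ((Q - R (Ft x)) w) \<le> norm (Q - R (Ft x)) * norm w" by (rule norm_blinfun)
    also have "\<dots> \<le> 1/8 * (2 * norm u)" using RQ wn by (intro mult_mono) (auto simp: norm_minus_commute)
    finally have q: "norm ((Q - R (Ft x)) w) \<le> norm u / 4" by simp
    have "u - R (Ft x) u = ((u - w) - R (Ft x) (u - w)) + (Q - R (Ft x)) w"
      using Qw by (simp add: blinfun.bilinear_simps)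
    then have "norm (u - R (Ft x) u) \<le> norm ((u - w) - R (Ft x) (u - w)) + norm ((Q - R (Ft x)) w)"
      by (metis norm_triangle_ineq)
    moreover have "norm ((u - w) - R (Ft x) (u - w)) \<le> norm (u - w) + (C + 1) * norm (u - w)"
      using norm_triangle_ineq4[of "u - w" "R (Ft x) (u - w)"] Rv[of "u - w"] by linarith
    moreover have "norm (u - w) + (C + 1) * norm (u - w) = (C + 2) * norm (u - w)" by (simp add: algebra_simps)
    ultimately have "norm (u - R (Ft x) u) \<le> norm u / 2" using uw1 q norm_ge_zero[of u] by linarith
    then show ?thesis using norm_triangle_sub[of u "R (Ft x) u"] unfolding u_def by linarith
  qed
  have GB: "norm (G x) \<le> B + 1" if x: "x \<in> Kt" for x
    using norm_triangle_sub[of "G x" "T (h x)"] close(1)[OF x] e(2) B(2)[OF hK[OF x]] by linarith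
  have Ginv: "G x (R x v) = R (Ft x) (G x v)" if x: "x \<in> Kt" for x v
    by (rule dominated_splitting_generator_invariant[OF Ft(2) Rdom[unfolded f_def A_def] _ _ _ RG _ Glow trans GB Rn x])
      (use m0 m1 in auto)
  have Rcont: "continuous_on Kt R"
  proof (rule dominated_splitting_continuous[where f=f and g=gN and A=A and m="m0/4" and \<theta>="1/2" and C="C+1" and \<delta>=\<delta>])
    show "continuous_on Kt f" unfolding f_def by (rule continuous_on_funpow[OF Ft(1) FtZ])
    show "continuous_on Kt gN" unfolding gN_def by (rule continuous_on_funpow[OF Ft(3) gZ])
    show "continuous_on Kt A" unfolding A_def by (rule continuous_on_cocycle_iter[OF Ft(1) FtZ Gc])
    fix x y assume xy: "x \<in> Kt" "y \<in> Kt" "dist x y < \<delta>"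
    have "R x - R y = (R x - P x) - (R y - P y) + (P x - P y)" by simp
    then have "norm (R x - R y) \<le> norm ((R x - P x) - (R y - P y)) + norm (P x - P y)" by (metis norm_triangle_ineq)
    also have "\<dots> \<le> (norm (R x - P x) + norm (R y - P y)) + norm (P x - P y)"
      by (intro add_right_mono norm_triangle_ineq4)
    also have "\<dots> \<le> 1/2" using RP[OF xy(1)] RP[OF xy(2)] \<delta>(2)[OF xy] r(2) by (simp add: P_def)
    finally show "norm (R x - R y) \<le> 1/2" .
  qed (use gNZ fg Rdom m0 RG Rn \<delta> in auto)
  show ?thesis
    by (rule exponential_separation_from_iterate[OF k Ft(2) Rcont RG N Rdom[unfolded f_def A_def] _ Ginv _ Glow GB])
      (use m0 m1 in auto)
qed

lemma perturbationI:
  fixes K :: "'a::real_normed_vector set"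
  assumes "Kt \<subseteq> unit_nbhd K" "h ` Kt \<subseteq> K" "homeomorphism Kt Kt Ft Ft'"
    and h: "(SUP x\<in>Kt. ereal (norm (h x - x))) \<le> ereal d"
    and F: "(SUP x\<in>unit_nbhd K. ereal (norm (Ft x - F x))) \<le> ereal d"
    and T: "(SUP x\<in>unit_nbhd K. ereal (norm (T x - G x))) \<le> ereal d"
  shows "perturbation K F T d Kt h Ft G"
proof -
  have "norm (h x - x) \<le> d" if "x \<in> Kt" for x
    using order_trans[OF SUP_upper[OF that] h] by simp
  moreover have "norm (Ft x - F x) \<le> d" if "x \<in> unit_nbhd K" for x
    using order_trans[OF SUP_upper[OF that] F] by simp
  moreover have "norm (T x - G x) \<le> d" if "x \<in> unit_nbhd K" for x
    using order_trans[OF SUP_upper[OF that] T] by simp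
  ultimately show ?thesis using assms(1-3) by (simp add: perturbation_def homeomorphism_def)
qed

theorem mainTheorem1:
  fixes K :: "'a::banach set" and k :: nat
    and F :: "'a \<Rightarrow> 'a" and T :: "'a \<Rightarrow> 'a \<Rightarrow>\<^sub>L 'a"
  assumes "k > 0"
    and "K \<noteq> {}" and "compact K"
    and "continuous_on (unit_nbhd K) F"
    and "\<exists>F'. homeomorphism K K F F'"
    and "continuous_on (unit_nbhd K) T"
    and "exponential_separation k K F T"
  shows "\<exists>\<epsilon>0 > (0::real). \<exists>\<delta>0 > (0::real). \<forall>\<epsilon>\<in>{0..\<epsilon>0}. \<forall>\<delta>\<in>{0..\<delta>0}.
    \<forall>(Kt :: 'a set) (h :: 'a \<Rightarrow> 'a) (Ft :: 'a \<Rightarrow> 'a) (D :: 'a set) (G :: 'a \<Rightarrow> 'a \<Rightarrow>\<^sub>L 'a).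
      Kt \<noteq> {} \<and> Kt \<subseteq> unit_nbhd K \<and> h ` Kt \<subseteq> K \<and>
      continuous_on (unit_nbhd K) Ft \<and> (\<exists>Ft'. homeomorphism Kt Kt Ft Ft') \<and>
      unit_nbhd K \<subseteq> D \<and> continuous_on D G \<and>
      (SUP x\<in>Kt. ereal (norm (h x - x))) \<le> ereal \<delta> \<and>
      (SUP x\<in>unit_nbhd K. ereal (norm (Ft x - F x))) \<le> ereal \<delta> \<and>
      (SUP x\<in>unit_nbhd K. ereal (norm (T x - G x))) = ereal \<epsilon>
      \<longrightarrow> exponential_separation k Kt Ft G \<and>
          (compact Kt \<longrightarrow> unique_exponential_separation k Kt Ft G)"
proof -
  note k = assms(1) and K0 = assms(2) and K = assms(3)
  have KU: "K \<subseteq> unit_nbhd K" by (rule subset_unit_nbhd)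
  have FK: "F y \<in> K" if "y \<in> K" for y using assms(5) that by (auto simp: homeomorphism_def)
  have Fc: "continuous_on K F" and Tc: "continuous_on K T"
    using continuous_on_subset KU assms(4,6) by blast+
  obtain P Q where sep: "separating_bundles k K F T P Q" using assms(7) by (auto simp: exponential_separation_def)
  obtain R0 M \<gamma> where SR: "separating_projections K F T R0 M \<gamma>" and R0c: "continuous_on K R0"
    and fixR: "\<And>x. x \<in> K \<Longrightarrow> fixed_space (R0 x) = P x" and nullR: "\<And>x. x \<in> K \<Longrightarrow> null_space (R0 x) = Q x"
    using separating_bundles_projections[where f=F, OF k sep FK] by blast
  note D = separating_projectionsD[OF SR]
  have "continuous_dim_bundle k K P" using sep unfolding separating_bundles_def by (elim conjE)
  then have GR: "fixed_space (R0 y) \<in> grassmannian k" if "y \<in> K" for y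
    using that fixR[OF that] by (simp add: continuous_dim_bundle_def)
  obtain C where C: "C \<ge> 1" "\<And>y. y \<in> K \<Longrightarrow> norm (R0 y) \<le> C" using compact_operator_bound[OF K R0c] by blast
  have inj: "p = 0" if "x \<in> K" "p \<in> fixed_space (R0 x)" "T x p = 0" for x p
    using D(6)[OF that(1,2), of "Suc 0"] that(3) unfolding cocycle_iter_1 by blast
  have "\<exists>m>0. \<forall>x\<in>K. \<forall>p\<in>fixed_space (R0 x). m * norm p \<le> norm (T x p)"
    by (rule uniform_lower_bound[OF K K0 Tc R0c D(4) GR inj])
  then obtain m1 where m1: "m1 > 0" "\<And>x p. x \<in> K \<Longrightarrow> p \<in> fixed_space (R0 x) \<Longrightarrow> m1 * norm p \<le> norm (T x p)"
    by blast
  define \<theta>1 where "\<theta>1 = M * \<gamma>"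
  have \<theta>1: "0 \<le> \<theta>1" using D(1,2) by (simp add: \<theta>1_def)
  have dom1: "dominated_splitting K F T R0 m1 \<theta>1"
    unfolding dominated_splitting_def
  proof (intro ballI conjI allI)
    fix x assume x: "x \<in> K"
    show "F x \<in> K" "idempotent (R0 x)" by (rule FK[OF x], rule D(4)[OF x])
    show "T x (R0 x v) = R0 (F x) (T x v)" for v using D(5)[OF x, of "Suc 0"] unfolding cocycle_iter_1 by simp
    fix p assume p: "p \<in> fixed_space (R0 x)"
    show "m1 * norm p \<le> norm (T x p)" by (rule m1(2)[OF x p])
    fix q assume q: "q \<in> null_space (R0 x)"
    show "norm (T x q) * norm p \<le> \<theta>1 * norm q * norm (T x p)"
      using D(8)[OF x p q, of "Suc 0"] unfolding cocycle_iter_1 by (simp add: \<theta>1_def)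
  qed
  \<comment> \<open>\<open>N\<close> is fixed here by the domination that the graph transform and its perturbation need\<close>
  define t where "t = min (1/32) (1 / (16 * (1 + C)^2))"
  have t: "t > 0" using C(1) by (simp add: t_def)
  obtain n where n: "\<gamma> ^ n < t / M" using real_arch_pow_inv[of "t / M" \<gamma>] t D(1,3) by auto
  define N where "N = Suc n"
  define \<theta>0 where "\<theta>0 = M * \<gamma> ^ N"
  have \<theta>0: "0 \<le> \<theta>0" using D(1,2) by (simp add: \<theta>0_def)
  have "\<gamma> ^ N \<le> \<gamma> ^ n" using D(2,3) unfolding N_def by (intro power_decreasing) auto
  then have "M * \<gamma> ^ N \<le> M * (t / M)" using n D(1) by (intro mult_left_mono) auto
  then have \<theta>t: "\<theta>0 \<le> t" using D(1) by (simp add: \<theta>0_def)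
  have \<theta>s: "\<theta>0 \<le> 1/32" "\<theta>0 * (1 + C)^2 \<le> 1/16"
  proof -
    show "\<theta>0 \<le> 1/32" using \<theta>t by (simp add: t_def)
    have "\<theta>0 * (1 + C)^2 \<le> 1 / (16 * (1 + C)^2) * (1 + C)^2"
      using \<theta>t by (intro mult_right_mono) (auto simp: t_def)
    also have "\<dots> = 1/16" using C(1) by simp
    finally show "\<theta>0 * (1 + C)^2 \<le> 1/16" .
  qed
  define m0 where "m0 = m1 ^ N"
  have m0: "m0 > 0" using m1(1) by (simp add: m0_def)
  have domN: "dominated_splitting K (F ^^ N) (cocycle_iter F T N) R0 m0 \<theta>0"
    unfolding dominated_splitting_def
  proof (intro ballI conjI allI)
    fix x assume x: "x \<in> K"
    note DN = dominated_splittingD[OF dominated_splitting_iter[OF dom1 m1(1) \<theta>1, of N] x]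
    show "(F ^^ N) x \<in> K" "idempotent (R0 x)" by (rule DN(1), rule DN(2))
    show "cocycle_iter F T N x (R0 x v) = R0 ((F ^^ N) x) (cocycle_iter F T N x v)" for v by (rule DN(3))
    fix p assume p: "p \<in> fixed_space (R0 x)"
    show "m0 * norm p \<le> norm (cocycle_iter F T N x p)" unfolding m0_def by (rule DN(4)[OF p])
    fix q assume q: "q \<in> null_space (R0 x)"
    show "norm (cocycle_iter F T N x q) * norm p \<le> \<theta>0 * norm q * norm (cocycle_iter F T N x p)"
      unfolding \<theta>0_def by (rule D(8)[OF x p q])
  qed
  obtain B1 where B1: "B1 \<ge> 1" "\<And>y. y \<in> K \<Longrightarrow> norm (T y) \<le> B1" using compact_operator_bound[OF K Tc] by blast
  obtain BN where BN: "BN \<ge> 1" "\<And>y. y \<in> K \<Longrightarrow> norm (cocycle_iter F T N y) \<le> BN"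
    using compact_operator_bound[OF K continuous_on_cocycle_iter[OF Fc FK Tc]] by blast
  define B where "B = max B1 BN"
  have B: "1 \<le> B" "\<And>y. y \<in> K \<Longrightarrow> norm (T y) \<le> B" "\<And>y. y \<in> K \<Longrightarrow> norm (cocycle_iter F T N y) \<le> B"
    using B1 BN by (auto simp: B_def intro: max.coboundedI1 max.coboundedI2)
  define r where "r = Min {1/16, m0 / (32 * B), m1 / (64 * (C + 2) * B)}"
  have "r > 0" using m0 m1(1) B(1) C(1) by (simp add: r_def)
  moreover have "r \<le> 1/16" "r \<le> m0 / (32 * B)" "r \<le> m1 / (64 * (C + 2) * B)"
    unfolding r_def by (rule Min_le; simp)+
  ultimately have r: "0 < r" "r \<le> 1/16" "B * r \<le> m0 / 32" "64 * (C + 2) * (B * r) \<le> m1"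
    using B(1) C(1) by (simp_all add: pos_le_divide_eq mult_ac)
  define \<rho> where "\<rho> = min (1/4) (r / (8 * C))"
  have \<rho>: "0 < \<rho>" "\<rho> \<le> 1/4" "8 * C * \<rho> \<le> r"
  proof -
    show "0 < \<rho>" "\<rho> \<le> 1/4" using r C(1) by (simp_all add: \<rho>_def)
    have "\<rho> \<le> r / (8 * C)" by (simp add: \<rho>_def)
    then show "8 * C * \<rho> \<le> r" using C(1) by (simp add: pos_le_divide_eq mult_ac)
  qed
  define W where "W = 16 * (1 + C)^3 * (B + 1 + C)"
  have W: "W > 0" using B(1) C(1) by (simp add: W_def)
  define e where "e = Min {1/16, m0 / 32, m1 / (64 * (C + 2)), m0 * \<rho> / W}"
  have e0: "e > 0" using m0 m1(1) C(1) \<rho>(1) W by (simp add: e_def)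
  have e34: "e \<le> 1/16" "e \<le> m0 / 32" "e \<le> m1 / (64 * (C + 2))" "e \<le> m0 * \<rho> / W"
    unfolding e_def by (rule Min_le; simp)+
  have e12: "64 * (C + 2) * e \<le> m1" "W * e \<le> m0 * \<rho>"
    using e34(3,4) C(1) W by (simp_all add: pos_le_divide_eq mult_ac)
  have e: "0 \<le> e" "e \<le> 1/16" "e \<le> m0 / 32" "64 * (C + 2) * e \<le> m1"
    using e0 e12(1) e34(1,2) by simp_all
  have \<rho>4: "16 * (1 + C)^3 * ((B + 1 + C) * e) \<le> m0 * \<rho>" using e12(2) by (simp add: W_def mult.assoc)
  have R0u: "uniformly_continuous_on K R0" using compact_uniformly_continuous[OF R0c K] .
  obtain d3 where d3: "d3 > 0" "\<And>x y. x \<in> K \<Longrightarrow> y \<in> K \<Longrightarrow> dist x y < d3 \<Longrightarrow> dist (R0 x) (R0 y) < e"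
    using R0u e0 unfolding uniformly_continuous_on_def by metis
  obtain d5 where d5: "d5 > 0" "\<And>x y. x \<in> K \<Longrightarrow> y \<in> K \<Longrightarrow> dist x y < d5 \<Longrightarrow> dist (R0 x) (R0 y) < 1/4"
    using R0u unfolding uniformly_continuous_on_def by (metis zero_less_divide_1_iff zero_less_numeral)
  have e': "min e d3 > 0" using e0 d3(1) by simp
  have FKs: "F ` K \<subseteq> K" using FK by blast
  obtain d1 where d1: "d1 > 0" "\<And>Kt h Ft G x. perturbation K F T d1 Kt h Ft G \<Longrightarrow> x \<in> Kt \<Longrightarrow>
      dist (h ((Ft ^^ Suc 0) x)) ((F ^^ Suc 0) (h x)) < min e d3 \<and>
      norm (cocycle_iter Ft G (Suc 0) x - cocycle_iter F T (Suc 0) (h x)) < min e d3"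
    using perturbed_iterates_close[OF K assms(4) FKs assms(6) e', of "Suc 0"] by blast
  obtain dN where dN: "dN > 0" "\<And>Kt h Ft G x. perturbation K F T dN Kt h Ft G \<Longrightarrow> x \<in> Kt \<Longrightarrow>
      dist (h ((Ft ^^ N) x)) ((F ^^ N) (h x)) < min e d3 \<and>
      norm (cocycle_iter Ft G N x - cocycle_iter F T N (h x)) < min e d3"
    using perturbed_iterates_close[OF K assms(4) FKs assms(6) e', of N] by blast
  define d where "d = Min {d1, dN, d5 / 4}"
  have d: "d > 0" "d \<le> d1" "d \<le> dN" "d \<le> d5 / 4"
  proof -
    show "d > 0" using d1(1) dN(1) d5(1) by (simp add: d_def)
    show "d \<le> d1" "d \<le> dN" "d \<le> d5 / 4" unfolding d_def by (rule Min_le; simp)+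
  qed
  have main: "exponential_separation k Kt Ft G"
    if per: "perturbation K F T d Kt h Ft G" and hom: "homeomorphism Kt Kt Ft Ft'" and Gc: "continuous_on Kt G"
    for Kt h Ft Ft' G
  proof -
    note c1 = d1(2)[OF perturbation_mono[OF per d(2)], unfolded cocycle_iter_1]
      and cN = dN(2)[OF perturbation_mono[OF per d(3)]]
    have hK: "h ` Kt \<subseteq> K" and hd: "\<And>x. x \<in> Kt \<Longrightarrow> dist (h x) x \<le> d" and FtK: "\<And>x. x \<in> Kt \<Longrightarrow> Ft x \<in> Kt"
      using per by (auto simp: perturbation_def dist_norm)
    have hx: "h x \<in> K" if "x \<in> Kt" for x using hK that by blast
    have FtN: "(Ft ^^ n) x \<in> Kt" if "x \<in> Kt" for x n using funpow_mem[of Kt Ft, OF FtK that] .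
    have FN: "(F ^^ n) x \<in> K" if "x \<in> K" for x n using funpow_mem[of K F, OF FK that] .
    show ?thesis
    proof (rule exponential_separation_persists[OF k _ domN m0 \<theta>0 dom1 m1(1) \<theta>1 GR _ C(2) B \<theta>s r e \<rho> \<rho>4 hom Gc hK,
          where \<delta>="d5/2"])
      fix x assume x: "x \<in> Kt"
      show "norm (G x - T (h x)) \<le> e" using c1[OF x] by simp
      show "norm (cocycle_iter Ft G N x - cocycle_iter F T N (h x)) \<le> e" using cN[OF x] by simp
      have "dist (R0 (h (Ft x))) (R0 (F (h x))) < e"
        using c1[OF x] by (intro d3(2) hx FtK FK x) simp
      then show "norm (R0 (h (Ft x)) - R0 (F (h x))) \<le> e" by (simp add: dist_norm)
      have "dist (R0 (h ((Ft ^^ N) x))) (R0 ((F ^^ N) (h x))) < e"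
        using cN[OF x] by (intro d3(2) hx FtN FN x) simp
      then show "norm (R0 (h ((Ft ^^ N) x)) - R0 ((F ^^ N) (h x))) \<le> e" by (simp add: dist_norm)
      fix y assume y: "y \<in> Kt" "dist x y < d5 / 2"
      have "dist (h x) (h y) \<le> dist (h x) x + dist x y + dist (h y) y"
        using dist_triangle[of "h x" "h y" x] dist_triangle[of x "h y" y] dist_commute[of y "h y"] by linarith
      also have "\<dots> < d5" using hd[OF x] hd[OF y(1)] y(2) d(4) by linarith
      finally have "dist (R0 (h x)) (R0 (h y)) < 1/4" by (intro d5(2) hx x y)
      then show "norm (R0 (h x) - R0 (h y)) \<le> 1/4" by (simp add: dist_norm)
    qed (use d5(1) C(1) in \<open>auto simp: N_def\<close>)
  qed
  show ?thesis
  proof (rule exI[of _ d], intro conjI d(1) exI[of _ d] ballI allI impI)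
    fix \<epsilon> \<delta> :: real and Kt D :: "'a set" and h Ft :: "'a \<Rightarrow> 'a" and G :: "'a \<Rightarrow> 'a \<Rightarrow>\<^sub>L 'a"
    assume \<epsilon>: "\<epsilon> \<in> {0..d}" and \<delta>: "\<delta> \<in> {0..d}"
      and H: "Kt \<noteq> {} \<and> Kt \<subseteq> unit_nbhd K \<and> h ` Kt \<subseteq> K \<and>
      continuous_on (unit_nbhd K) Ft \<and> (\<exists>Ft'. homeomorphism Kt Kt Ft Ft') \<and>
      unit_nbhd K \<subseteq> D \<and> continuous_on D G \<and>
      (SUP x\<in>Kt. ereal (norm (h x - x))) \<le> ereal \<delta> \<and>
      (SUP x\<in>unit_nbhd K. ereal (norm (Ft x - F x))) \<le> ereal \<delta> \<and>
      (SUP x\<in>unit_nbhd K. ereal (norm (T x - G x))) = ereal \<epsilon>"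
    obtain Ft' where hom: "homeomorphism Kt Kt Ft Ft'" using H by blast
    have ed: "ereal \<epsilon> \<le> ereal d" "ereal \<delta> \<le> ereal d" using \<epsilon> \<delta> by auto
    have per: "perturbation K F T d Kt h Ft G"
    proof (rule perturbationI[OF _ _ hom])
      show "Kt \<subseteq> unit_nbhd K" "h ` Kt \<subseteq> K" using H by simp_all
      show "(SUP x\<in>Kt. ereal (norm (h x - x))) \<le> ereal d"
        "(SUP x\<in>unit_nbhd K. ereal (norm (Ft x - F x))) \<le> ereal d"
        using H ed(2) by (blast intro: order_trans)+
      show "(SUP x\<in>unit_nbhd K. ereal (norm (T x - G x))) \<le> ereal d" using H ed(1) by simp
    qed
    have Gc: "continuous_on Kt G" using H by (blast intro: continuous_on_subset)
    show ex: "exponential_separation k Kt Ft G" by (rule main[OF per hom Gc])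
    assume cpt: "compact Kt"
    have im: "Ft ` Kt = Kt" using per by (simp add: perturbation_def)
    show "unique_exponential_separation k Kt Ft G"
      unfolding unique_exponential_separation_def
    proof (rule conjI[OF ex], intro allI impI ballI)
      fix P Q P' Q' x
      assume "separating_bundles k Kt Ft G P Q \<and> separating_bundles k Kt Ft G P' Q'" and x: "x \<in> Kt"
      then have s: "separating_bundles k Kt Ft G P Q" "separating_bundles k Kt Ft G P' Q'" by simp_all
      show "P x = P' x \<and> Q x = Q' x"
        using separating_bundles_unique[OF k cpt im s x] by (rule conjI)
    qed
  qed
qed

end
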